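(* Let $1\le m<n$, and let $\psi$, $\Gamma$, $\varphi_0$, $K$ and $T_\lambda$ be as in the context. There is a constant $C$, depending on the cut-off function $\varphi_0$ (and on $n$, $m$, $K$) but independent of $\lambda$, of $x_{n+1}$ and of $\psi$, such that for every $\lambda>0$ and every $x_{n+1}\in\mathbb{R}$ $$\|T_\lambda\|\le C\,\lambda^{-\frac{m}{2}\frac{n}{n+1}}\,\bigl[1+\|\nabla\psi\|_{L^\infty(\mathbb{R}^n)}\bigr]\,\bigl[1+\|\psi\|_{L^\infty(\mathbb{R}^n)}\bigr].$$
   Context: Let $n\ge1$. Let $\psi\in C^\infty(\mathbb{R}^n)$ be real-valued with $D^\alpha\psi$ bounded on $\mathbb{R}^n$ for every multi-index $\alpha\in\mathbb{Z}^n_+$, and let $\Gamma=\{(y,\psi(y))\in\mathbb{R}^{n+1}: y\in\mathbb{R}^n\}$ with induced surface measure $d\sigma$, i.e. $d\sigma=(1+|\nabla\psi(y)|^2)^{1/2}dy$. Let $\varphi_0\in C_0^\infty(\mathbb{R}^{n+1}\times\mathbb{R}^n)$ be real-valued. Let $K\in C^\infty(\mathbb{R}^{n+1}\setminus\{0\})$ satisfy, for every $\alpha\in\mathbb{Z}^{n+1}_+$, $|D^\alpha K(z)|\le C_\alpha |z|^{m-n-|\alpha|}$ for all $z\in\mathbb{R}^{n+1}\setminus\{0\}$, where $m$ (not necessarily an integer) is the exponent in the claim. For $f\in L^2(\mathbb{R}^n)$, $\lambda>0$ and $(x,x_{n+1})\in\mathbb{R}^n\times\mathbb{R}$ define $$T_\lambda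 f(x,x_{n+1})=\int_\Gamma e^{i\lambda x\cdot y}\,\varphi_0((x,x_{n+1}),y)\,K(x-y,x_{n+1}-y_{n+1})\,f(y)\,d\sigma(y,y_{n+1}),$$ where $y_{n+1}=\psi(y)$ on $\Gamma$. For fixed $x_{n+1}$, $T_\lambda$ is viewed as an operator $f\mapsto T_\lambda f(\cdot,x_{n+1})$ from $L^2(\mathbb{R}^n)$ to $L^2(\mathbb{R}^n)$, and $\|T_\lambda\|$ is its operator norm. *)

theory Defs
  imports "HOL-Analysis.Analysis" "HOL-Probability.Essential_Supremum"
begin

text \<open>Throughout, \<open>real ^ 'n\<close> is $R^n$ with \<open>n = CARD('n)\<close>, and
  \<open>(real ^ 'n) \<times> real\<close>, with its Euclidean norm and product Lebesgue measure, is $R^{n+1}$.\<close>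

section \<open>Smooth functions and multi-index derivatives\<close>

text \<open>The two notions of smoothness below are meant for open sets \<open>S\<close>.\<close>

primrec Ck_on :: "nat \<Rightarrow> ('a::real_normed_vector \<Rightarrow> 'b::real_normed_vector) \<Rightarrow> 'a set \<Rightarrow> bool" where
  "Ck_on 0 f S \<longleftrightarrow> continuous_on S f"
| "Ck_on (Suc k) f S \<longleftrightarrow>
     (\<forall>x\<in>S. f differentiable (at x)) \<and> (\<forall>v. Ck_on k (\<lambda>x. frechet_derivative f (at x) v) S)"

definition smooth_on :: "('a::real_normed_vector \<Rightarrow> 'b::real_normed_vector) \<Rightarrow> 'a set \<Rightarrow> bool" where
  "smooth_on f S \<longleftrightarrow> (\<forall>k. Ck_on k f S)"

definition partial_deriv ::
    "'a::euclidean_space \<Rightarrow> ('a \<Rightarrow> 'b::real_normed_vector) \<Rightarrow> 'a \<Rightarrow> 'b" where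
  "partial_deriv b f = (\<lambda>x. frechet_derivative f (at x) b)"

text \<open>A multi-index is a function \<open>\<alpha> :: 'a \<Rightarrow> nat\<close>, of which only the values on \<open>Basis\<close> matter.
  \<open>multi_deriv\<close> applies the partial derivatives in the order of an arbitrary fixed enumeration
  of \<open>Basis\<close>; for smooth functions the order is irrelevant.\<close>

definition basis_enum :: "'a::euclidean_space list" where
  "basis_enum = (SOME bs. distinct bs \<and> set bs = Basis)"

definition multi_deriv ::
    "('a::euclidean_space \<Rightarrow> nat) \<Rightarrow> ('a \<Rightarrow> 'b::real_normed_vector) \<Rightarrow> 'a \<Rightarrow> 'b" where
  "multi_deriv \<alpha> f = foldr (\<lambda>b. partial_deriv b ^^ \<alpha> b) basis_enum f"

definition multi_order :: "('a::euclidean_space \<Rightarrow> nat) \<Rightarrow> nat" where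
  "multi_order \<alpha> = (\<Sum>b\<in>Basis. \<alpha> b)"

definition grad :: "('a::euclidean_space \<Rightarrow> real) \<Rightarrow> 'a \<Rightarrow> 'a" where
  "grad f x = (\<Sum>b\<in>Basis. partial_deriv b f x *\<^sub>R b)"


section \<open>The spaces \<open>L\<^sup>2\<close> and \<open>L\<^sup>\<infinity>\<close>\<close>

text \<open>Functions represent their almost-everywhere classes.\<close>

definition L2 :: "('a::euclidean_space \<Rightarrow> complex) set" where
  "L2 = {f \<in> borel_measurable lborel. integrable lborel (\<lambda>x. (norm (f x))\<^sup>2)}"

definition L2_norm :: "('a::euclidean_space \<Rightarrow> complex) \<Rightarrow> real" where
  "L2_norm f = sqrt (LINT x|lborel. (norm (f x))\<^sup>2)"

text \<open>The supremum is taken in \<open>ennreal\<close>, so that an unbounded operator has norm \<open>\<infinity>\<close>.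
  This is meaningful only for operators that map \<open>L2\<close> into \<open>L2\<close>.\<close>

definition L2_op_norm ::
    "(('a::euclidean_space \<Rightarrow> complex) \<Rightarrow> 'a \<Rightarrow> complex) \<Rightarrow> ennreal" where
  "L2_op_norm T = (SUP f\<in>{f \<in> L2. L2_norm f \<le> 1}. ennreal (L2_norm (T f)))"

definition Linf_norm :: "('a::euclidean_space \<Rightarrow> 'b::real_normed_vector) \<Rightarrow> ennreal" where
  "Linf_norm g = esssup lborel (\<lambda>x. ennreal (norm (g x)))"


section \<open>The hypersurface and the oscillatory integral operator\<close>

definition hypersurface :: "(real ^ 'n \<Rightarrow> real) \<Rightarrow> ((real ^ 'n) \<times> real) set" where
  "hypersurface \<psi> = {(y, \<psi> y) | y. True}"

definition surface_measure :: "(real ^ 'n \<Rightarrow> real) \<Rightarrow> ((real ^ 'n) \<times> real) measure" where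
  "surface_measure \<psi> =
     distr (density lborel (\<lambda>y. ennreal (sqrt (1 + (norm (grad \<psi> y))\<^sup>2)))) borel (\<lambda>y. (y, \<psi> y))"

definition T_integrand ::
    "((real ^ 'n) \<times> real \<Rightarrow> complex) \<Rightarrow> (((real ^ 'n) \<times> real) \<times> (real ^ 'n) \<Rightarrow> real) \<Rightarrow>
     real \<Rightarrow> (real ^ 'n \<Rightarrow> complex) \<Rightarrow> (real ^ 'n) \<times> real \<Rightarrow> (real ^ 'n) \<times> real \<Rightarrow> complex" where
  "T_integrand K \<phi>\<^sub>0 lam f = (\<lambda>(x, s) (y, t).
     exp (\<i> * of_real (lam * (x \<bullet> y))) * of_real (\<phi>\<^sub>0 ((x, s), y)) * K (x - y, s - t) * f y)"

definition T_op ::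
    "((real ^ 'n) \<times> real \<Rightarrow> complex) \<Rightarrow> (((real ^ 'n) \<times> real) \<times> (real ^ 'n) \<Rightarrow> real) \<Rightarrow>
     (real ^ 'n \<Rightarrow> real) \<Rightarrow> real \<Rightarrow> (real ^ 'n \<Rightarrow> complex) \<Rightarrow> (real ^ 'n) \<times> real \<Rightarrow> complex" where
  "T_op K \<phi>\<^sub>0 \<psi> lam f p =
     (LINT q : hypersurface \<psi> | surface_measure \<psi>. T_integrand K \<phi>\<^sub>0 lam f p q)"

end

theory Submission
  imports Defs
begin

text \<open>
  Let \<open>n\<close> be the dimension of the parameter space and \<open>e = m - n < 0\<close> the order of the singularity of \<open>K\<close>.
  Pulled back to the parameter \<open>y\<close>, the operator is \<open>T f = S (J f)\<close>, where
  \<open>J = sqrt (1 + \<bar>\<nabla>\<psi>\<bar>\<^sup>2) \<le> 1 + \<bar>\<nabla>\<psi>\<bar>\<close> and \<open>S\<close> has the kernel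
  \<open>exp (\<i> \<lambda> x \<bullet> y) \<phi>\<^sub>0 ((x, s), y) K (x - y, s - \<psi> y)\<close>. The density \<open>J\<close> accounts for the gradient in the
  bound, so it suffices to bound \<open>S\<close> by \<open>C \<lambda> powr (- (m / 2) (n / (n + 1)))\<close> with a constant
  that does not see \<open>\<psi>\<close> or \<open>s\<close>. This is possible because all derivatives below fall on \<open>x\<close>, while
  \<open>\<psi>\<close> is a function of \<open>y\<close>, and because \<open>\<bar>K (z, t)\<bar>\<close> and its derivatives are controlled by powers
  of \<open>\<bar>z\<bar>\<close> that are uniform in \<open>t\<close>.

  For \<open>\<lambda> \<le> 1\<close> no decay is claimed: the kernel is dominated by \<open>\<bar>x - y\<bar> powr e\<close> on a bounded set, which
  is integrable in either variable, and Schur's test applies.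

  For \<open>\<lambda> \<ge> 1\<close> the kernel is cut at distance \<open>\<delta> = \<lambda> powr (- n / (2 (n + 1)))\<close> from the diagonal.
  The part within \<open>2 \<delta>\<close> of the diagonal has norm \<open>O(\<delta> powr m)\<close> by Schur's test, and \<open>\<delta> powr m\<close>
  is exactly the rate claimed. For the remaining part \<open>A\<close> the kernel of \<open>A\<^sup>*A\<close> is the oscillatory integral
  \<open>\<integral> exp (\<i> \<lambda> x \<bullet> (y - y')) g(x) dx\<close>, where \<open>g\<close> is the product of two truncated amplitudes and
  vanishes within \<open>\<delta>\<close> of \<open>y\<close> and of \<open>y'\<close>. It is estimated twice. Trivially it is
  \<open>O(\<delta> powr e)\<close>. Integrating by parts \<open>N = n + 1\<close> times along the coordinate axis on which \<open>y - y'\<close> has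
  its largest component gives \<open>O((\<lambda> \<bar>y - y'\<bar>) powr - N \<delta> powr (2 e - N + n))\<close>. Using the first bound
  for \<open>\<bar>y - y'\<bar> < \<rho>\<close> and the second one beyond, with \<open>\<rho> = \<delta> powr (1 + m / n)\<close>, the integral over
  \<open>y'\<close> is \<open>O(\<delta> powr (2 m))\<close>; here \<open>m < n\<close> is used once more. Schur's test for \<open>A\<^sup>*A\<close> then yields
  \<open>\<parallel>A\<parallel> = O(\<delta> powr m)\<close>.

  Differentiating along coordinate axes only has the advantage that just the pure derivatives of \<open>K\<close> occur,
  so that no interchange of mixed partial derivatives is involved. The derivative bounds for products are
  handled by the predicate \<open>symbols\<close>, which is closed under products and is uniform over families of functions.
  The main stations are \<open>schur_test\<close>, \<open>tstar_t_bound\<close>, \<open>oscillatory_integral_bound\<close>,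
  \<open>gram_oscillation_bound\<close>, \<open>far_operator_bound\<close> and \<open>kernel_operator_bound\<close>.
\<close>

section \<open>Integrals of powers of the norm\<close>

lemma nn_integral_translate:
  fixes h :: "'a::euclidean_space \<Rightarrow> ennreal"
  assumes [measurable]: "h \<in> borel_measurable borel"
  shows "(\<integral>\<^sup>+x. h (x - y) \<partial>lborel) = (\<integral>\<^sup>+x. h x \<partial>lborel)"
proof -
  have "(\<integral>\<^sup>+x. h x \<partial>lborel) = (\<integral>\<^sup>+x. h x \<partial>distr lborel borel ((+) (- y)))"
    by (simp add: lborel_distr_plus)
  also have "\<dots> = (\<integral>\<^sup>+x. h (x - y) \<partial>lborel)"
    by (subst nn_integral_distr) auto
  finally show ?thesis ..
qed

text \<open>Both integrals of powers of the norm below reduce to this covering argument: \<open>h\<close> is dominated by a sum of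
  multiples of indicators of balls whose contributions form a geometric series.\<close>

lemma nn_integral_dyadic_le:
  fixes h :: "'a::euclidean_space \<Rightarrow> ennreal" and c \<rho> :: "nat \<Rightarrow> real"
  assumes h: "\<And>z. h z \<noteq> 0 \<Longrightarrow> \<exists>k. norm z \<le> \<rho> k \<and> h z \<le> ennreal (c k)"
    and nonneg: "\<And>k. 0 \<le> c k" "\<And>k. 0 \<le> \<rho> k"
    and geometric: "\<And>k. c k * \<rho> k ^ DIM('a) = B * q ^ k" and q: "0 \<le> q" "q < 1"
  shows "(\<integral>\<^sup>+z. h z \<partial>lborel) \<le> ennreal (unit_ball_vol (DIM('a)) / (1 - q) * B)"
proof -
  let ?V = "unit_ball_vol (real DIM('a))"
  have B: "0 \<le> B"
    using geometric[of 0] nonneg by (metis mult_nonneg_nonneg power_0 mult.right_neutral zero_le_power)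
  have "(\<integral>\<^sup>+z. h z \<partial>lborel) \<le> (\<integral>\<^sup>+z. (\<Sum>k. ennreal (c k) * indicator (cball (0::'a) (\<rho> k)) z) \<partial>lborel)"
  proof (rule nn_integral_mono)
    fix z :: 'a
    show "h z \<le> (\<Sum>k. ennreal (c k) * indicator (cball 0 (\<rho> k)) z)"
    proof (cases "h z = 0")
      case False
      then obtain k where k: "norm z \<le> \<rho> k" "h z \<le> ennreal (c k)" using h by blast
      have "h z \<le> (\<Sum>i\<in>{k}. ennreal (c i) * indicator (cball 0 (\<rho> i)) z)"
        using k by (simp add: indicator_def)
      also have "\<dots> \<le> (\<Sum>k. ennreal (c k) * indicator (cball 0 (\<rho> k)) z)"
        by (rule sum_le_suminf) auto
      finally show ?thesis .
    qed simp
  qed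
  also have "\<dots> = (\<Sum>k. ennreal (c k) * emeasure lborel (cball (0::'a) (\<rho> k)))"
    by (subst nn_integral_suminf) (auto intro!: borel_measurable_times_ennreal borel_measurable_indicator suminf_cong nn_integral_cmult_indicator)
  also have "\<dots> = (\<Sum>k. ennreal (?V * B * q ^ k))"
  proof (rule suminf_cong)
    fix k
    have "ennreal (c k) * emeasure lborel (cball (0::'a) (\<rho> k)) = ennreal (c k * (?V * \<rho> k ^ DIM('a)))"
      using nonneg by (simp add: emeasure_cball ennreal_mult)
    also have "c k * (?V * \<rho> k ^ DIM('a)) = ?V * B * q ^ k"
      using geometric[of k] by (simp add: algebra_simps)
    finally show "ennreal (c k) * emeasure lborel (cball (0::'a) (\<rho> k)) = ennreal (?V * B * q ^ k)" .
  qed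
  also have "\<dots> = ennreal (\<Sum>k. ?V * B * q ^ k)"
    using q B by (intro suminf_ennreal2) (auto intro!: summable_mult summable_geometric)
  also have "(\<Sum>k. ?V * B * q ^ k) = ?V / (1 - q) * B"
    using q by (subst suminf_mult) (auto simp: suminf_geometric summable_geometric)
  finally show ?thesis .
qed

lemma nn_integral_norm_powr_cball:
  fixes e :: real
  assumes e: "- real DIM('a::euclidean_space) < e" "e \<le> 0"
  obtains C where "0 < C" "\<And>r. 0 < r \<Longrightarrow>
    (\<integral>\<^sup>+z. ennreal (indicator (cball (0::'a) r) z * norm z powr e) \<partial>lborel) \<le> ennreal (C * r powr (e + real DIM('a)))"
proof
  let ?n = "real DIM('a)"
  let ?C = "unit_ball_vol ?n / (1 - 2 powr - (e + ?n)) * 2 powr - e"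
  have q1: "2 powr - (e + ?n) < 1"
    using e by (intro powr_less_one) auto
  show "0 < ?C" using q1 by (simp add: unit_ball_vol_pos)
  fix r :: real assume r: "0 < r"
  have "(\<integral>\<^sup>+z. ennreal (indicator (cball (0::'a) r) z * norm z powr e) \<partial>lborel)
      \<le> ennreal (unit_ball_vol ?n / (1 - 2 powr - (e + ?n)) * (2 powr - e * r powr (e + ?n)))"
  proof (rule nn_integral_dyadic_le[where c="\<lambda>k. (r / 2 ^ Suc k) powr e" and \<rho>="\<lambda>k. r / 2 ^ k"])
    fix z :: 'a
    assume "ennreal (indicator (cball 0 r) z * norm z powr e) \<noteq> 0"
    then have z: "norm z \<le> r" "z \<noteq> 0" by (auto simp: indicator_def split: if_splits)
    have ex: "\<exists>k. r / 2 ^ Suc k < norm z"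
    proof -
      obtain k where "r / norm z < 2 ^ k" using real_arch_pow[of 2 "r / norm z"] by auto
      then have "r / 2 ^ k < norm z" using z by (simp add: field_simps)
      moreover have "r / 2 ^ Suc k \<le> r / 2 ^ k" using r by (simp add: field_simps)
      ultimately show ?thesis by (intro exI[of _ k]) linarith
    qed
    \<comment> \<open>the shell \<open>r / 2 ^ (k + 1) < \<bar>z\<bar> \<le> r / 2 ^ k\<close> that contains \<open>z\<close>\<close>
    define k where "k = (LEAST k. r / 2 ^ Suc k < norm z)"
    have k: "r / 2 ^ Suc k < norm z" unfolding k_def by (rule LeastI_ex[OF ex])
    have "norm z \<le> r / 2 ^ k"
    proof (cases k)
      case 0 then show ?thesis using z by simp
    next
      case (Suc j)
      then have "\<not> r / 2 ^ Suc j < norm z" using k_def lessI not_less_Least by metis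
      then show ?thesis using Suc by simp
    qed
    moreover have "norm z powr e \<le> (r / 2 ^ Suc k) powr e"
      using k r e(2) by (intro powr_mono2') auto
    ultimately show "\<exists>k. norm z \<le> r / 2 ^ k \<and>
        ennreal (indicator (cball 0 r) z * norm z powr e) \<le> ennreal ((r / 2 ^ Suc k) powr e)"
      using z by (intro exI[of _ k]) (auto intro!: ennreal_leI)
  next
    fix k
    have "(r / 2 ^ Suc k) powr e * (r / 2 ^ k) ^ DIM('a)
       = (r powr e * 2 powr (- (real k + 1) * e)) * (r powr ?n * 2 powr (- real k * ?n))"
    proof -
      have "r / 2 ^ Suc k = r * 2 powr - (real k + 1)" "r / 2 ^ k = r * 2 powr - real k"
        using powr_realpow[of "2::real" "Suc k"] powr_realpow[of "2::real" k]
        by (simp_all only: powr_minus of_nat_Suc divide_inverse add.commute)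
      moreover have "(r * 2 powr - real k) ^ DIM('a) = (r * 2 powr - real k) powr ?n"
        using r by (simp add: powr_realpow)
      moreover have "(r * 2 powr t) powr a = r powr a * 2 powr (t * a)" for t a
        using r by (simp only: powr_mult powr_powr less_imp_le powr_ge_zero)
      ultimately show ?thesis by (simp only:)
    qed
    also have "\<dots> = 2 powr - e * r powr (e + ?n) * 2 powr (real k * - (e + ?n))"
    proof -
      have "2 powr (- (real k + 1) * e) * 2 powr (- real k * ?n) = 2 powr - e * 2 powr (real k * - (e + ?n))"
        by (simp only: powr_add[symmetric]) (simp add: algebra_simps)
      moreover have "r powr (e + ?n) = r powr e * r powr ?n" by (rule powr_add)
      ultimately show ?thesis by (simp only: ac_simps)
    qed
    also have "2 powr (real k * - (e + ?n)) = (2 powr - (e + ?n)) ^ k"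
      by (rule powr_power[symmetric]) simp
    finally show "(r / 2 ^ Suc k) powr e * (r / 2 ^ k) ^ DIM('a) =
         2 powr - e * r powr (e + ?n) * (2 powr - (e + ?n)) ^ k" .
  qed (use r q1 in auto)
  then show "(\<integral>\<^sup>+z. ennreal (indicator (cball (0::'a) r) z * norm z powr e) \<partial>lborel) \<le> ennreal (?C * r powr (e + ?n))"
    by (simp add: mult.assoc)
qed

text \<open>The exponent \<open>e\<close> lies on the other side of \<open>- n\<close>, so the shells have to grow instead of shrink.\<close>

lemma nn_integral_norm_powr_exterior:
  fixes e :: real
  assumes e: "e < - real DIM('a::euclidean_space)"
  obtains C where "0 < C" "\<And>r. 0 < r \<Longrightarrow>
    (\<integral>\<^sup>+z. ennreal (indicator (- ball (0::'a) r) z * norm z powr e) \<partial>lborel) \<le> ennreal (C * r powr (e + real DIM('a)))"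
proof
  let ?n = "real DIM('a)"
  let ?C = "unit_ball_vol ?n / (1 - 2 powr (e + ?n)) * 2 powr ?n"
  have e0: "e \<le> 0" using e of_nat_0_le_iff[of "DIM('a)", where 'a=real] by linarith
  have q1: "2 powr (e + ?n) < 1"
    using e by (intro powr_less_one) auto
  show "0 < ?C" using q1 by (simp add: unit_ball_vol_pos)
  fix r :: real assume r: "0 < r"
  have "(\<integral>\<^sup>+z. ennreal (indicator (- ball (0::'a) r) z * norm z powr e) \<partial>lborel)
      \<le> ennreal (unit_ball_vol ?n / (1 - 2 powr (e + ?n)) * (2 powr ?n * r powr (e + ?n)))"
  proof (rule nn_integral_dyadic_le[where c="\<lambda>k. (r * 2 ^ k) powr e" and \<rho>="\<lambda>k. r * 2 ^ Suc k"])
    fix z :: 'a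
    assume "ennreal (indicator (- ball 0 r) z * norm z powr e) \<noteq> 0"
    then have z: "r \<le> norm z" by (auto simp: indicator_def split: if_splits)
    have ex: "\<exists>k. norm z \<le> r * 2 ^ Suc k"
    proof -
      obtain k where "norm z / r < 2 ^ k" using real_arch_pow[of 2 "norm z / r"] by auto
      then have "norm z < r * 2 ^ k" using r by (simp add: field_simps)
      moreover have "r * 2 ^ k \<le> r * 2 ^ Suc k" using r by (simp add: field_simps)
      ultimately show ?thesis by (intro exI[of _ k]) linarith
    qed
    define k where "k = (LEAST k. norm z \<le> r * 2 ^ Suc k)"
    have k: "norm z \<le> r * 2 ^ Suc k" unfolding k_def by (rule LeastI_ex[OF ex])
    have k': "r * 2 ^ k \<le> norm z"
    proof (cases k)
      case 0 then show ?thesis using z by simp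
    next
      case (Suc j)
      then have "\<not> norm z \<le> r * 2 ^ Suc j" using k_def lessI not_less_Least by metis
      then show ?thesis using Suc by simp
    qed
    have "norm z powr e \<le> (r * 2 ^ k) powr e"
      using k' r e0 by (intro powr_mono2') auto
    then show "\<exists>k. norm z \<le> r * 2 ^ Suc k \<and>
        ennreal (indicator (- ball 0 r) z * norm z powr e) \<le> ennreal ((r * 2 ^ k) powr e)"
      using z k by (intro exI[of _ k]) (auto intro!: ennreal_leI)
  next
    fix k
    have "(r * 2 ^ k) powr e * (r * 2 ^ Suc k) ^ DIM('a)
       = (r powr e * 2 powr (real k * e)) * (r powr ?n * 2 powr ((real k + 1) * ?n))"
    proof -
      have "(r * 2 ^ k) powr e = r powr e * 2 powr (real k * e)"
        using r by (simp add: powr_mult powr_powr powr_realpow[symmetric])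
      moreover have "(r * 2 ^ Suc k) ^ DIM('a) = r powr ?n * 2 powr ((real k + 1) * ?n)"
      proof -
        have "(r * 2 ^ Suc k) ^ DIM('a) = (r * 2 powr real (Suc k)) powr ?n"
          using r by (simp add: powr_realpow powr_add)
        then show ?thesis using r by (simp add: powr_mult powr_powr algebra_simps)
      qed
      ultimately show ?thesis by simp
    qed
    also have "\<dots> = 2 powr ?n * r powr (e + ?n) * 2 powr (real k * (e + ?n))"
      by (simp add: powr_add distrib_left distrib_right)
    also have "2 powr (real k * (e + ?n)) = (2 powr (e + ?n)) ^ k"
      by (rule powr_power[symmetric]) simp
    finally show "(r * 2 ^ k) powr e * (r * 2 ^ Suc k) ^ DIM('a) =
         2 powr ?n * r powr (e + ?n) * (2 powr (e + ?n)) ^ k" .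
  qed (use r q1 in auto)
  then show "(\<integral>\<^sup>+z. ennreal (indicator (- ball (0::'a) r) z * norm z powr e) \<partial>lborel) \<le> ennreal (?C * r powr (e + ?n))"
    by (simp add: mult.assoc)
qed

text \<open>The Gram kernels below have singularities at two points \<open>y\<close> and \<open>y'\<close>, and their size is controlled by
  one profile placed at each of them.\<close>

lemma integral_norm_le_two_translates:
  fixes h :: "'a::euclidean_space \<Rightarrow> complex" and k :: "'a \<Rightarrow> real"
  assumes [measurable]: "k \<in> borel_measurable borel" and k: "\<And>z. 0 \<le> k z" and D: "0 \<le> D" and I: "0 \<le> I"
    and le: "\<And>x. norm (h x) \<le> D * k (x - y) + D * k (x - y')"
    and int: "(\<integral>\<^sup>+z. ennreal (k z) \<partial>lborel) \<le> ennreal I"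
  shows "(LINT x|lborel. norm (h x)) \<le> 2 * D * I"
proof -
  have shift: "(\<integral>\<^sup>+x. ennreal (D * k (x - z)) \<partial>lborel) \<le> ennreal (D * I)" for z
  proof -
    have "(\<integral>\<^sup>+x. ennreal (D * k (x - z)) \<partial>lborel) = (\<integral>\<^sup>+x. ennreal (D * k x) \<partial>lborel)"
      by (rule nn_integral_translate) simp
    also have "\<dots> = ennreal D * (\<integral>\<^sup>+x. ennreal (k x) \<partial>lborel)"
      using D k by (simp add: ennreal_mult nn_integral_cmult)
    also have "\<dots> \<le> ennreal D * ennreal I" by (rule mult_left_mono[OF int]) simp
    finally show ?thesis using D I by (simp add: ennreal_mult)
  qed
  have "(\<integral>\<^sup>+x. ennreal (norm (h x)) \<partial>lborel) \<le> (\<integral>\<^sup>+x. ennreal (D * k (x - y)) + ennreal (D * k (x - y')) \<partial>lborel)"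
    using D k le by (intro nn_integral_mono) (simp add: ennreal_plus[symmetric] ennreal_leI del: ennreal_plus)
  also have "\<dots> = (\<integral>\<^sup>+x. ennreal (D * k (x - y)) \<partial>lborel) + (\<integral>\<^sup>+x. ennreal (D * k (x - y')) \<partial>lborel)"
    by (rule nn_integral_add) simp_all
  also have "\<dots> \<le> ennreal (D * I) + ennreal (D * I)" by (rule add_mono[OF shift shift])
  also have "\<dots> = ennreal (2 * D * I)" using D I by (simp flip: ennreal_plus)
  finally show ?thesis using D I by (intro integral_real_bounded) auto
qed

section \<open>Schur's test\<close>

lemma L2_measurable: "f \<in> L2 \<Longrightarrow> f \<in> borel_measurable borel"
  by (simp add: L2_def)

lemma nn_integral_norm_power2:
  assumes "f \<in> L2"
  shows "(\<integral>\<^sup>+x. ennreal ((norm (f x))\<^sup>2) \<partial>lborel) = ennreal ((L2_norm f)\<^sup>2)"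
  using assms by (simp add: L2_def L2_norm_def nn_integral_eq_integral)

lemma L2_normI:
  assumes f: "f \<in> borel_measurable borel" and c: "0 \<le> c"
    and le: "(\<integral>\<^sup>+x. ennreal ((norm (f x))\<^sup>2) \<partial>lborel) \<le> ennreal (c\<^sup>2)"
  shows "f \<in> L2" "L2_norm f \<le> c"
proof -
  have "integrable lborel (\<lambda>x. (norm (f x))\<^sup>2)"
    using f le by (intro integrableI_nonneg) (auto intro: le_less_trans)
  then show L2: "f \<in> L2" using f by (simp add: L2_def)
  have "(L2_norm f)\<^sup>2 \<le> c\<^sup>2"
    using le unfolding nn_integral_norm_power2[OF L2] by simp
  then show "L2_norm f \<le> c" using c by (rule power2_le_imp_le)
qed

text \<open>Split \<open>\<kappa> = sqrt \<kappa> * sqrt \<kappa>\<close> and apply the Cauchy-Schwarz inequality to \<open>sqrt \<kappa>\<close> and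
  \<open>sqrt \<kappa> F\<close>; the row integral takes care of the first factor, Tonelli and the column integral of the second.\<close>

lemma schur_test_nn:
  fixes \<kappa> :: "'a::euclidean_space \<Rightarrow> 'a \<Rightarrow> real" and F :: "'a \<Rightarrow> ennreal"
  assumes [measurable]: "(\<lambda>(x, y). \<kappa> x y) \<in> borel_measurable (borel \<Otimes>\<^sub>M borel)"
    and [measurable]: "F \<in> borel_measurable borel"
    and nonneg: "\<And>x y. 0 \<le> \<kappa> x y"
    and row: "\<And>x. (\<integral>\<^sup>+y. \<kappa> x y \<partial>lborel) \<le> a"
    and col: "\<And>y. (\<integral>\<^sup>+x. \<kappa> x y \<partial>lborel) \<le> a"
  shows "(\<integral>\<^sup>+x. (\<integral>\<^sup>+y. \<kappa> x y * F y \<partial>lborel)\<^sup>2 \<partial>lborel) \<le> a\<^sup>2 * (\<integral>\<^sup>+y. (F y)\<^sup>2 \<partial>lborel)"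
proof -
  have "(\<integral>\<^sup>+y. \<kappa> x y * F y \<partial>lborel)\<^sup>2 \<le> a * (\<integral>\<^sup>+y. \<kappa> x y * (F y)\<^sup>2 \<partial>lborel)" for x
  proof -
    have "(\<integral>\<^sup>+y. \<kappa> x y * F y \<partial>lborel)\<^sup>2
        = (\<integral>\<^sup>+y. ennreal (sqrt (\<kappa> x y)) * (ennreal (sqrt (\<kappa> x y)) * F y) \<partial>lborel)\<^sup>2"
      using nonneg by (simp add: mult.assoc[symmetric] ennreal_mult[symmetric])
    also have "\<dots> \<le> (\<integral>\<^sup>+y. (ennreal (sqrt (\<kappa> x y)))\<^sup>2 \<partial>lborel) *
        (\<integral>\<^sup>+y. (ennreal (sqrt (\<kappa> x y)) * F y)\<^sup>2 \<partial>lborel)"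
      by (rule Cauchy_Schwarz_nn_integral) measurable
    also have "\<dots> = (\<integral>\<^sup>+y. \<kappa> x y \<partial>lborel) * (\<integral>\<^sup>+y. \<kappa> x y * (F y)\<^sup>2 \<partial>lborel)"
      using nonneg by (simp add: power_mult_distrib ennreal_power)
    also have "\<dots> \<le> a * (\<integral>\<^sup>+y. \<kappa> x y * (F y)\<^sup>2 \<partial>lborel)"
      by (rule mult_right_mono[OF row]) simp
    finally show ?thesis .
  qed
  then have "(\<integral>\<^sup>+x. (\<integral>\<^sup>+y. \<kappa> x y * F y \<partial>lborel)\<^sup>2 \<partial>lborel)
      \<le> (\<integral>\<^sup>+x. a * (\<integral>\<^sup>+y. \<kappa> x y * (F y)\<^sup>2 \<partial>lborel) \<partial>lborel)"
    by (rule nn_integral_mono)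
  also have "\<dots> = a * (\<integral>\<^sup>+x. (\<integral>\<^sup>+y. \<kappa> x y * (F y)\<^sup>2 \<partial>lborel) \<partial>lborel)"
    by (rule nn_integral_cmult) measurable
  also have "(\<integral>\<^sup>+x. (\<integral>\<^sup>+y. \<kappa> x y * (F y)\<^sup>2 \<partial>lborel) \<partial>lborel)
      = (\<integral>\<^sup>+y. (\<integral>\<^sup>+x. \<kappa> x y * (F y)\<^sup>2 \<partial>lborel) \<partial>lborel)"
    by (rule lborel_pair.Fubini'[symmetric]) simp
  also have "\<dots> = (\<integral>\<^sup>+y. (\<integral>\<^sup>+x. \<kappa> x y \<partial>lborel) * (F y)\<^sup>2 \<partial>lborel)"
    by (intro nn_integral_cong nn_integral_multc) simp
  also have "\<dots> \<le> (\<integral>\<^sup>+y. a * (F y)\<^sup>2 \<partial>lborel)"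
    by (intro nn_integral_mono mult_right_mono col) simp
  also have "\<dots> = a * (\<integral>\<^sup>+y. (F y)\<^sup>2 \<partial>lborel)"
    by (rule nn_integral_cmult) measurable
  finally show ?thesis by (simp add: power2_eq_square mult.assoc mult_left_mono)
qed

text \<open>The domination by \<open>\<kappa>\<close> is only required almost everywhere in \<open>y\<close> because the singular kernels are
  arbitrary on the diagonal.\<close>

lemma schur_test:
  fixes A :: "'a::euclidean_space \<Rightarrow> 'a \<Rightarrow> complex" and \<kappa> :: "'a \<Rightarrow> 'a \<Rightarrow> real"
  assumes [measurable]: "(\<lambda>(x, y). A x y) \<in> borel_measurable (borel \<Otimes>\<^sub>M borel)"
    and [measurable]: "(\<lambda>(x, y). \<kappa> x y) \<in> borel_measurable (borel \<Otimes>\<^sub>M borel)"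
    and A: "\<And>x. AE y in lborel. norm (A x y) \<le> \<kappa> x y"
    and nonneg: "\<And>x y. 0 \<le> \<kappa> x y"
    and row: "\<And>x. (\<integral>\<^sup>+y. \<kappa> x y \<partial>lborel) \<le> ennreal a"
    and col: "\<And>y. (\<integral>\<^sup>+x. \<kappa> x y \<partial>lborel) \<le> ennreal a"
    and a: "0 \<le> a" and f: "f \<in> L2"
  shows "AE x in lborel. integrable lborel (\<lambda>y. A x y * f y)"
    and "(\<lambda>x. LINT y|lborel. A x y * f y) \<in> L2"
    and "L2_norm (\<lambda>x. LINT y|lborel. A x y * f y) \<le> a * L2_norm f"
proof -
  note [measurable] = L2_measurable[OF f]
  let ?I = "\<lambda>x. \<integral>\<^sup>+y. \<kappa> x y * ennreal (norm (f y)) \<partial>lborel"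
  have "(\<integral>\<^sup>+x. (?I x)\<^sup>2 \<partial>lborel) \<le> (ennreal a)\<^sup>2 * (\<integral>\<^sup>+y. (ennreal (norm (f y)))\<^sup>2 \<partial>lborel)"
    by (rule schur_test_nn[OF _ _ nonneg row col]) measurable
  also have "\<dots> = ennreal ((a * L2_norm f)\<^sup>2)"
    using a nn_integral_norm_power2[OF f]
    by (simp add: ennreal_power ennreal_mult[symmetric] power_mult_distrib)
  finally have I: "(\<integral>\<^sup>+x. (?I x)\<^sup>2 \<partial>lborel) \<le> ennreal ((a * L2_norm f)\<^sup>2)" .
  have le: "(\<integral>\<^sup>+y. norm (A x y * f y) \<partial>lborel) \<le> ?I x" for x
    using A[of x] nonneg
    by (intro nn_integral_mono_AE) (auto simp: norm_mult ennreal_mult[symmetric] intro!: ennreal_leI mult_right_mono)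
  have "AE x in lborel. (?I x)\<^sup>2 \<noteq> \<infinity>"
    using I by (intro nn_integral_PInf_AE) (auto simp: top_unique)
  then show "AE x in lborel. integrable lborel (\<lambda>y. A x y * f y)"
  proof (rule AE_mp, intro AE_I2 impI)
    fix x assume "(?I x)\<^sup>2 \<noteq> \<infinity>"
    then have "?I x < \<infinity>" by (auto simp: power2_eq_square ennreal_mult_eq_top_iff less_top)
    then show "integrable lborel (\<lambda>y. A x y * f y)"
      using le[of x] by (intro integrableI_bounded) (auto intro: le_less_trans)
  qed
  have "(\<integral>\<^sup>+x. ennreal ((norm (LINT y|lborel. A x y * f y))\<^sup>2) \<partial>lborel) \<le> (\<integral>\<^sup>+x. (?I x)\<^sup>2 \<partial>lborel)"
  proof (rule nn_integral_mono)
    fix x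
    have "ennreal (norm (LINT y|lborel. A x y * f y)) \<le> ?I x"
    proof (cases "integrable lborel (\<lambda>y. A x y * f y)")
      case True
      then show ?thesis using integral_norm_bound_ennreal le order_trans by blast
    qed (simp add: not_integrable_integral_eq)
    then show "ennreal ((norm (LINT y|lborel. A x y * f y))\<^sup>2) \<le> (?I x)\<^sup>2"
      by (simp add: ennreal_power[symmetric] power_mono)
  qed
  also note I
  finally have *: "(\<integral>\<^sup>+x. ennreal ((norm (LINT y|lborel. A x y * f y))\<^sup>2) \<partial>lborel) \<le> ennreal ((a * L2_norm f)\<^sup>2)" .
  have nn: "0 \<le> a * L2_norm f" using a by (simp add: L2_norm_def)
  show "(\<lambda>x. LINT y|lborel. A x y * f y) \<in> L2" "L2_norm (\<lambda>x. LINT y|lborel. A x y * f y) \<le> a * L2_norm f"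
    using L2_normI[OF _ nn *] by measurable
qed

text \<open>A substitute for the triangle inequality, with the constant 2 coming from \<open>(a + b)\<^sup>2 \<le> 2 a\<^sup>2 + 2 b\<^sup>2\<close>.\<close>

lemma L2_norm_le_of_dominated:
  assumes "h \<in> L2" "f \<in> L2" "g \<in> L2" "AE x in lborel. norm (h x) \<le> norm (f x) + norm (g x)"
  shows "L2_norm h \<le> 2 * (L2_norm f + L2_norm g)"
proof -
  have int: "integrable lborel (\<lambda>x. (norm (u x))\<^sup>2)" if "u \<in> L2" for u :: "'a \<Rightarrow> complex"
    using that by (simp add: L2_def)
  have sq: "(L2_norm u)\<^sup>2 = (LINT x|lborel. (norm (u x))\<^sup>2)" for u :: "'a \<Rightarrow> complex"
    by (simp add: L2_norm_def)
  have nn: "0 \<le> L2_norm u" for u :: "'a \<Rightarrow> complex" by (simp add: L2_norm_def)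
  have "(L2_norm h)\<^sup>2 \<le> (LINT x|lborel. 2 * (norm (f x))\<^sup>2 + 2 * (norm (g x))\<^sup>2)"
    unfolding sq
  proof (rule integral_mono_AE)
    show "AE x in lborel. (norm (h x))\<^sup>2 \<le> 2 * (norm (f x))\<^sup>2 + 2 * (norm (g x))\<^sup>2"
      using assms(4)
    proof (rule AE_mp, intro AE_I2 impI)
      fix x assume "norm (h x) \<le> norm (f x) + norm (g x)"
      then have "(norm (h x))\<^sup>2 \<le> (norm (f x) + norm (g x))\<^sup>2" by (rule power_mono) simp
      moreover have "0 \<le> (norm (f x) - norm (g x))\<^sup>2" by simp
      ultimately show "(norm (h x))\<^sup>2 \<le> 2 * (norm (f x))\<^sup>2 + 2 * (norm (g x))\<^sup>2"
        by (simp add: power2_eq_square algebra_simps)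
    qed
  qed (use int assms in auto)
  also have "\<dots> = 2 * (L2_norm f)\<^sup>2 + 2 * (L2_norm g)\<^sup>2"
    using int assms by (simp add: sq)
  also have "\<dots> \<le> (2 * (L2_norm f + L2_norm g))\<^sup>2"
  proof -
    have "(2 * (a + b))\<^sup>2 = (2 * a\<^sup>2 + 2 * b\<^sup>2) + (2 * a\<^sup>2 + 2 * b\<^sup>2 + 8 * (a * b))" for a b :: real
      by (simp add: power2_eq_square algebra_simps)
    moreover have "0 \<le> 2 * (L2_norm f)\<^sup>2 + 2 * (L2_norm g)\<^sup>2 + 8 * (L2_norm f * L2_norm g)"
      using nn by (intro add_nonneg_nonneg mult_nonneg_nonneg) auto
    ultimately show ?thesis by (simp only: le_add_same_cancel1)
  qed
  finally show ?thesis by (rule power2_le_imp_le) (simp add: nn)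
qed

text \<open>Since \<open>e > - n\<close>, a kernel of size \<open>\<bar>x - y\<bar> powr e\<close> within distance \<open>r\<close> of the diagonal has row
  and column integrals of size \<open>r powr (e + n)\<close>. The constant precedes \<open>r\<close>: the lemma is used both with
  \<open>r\<close> of the size of the support and with the small radius at which the kernel is cut.\<close>

lemma weakly_singular_kernel_bound:
  fixes e :: real
  assumes e: "- real DIM('a::euclidean_space) < e" "e \<le> 0"
  obtains C where "0 < C" "\<And>(A :: 'a \<Rightarrow> 'a \<Rightarrow> complex) B r f.
      (\<lambda>(x, y). A x y) \<in> borel_measurable (borel \<Otimes>\<^sub>M borel) \<Longrightarrow> 0 < r \<Longrightarrow> 0 \<le> B \<Longrightarrow>
      (\<And>x y. x \<noteq> y \<Longrightarrow> norm (A x y) \<le> B * (indicator (cball 0 r) (x - y) * norm (x - y) powr e)) \<Longrightarrow>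
      f \<in> L2 \<Longrightarrow>
      (AE x in lborel. integrable lborel (\<lambda>y. A x y * f y)) \<and>
      (\<lambda>x. LINT y|lborel. A x y * f y) \<in> L2 \<and>
      L2_norm (\<lambda>x. LINT y|lborel. A x y * f y) \<le> C * B * r powr (e + real DIM('a)) * L2_norm f"
proof -
  obtain C where C: "0 < C" and Cr: "\<And>r. 0 < r \<Longrightarrow>
      (\<integral>\<^sup>+z. ennreal (indicator (cball (0::'a) r) z * norm z powr e) \<partial>lborel) \<le> ennreal (C * r powr (e + real DIM('a)))"
    using nn_integral_norm_powr_cball[OF e] by blast
  show ?thesis
  proof (rule that[OF C])
    fix A :: "'a \<Rightarrow> 'a \<Rightarrow> complex" and B r :: real and f :: "'a \<Rightarrow> complex"
    assume A: "(\<lambda>(x, y). A x y) \<in> borel_measurable (borel \<Otimes>\<^sub>M borel)" and r: "0 < r" and B: "0 \<le> B"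
      and bnd: "\<And>x y. x \<noteq> y \<Longrightarrow> norm (A x y) \<le> B * (indicator (cball 0 r) (x - y) * norm (x - y) powr e)"
      and f: "f \<in> L2"
    let ?h = "\<lambda>z::'a. indicator (cball 0 r) z * norm z powr e"
    have [measurable]: "(indicator (cball 0 r) :: 'a \<Rightarrow> real) \<in> borel_measurable borel"
      by (auto intro!: borel_measurable_indicator)
    have int: "(\<integral>\<^sup>+x. ennreal (B * ?h (x - y)) \<partial>lborel) \<le> ennreal (C * B * r powr (e + real DIM('a)))" for y
    proof -
      have "(\<integral>\<^sup>+x. ennreal (B * ?h (x - y)) \<partial>lborel) = ennreal B * (\<integral>\<^sup>+x. ennreal (?h (x - y)) \<partial>lborel)"
        using B by (simp add: ennreal_mult nn_integral_cmult)
      also have "(\<integral>\<^sup>+x. ennreal (?h (x - y)) \<partial>lborel) = (\<integral>\<^sup>+x. ennreal (?h x) \<partial>lborel)"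
        by (rule nn_integral_translate) simp
      also have "ennreal B * \<dots> \<le> ennreal B * ennreal (C * r powr (e + real DIM('a)))"
        by (rule mult_left_mono[OF Cr[OF r]]) simp
      also have "\<dots> = ennreal (C * B * r powr (e + real DIM('a)))"
        using B C by (simp add: ennreal_mult'[symmetric] ac_simps)
      finally show ?thesis .
    qed
    have sym: "?h (x - y) = ?h (y - x)" for x y by (simp add: indicator_def norm_minus_commute)
    note T = schur_test[OF A, where \<kappa>="\<lambda>x y. B * ?h (x - y)" and a="C * B * r powr (e + real DIM('a))" and f=f]
    have P: "(\<lambda>(x, y). B * ?h (x - y)) \<in> borel_measurable (borel \<Otimes>\<^sub>M borel)" by measurable
    have Q: "AE y in lborel. norm (A x y) \<le> B * ?h (x - y)" for x
      using AE_lborel_singleton[of x] by (rule AE_mp, intro AE_I2 impI bnd) auto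
    have row: "(\<integral>\<^sup>+y. ennreal (B * ?h (x - y)) \<partial>lborel) \<le> ennreal (C * B * r powr (e + real DIM('a)))" for x
      using int[of x] by (simp only: sym[of x])
    have nn: "0 \<le> B * ?h (x - y)" for x y using B by simp
    have a: "0 \<le> C * B * r powr (e + real DIM('a))" using B C by simp
    show "(AE x in lborel. integrable lborel (\<lambda>y. A x y * f y)) \<and>
      (\<lambda>x. LINT y|lborel. A x y * f y) \<in> L2 \<and>
      L2_norm (\<lambda>x. LINT y|lborel. A x y * f y) \<le> C * B * r powr (e + real DIM('a)) * L2_norm f"
      using T(1)[OF P Q nn row int a f] T(2)[OF P Q nn row int a f] T(3)[OF P Q nn row int a f] by blast
  qed
qed


section \<open>The T*T method\<close>

lemma borel_measurable_cnj [measurable (raw)]: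
  "f \<in> borel_measurable M \<Longrightarrow> (\<lambda>x. cnj (f x)) \<in> borel_measurable M"
  by (rule measurable_compose[OF _ borel_measurable_continuous_onI]) (auto intro!: continuous_intros)

text \<open>Expanding the square and interchanging the order of integration gives
  \<open>\<integral> \<bar>S f\<bar>\<^sup>2 = \<integral>\<integral> G y y' f(y) cnj (f(y'))\<close> with the Gram kernel
  \<open>G y y' = \<integral> A x y cnj (A x y') dx\<close>; Schur's test for the majorant \<open>\<gamma>\<close> of \<open>G\<close> and
  the Cauchy-Schwarz inequality finish the argument. Boundedness of \<open>A\<close> and of its support serve to
  justify Fubini. The diagonal \<open>y = y'\<close>, on which oscillation gives nothing, is a null set.\<close>

lemma tstar_t_bound:
  fixes A :: "'a::euclidean_space \<Rightarrow> 'a \<Rightarrow> complex" and \<gamma> :: "'a \<Rightarrow> 'a \<Rightarrow> real"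
  assumes [measurable]: "(\<lambda>(x, y). A x y) \<in> borel_measurable (borel \<Otimes>\<^sub>M borel)"
    and [measurable]: "(\<lambda>(y, y'). \<gamma> y y') \<in> borel_measurable (borel \<Otimes>\<^sub>M borel)"
    and B: "\<And>x y. norm (A x y) \<le> B"
    and supp: "\<And>x y. A x y \<noteq> 0 \<Longrightarrow> norm x \<le> R \<and> norm y \<le> R"
    and gram: "\<And>y y'. y \<noteq> y' \<Longrightarrow> norm (LINT x|lborel. A x y * cnj (A x y')) \<le> \<gamma> y y'"
    and nonneg: "\<And>y y'. 0 \<le> \<gamma> y y'"
    and row: "\<And>y. (\<integral>\<^sup>+y'. \<gamma> y y' \<partial>lborel) \<le> ennreal a"
    and col: "\<And>y'. (\<integral>\<^sup>+y. \<gamma> y y' \<partial>lborel) \<le> ennreal a"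
    and a: "0 \<le> a" and f: "f \<in> L2"
  shows "(L2_norm (\<lambda>x. LINT y|lborel. A x y * f y))\<^sup>2 \<le> a * (L2_norm f)\<^sup>2"
proof -
  note [measurable] = L2_measurable[OF f]
  let ?P = "lborel \<Otimes>\<^sub>M lborel :: ('a \<times> 'a) measure"
  have P: "sigma_finite_measure ?P" by (intro sigma_finite_pair_measure sigma_finite_lborel)
  interpret Q: pair_sigma_finite "lborel :: 'a measure" ?P
    by (intro pair_sigma_finite.intro sigma_finite_lborel P)
  define u where "u x y = A x y * f y" for x y
  have [measurable]: "(\<lambda>(x, y). u x y) \<in> borel_measurable (borel \<Otimes>\<^sub>M borel)"
    unfolding u_def by measurable
  have B0: "0 \<le> B" using B[of 0 0] norm_ge_zero order_trans by blast
  \<comment> \<open>\<open>f\<close> itself need not be integrable, but its restriction to a ball containing the support of \<open>A\<close> is\<close>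
  define \<phi> where "\<phi> y = indicator (cball 0 R) y * norm (f y)" for y
  have [measurable]: "\<phi> \<in> borel_measurable borel" unfolding \<phi>_def by (intro borel_measurable_times borel_measurable_indicator) auto
  have [measurable]: "(indicator (cball (0::'a) R) :: 'a \<Rightarrow> real) \<in> borel_measurable borel"
    "(indicator (cball (0::'a) R) :: 'a \<Rightarrow> ennreal) \<in> borel_measurable borel"
    by (auto intro!: borel_measurable_indicator)
  define M where "M = (\<integral>\<^sup>+y. ennreal (\<phi> y) \<partial>lborel)"
  have M: "M < \<infinity>"
  proof -
    have "M \<le> (\<integral>\<^sup>+y. indicator (cball 0 R) y + ennreal ((norm (f y))\<^sup>2) \<partial>lborel)"
      unfolding M_def
    proof (rule nn_integral_mono)
      fix y
      have "norm (f y) \<le> 1 + (norm (f y))\<^sup>2"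
      proof -
        have "0 \<le> (norm (f y) - 1/2)\<^sup>2" by simp
        then show ?thesis by (simp add: power2_eq_square algebra_simps)
      qed
      then have "\<phi> y \<le> indicator (cball 0 R) y + (norm (f y))\<^sup>2"
        by (auto simp: \<phi>_def indicator_def)
      then have "ennreal (\<phi> y) \<le> ennreal (indicator (cball 0 R) y + (norm (f y))\<^sup>2)"
        by (rule ennreal_leI)
      then show "ennreal (\<phi> y) \<le> indicator (cball 0 R) y + ennreal ((norm (f y))\<^sup>2)"
        by (simp add: ennreal_plus ennreal_indicator)
    qed
    also have "\<dots> = emeasure lborel (cball (0::'a) R) + ennreal ((L2_norm f)\<^sup>2)"
      by (subst nn_integral_add) (simp_all add: nn_integral_norm_power2[OF f])
    also have "\<dots> < \<infinity>"
      using emeasure_compact_finite[of "cball (0::'a) R"] by (simp add: emeasure_lborel_cball_finite)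
    finally show ?thesis .
  qed
  have u_le: "norm (u x y) \<le> B * indicator (cball 0 R) x * \<phi> y" for x y
    using B[of x y] supp[of x y] B0
    by (cases "A x y = 0") (auto simp: u_def \<phi>_def norm_mult indicator_def intro!: mult_right_mono)
  have u_le': "norm (u x y) \<le> B * \<phi> y" for x y
    using u_le[of x y] B0 by (cases "x \<in> cball 0 R") (auto simp: indicator_def \<phi>_def split: if_splits)
  have u_int: "integrable lborel (u x)" for x
  proof (rule integrableI_bounded)
    have "(\<integral>\<^sup>+y. ennreal (norm (u x y)) \<partial>lborel) \<le> (\<integral>\<^sup>+y. ennreal B * ennreal (\<phi> y) \<partial>lborel)"
      using u_le' B0 by (intro nn_integral_mono) (auto simp: ennreal_mult'[symmetric] intro!: ennreal_leI)
    also have "\<dots> = ennreal B * M" unfolding M_def by (rule nn_integral_cmult) simp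
    also have "\<dots> < \<infinity>" using M by (simp add: ennreal_mult_less_top)
    finally show "(\<integral>\<^sup>+y. ennreal (norm (u x y)) \<partial>lborel) < \<infinity>" .
  qed (simp add: u_def)
  define H where "H x q = u x (fst q) * cnj (u x (snd q))" for x q
  have Hm [measurable]: "(\<lambda>(x, q). H x q) \<in> borel_measurable (borel \<Otimes>\<^sub>M (borel \<Otimes>\<^sub>M borel))"
    unfolding H_def by measurable
  have H_int: "integrable (lborel \<Otimes>\<^sub>M ?P) (\<lambda>(x, q). H x q)"
  proof (rule integrableI_bounded)
    show "(\<lambda>(x, q). H x q) \<in> borel_measurable (lborel \<Otimes>\<^sub>M ?P)" by measurable
    have "(\<integral>\<^sup>+p. ennreal (norm (case p of (x, q) \<Rightarrow> H x q)) \<partial>(lborel \<Otimes>\<^sub>M ?P))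
        = (\<integral>\<^sup>+x. (\<integral>\<^sup>+q. ennreal (norm (H x q)) \<partial>?P) \<partial>lborel)"
      by (subst sigma_finite_measure.nn_integral_fst[OF P, symmetric]) (simp_all add: split_beta')
    also have "\<dots> = (\<integral>\<^sup>+x. (\<integral>\<^sup>+y. (\<integral>\<^sup>+y'. ennreal (norm (u x y)) * ennreal (norm (u x y')) \<partial>lborel) \<partial>lborel) \<partial>lborel)"
      by (subst sigma_finite_measure.nn_integral_fst[OF sigma_finite_lborel, symmetric]) (simp_all add: H_def norm_mult ennreal_mult)
    also have "\<dots> \<le> (\<integral>\<^sup>+x. (\<integral>\<^sup>+y. (\<integral>\<^sup>+y'. (ennreal (B * indicator (cball (0::'a) R) x) * ennreal (\<phi> y)) *
        (ennreal B * ennreal (\<phi> y')) \<partial>lborel) \<partial>lborel) \<partial>lborel)"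
    proof -
      have "ennreal (norm (u x y)) \<le> ennreal (B * indicator (cball 0 R) x) * ennreal (\<phi> y)" for x y
        using u_le[of x y] B0 by (simp add: ennreal_mult'[symmetric] ennreal_leI)
      moreover have "ennreal (norm (u x y)) \<le> ennreal B * ennreal (\<phi> y)" for x y
        using u_le'[of x y] B0 by (simp add: ennreal_mult'[symmetric] ennreal_leI)
      ultimately show ?thesis by (intro nn_integral_mono mult_mono) auto
    qed
    also have "\<dots> = (\<integral>\<^sup>+x. ennreal B * M * M * ennreal B * indicator (cball (0::'a) R) x \<partial>lborel)"
    proof (rule nn_integral_cong)
      fix x :: 'a
      have "(\<integral>\<^sup>+y. (\<integral>\<^sup>+y'. (ennreal (B * indicator (cball (0::'a) R) x) * ennreal (\<phi> y)) *
          (ennreal B * ennreal (\<phi> y')) \<partial>lborel) \<partial>lborel)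
        = (\<integral>\<^sup>+y. ennreal (B * indicator (cball 0 R) x) * ennreal (\<phi> y) * (ennreal B * M) \<partial>lborel)"
        unfolding M_def by (simp add: nn_integral_cmult)
      also have "\<dots> = ennreal (B * indicator (cball 0 R) x) * M * (ennreal B * M)"
        by (simp add: nn_integral_multc nn_integral_cmult M_def)
      also have "\<dots> = ennreal B * M * M * ennreal B * indicator (cball (0::'a) R) x"
        by (simp add: indicator_def ac_simps)
      finally show "(\<integral>\<^sup>+y. (\<integral>\<^sup>+y'. (ennreal (B * indicator (cball (0::'a) R) x) * ennreal (\<phi> y)) *
          (ennreal B * ennreal (\<phi> y')) \<partial>lborel) \<partial>lborel) = ennreal B * M * M * ennreal B * indicator (cball (0::'a) R) x" .
    qed
    also have "\<dots> = ennreal B * M * M * ennreal B * emeasure lborel (cball (0::'a) R)"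
      by (rule nn_integral_cmult_indicator) simp
    also have "\<dots> < \<infinity>"
      using M emeasure_lborel_cball_finite[of "0::'a" R] by (simp add: ennreal_mult_less_top)
    finally show "(\<integral>\<^sup>+p. ennreal (norm (case p of (x, q) \<Rightarrow> H x q)) \<partial>(lborel \<Otimes>\<^sub>M ?P)) < \<infinity>" .
  qed
  define S where "S x = (LINT y|lborel. u x y)" for x
  define G where "G y y' = (LINT x|lborel. A x y * cnj (A x y'))" for y y'
  have inner: "(LINT q|?P. H x q) = complex_of_real ((norm (S x))\<^sup>2)" for x
  proof -
    have "integrable ?P (H x)"
    proof (rule lborel_pair.Fubini_integrable)
      show "integrable lborel (\<lambda>y. LINT y'|lborel. norm (H x (y, y')))"
        using u_int[of x] by (simp add: H_def norm_mult)
      show "AE y in lborel. integrable lborel (\<lambda>y'. H x (y, y'))"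
        using u_int[of x] by (simp add: H_def)
    qed measurable
    then have "(LINT q|?P. H x q) = (LINT y|lborel. LINT y'|lborel. H x (y, y'))"
      by (rule lborel_pair.integral_fst'[symmetric])
    also have "\<dots> = S x * cnj (S x)"
      by (simp add: H_def S_def)
    finally show ?thesis by (simp only: complex_norm_square)
  qed
  have outer: "(LINT x|lborel. H x q) = G (fst q) (snd q) * (f (fst q) * cnj (f (snd q)))" for q
  proof -
    have "(LINT x|lborel. H x q)
        = (LINT x|lborel. (A x (fst q) * cnj (A x (snd q))) * (f (fst q) * cnj (f (snd q))))"
      by (simp add: H_def u_def ac_simps)
    then show ?thesis by (simp add: G_def)
  qed
  have swap: "(LINT x|lborel. complex_of_real ((norm (S x))\<^sup>2))
      = (LINT q|?P. G (fst q) (snd q) * (f (fst q) * cnj (f (snd q))))"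
    using Q.Fubini_integral[OF H_int] by (simp add: inner outer)
  have Gm [measurable]: "(\<lambda>(y, y'). G y y') \<in> borel_measurable (borel \<Otimes>\<^sub>M borel)"
    unfolding G_def by measurable
  let ?J = "\<lambda>y. \<integral>\<^sup>+y'. ennreal (\<gamma> y y') * ennreal (norm (f y')) \<partial>lborel"
  have "0 \<le> (LINT x|lborel. (norm (S x))\<^sup>2)" by simp
  then have "ennreal ((L2_norm S)\<^sup>2) = ennreal (norm (LINT x|lborel. complex_of_real ((norm (S x))\<^sup>2)))"
    by (simp only: L2_norm_def integral_complex_of_real norm_of_real real_sqrt_pow2 abs_of_nonneg)
  also have "\<dots> \<le> (\<integral>\<^sup>+q. ennreal (norm (G (fst q) (snd q) * (f (fst q) * cnj (f (snd q))))) \<partial>?P)"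
    unfolding swap
  proof (cases "integrable ?P (\<lambda>q. G (fst q) (snd q) * (f (fst q) * cnj (f (snd q))))")
    case True
    then show "ennreal (norm (LINT q|?P. G (fst q) (snd q) * (f (fst q) * cnj (f (snd q)))))
        \<le> (\<integral>\<^sup>+q. ennreal (norm (G (fst q) (snd q) * (f (fst q) * cnj (f (snd q))))) \<partial>?P)"
      by (rule integral_norm_bound_ennreal)
  qed (simp add: not_integrable_integral_eq)
  also have "\<dots> = (\<integral>\<^sup>+y. (\<integral>\<^sup>+y'. ennreal (norm (G y y')) * (ennreal (norm (f y)) * ennreal (norm (f y'))) \<partial>lborel) \<partial>lborel)"
    by (subst sigma_finite_measure.nn_integral_fst[OF sigma_finite_lborel, symmetric]) (simp_all add: norm_mult ennreal_mult)
  also have "\<dots> \<le> (\<integral>\<^sup>+y. ennreal (norm (f y)) * ?J y \<partial>lborel)"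
  proof (rule nn_integral_mono)
    fix y
    have "(\<integral>\<^sup>+y'. ennreal (norm (G y y')) * (ennreal (norm (f y)) * ennreal (norm (f y'))) \<partial>lborel)
       \<le> (\<integral>\<^sup>+y'. ennreal (norm (f y)) * (ennreal (\<gamma> y y') * ennreal (norm (f y'))) \<partial>lborel)"
    proof (rule nn_integral_mono_AE)
      show "AE y' in lborel. ennreal (norm (G y y')) * (ennreal (norm (f y)) * ennreal (norm (f y')))
          \<le> ennreal (norm (f y)) * (ennreal (\<gamma> y y') * ennreal (norm (f y')))"
        using AE_lborel_singleton[of y]
      proof (rule AE_mp, intro AE_I2 impI)
        fix y' assume "y' \<noteq> y"
        then have "ennreal (norm (G y y')) \<le> ennreal (\<gamma> y y')"
          using gram[of y y'] by (auto simp: G_def intro!: ennreal_leI)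
        then show "ennreal (norm (G y y')) * (ennreal (norm (f y)) * ennreal (norm (f y')))
          \<le> ennreal (norm (f y)) * (ennreal (\<gamma> y y') * ennreal (norm (f y')))"
          by (simp add: mult.left_commute mult_left_mono mult_right_mono)
      qed
    qed
    then show "(\<integral>\<^sup>+y'. ennreal (norm (G y y')) * (ennreal (norm (f y)) * ennreal (norm (f y'))) \<partial>lborel)
       \<le> ennreal (norm (f y)) * ?J y"
      by (simp add: nn_integral_cmult)
  qed
  finally have 1: "ennreal ((L2_norm S)\<^sup>2) \<le> (\<integral>\<^sup>+y. ennreal (norm (f y)) * ?J y \<partial>lborel)" .
  have "(ennreal ((L2_norm S)\<^sup>2))\<^sup>2 \<le> (\<integral>\<^sup>+y. ennreal (norm (f y)) * ?J y \<partial>lborel)\<^sup>2"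
    by (rule power_mono[OF 1]) simp
  also have "\<dots> \<le> (\<integral>\<^sup>+y. (ennreal (norm (f y)))\<^sup>2 \<partial>lborel) * (\<integral>\<^sup>+y. (?J y)\<^sup>2 \<partial>lborel)"
    by (rule Cauchy_Schwarz_nn_integral) measurable
  also have "\<dots> \<le> (\<integral>\<^sup>+y. (ennreal (norm (f y)))\<^sup>2 \<partial>lborel) *
      ((ennreal a)\<^sup>2 * (\<integral>\<^sup>+y. (ennreal (norm (f y)))\<^sup>2 \<partial>lborel))"
    by (intro mult_left_mono schur_test_nn nonneg row col) auto
  also have "\<dots> = ennreal ((a * (L2_norm f)\<^sup>2)\<^sup>2)"
    using a nn_integral_norm_power2[OF f]
    by (simp add: ennreal_power ennreal_mult[symmetric] power2_eq_square ac_simps)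
  finally have "((L2_norm S)\<^sup>2)\<^sup>2 \<le> (a * (L2_norm f)\<^sup>2)\<^sup>2"
    by (simp add: ennreal_power)
  then have "(L2_norm S)\<^sup>2 \<le> a * (L2_norm f)\<^sup>2"
    using a by (intro power2_le_imp_le[of "(L2_norm S)\<^sup>2"]) auto
  moreover have "S = (\<lambda>x. LINT y|lborel. A x y * f y)"
    unfolding S_def u_def[abs_def] ..
  ultimately show ?thesis by simp
qed


section \<open>Families of symbols\<close>

text \<open>Only derivatives in one fixed direction \<open>v\<close> occur in the integrations by parts, so the calculus is set up for
  these alone.\<close>

abbreviation has_dir_deriv ::
    "'a::real_normed_vector \<Rightarrow> ('a \<Rightarrow> complex) \<Rightarrow> complex \<Rightarrow> 'a \<Rightarrow> bool" where
  "has_dir_deriv v f d x \<equiv> ((\<lambda>t::real. f (x + t *\<^sub>R v)) has_vector_derivative d) (at 0)"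

definition dir_deriv :: "'a::real_normed_vector \<Rightarrow> ('a \<Rightarrow> complex) \<Rightarrow> 'a \<Rightarrow> complex" where
  "dir_deriv v f x = vector_derivative (\<lambda>t::real. f (x + t *\<^sub>R v)) (at 0)"

lemma dir_deriv_eqI: "has_dir_deriv v f d x \<Longrightarrow> dir_deriv v f x = d"
  unfolding dir_deriv_def by (rule vector_derivative_at)

lemma has_dir_deriv_dir_deriv: "has_dir_deriv v f d x \<Longrightarrow> has_dir_deriv v f (dir_deriv v f x) x"
  using dir_deriv_eqI by metis

lemma eventually_line_in_open:
  fixes x v :: "'a::real_normed_vector"
  assumes "open U" "x \<in> U"
  shows "eventually (\<lambda>t::real. x + t *\<^sub>R v \<in> U) (nhds 0)"
proof -
  have "((\<lambda>t::real. x + t *\<^sub>R v) \<longlongrightarrow> x + 0 *\<^sub>R v) (nhds 0)"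
    by (intro tendsto_add tendsto_const tendsto_scaleR filterlim_ident)
  then show ?thesis using topological_tendstoD[OF _ assms(1)] assms(2) by simp
qed

lemma has_dir_deriv_cong:
  assumes "open U" "x \<in> U" "\<And>x. x \<in> U \<Longrightarrow> f x = g x"
  shows "has_dir_deriv v f d x \<longleftrightarrow> has_dir_deriv v g d x"
  using assms eventually_mono[OF eventually_line_in_open[OF assms(1,2), of v]]
  by (intro has_vector_derivative_cong_ev) (auto simp: eventually_mono[OF eventually_line_in_open[OF assms(1,2), of v]])

lemma dir_deriv_cong:
  assumes "open U" "x \<in> U" "\<And>x. x \<in> U \<Longrightarrow> f x = g x"
  shows "dir_deriv v f x = dir_deriv v g x"
  unfolding dir_deriv_def vector_derivative_def
  by (rule arg_cong[where f=Eps], rule ext, rule has_dir_deriv_cong[OF assms])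

text \<open>The derivatives of a function inherit its zeros on open sets; this is how the support of an amplitude is
  passed on to the integrand that is left after the integrations by parts.\<close>

lemma dir_deriv_iterate_zero:
  assumes "open V" "\<And>x. x \<in> V \<Longrightarrow> f x = 0" "x \<in> V"
  shows "(dir_deriv v ^^ i) f x = 0"
  using assms(3)
proof (induction i arbitrary: x)
  case (Suc i)
  have "has_dir_deriv v ((dir_deriv v ^^ i) f) 0 x"
    using has_dir_deriv_cong[OF assms(1) Suc.prems, of "(dir_deriv v ^^ i) f" "\<lambda>_. 0" v 0] Suc.IH by simp
  then show ?case by (simp add: dir_deriv_eqI)
qed (use assms in auto)

definition weight_bounded ::
    "'p set \<Rightarrow> ('p \<Rightarrow> 'a::euclidean_space set) \<Rightarrow> ('p \<Rightarrow> 'a \<Rightarrow> real) \<Rightarrow> real \<Rightarrow> ('p \<Rightarrow> 'a \<Rightarrow> complex) \<Rightarrow> bool" where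
  "weight_bounded P U w e F \<longleftrightarrow>
     (\<exists>C\<ge>0. \<forall>p\<in>P. \<forall>x\<in>U p. norm (F p x) \<le> C * w p x powr e) \<and> (\<forall>p\<in>P. continuous_on (U p) (F p))"

text \<open>A family \<open>F p\<close>, \<open>p \<in> P\<close>, is a family of symbols of order \<open>e\<close> if its \<open>i\<close>-th derivatives in the
  direction \<open>v\<close> are \<open>O(w powr (e - i))\<close> on the open sets \<open>U p\<close> for \<open>i \<le> k\<close>. The bound \<open>C\<close> is chosen
  before \<open>p\<close>. With the parameters of the problem packed into \<open>p\<close>, this is what makes the final
  constant independent of them without ever computing it.\<close>

primrec symbols ::
    "'a::euclidean_space \<Rightarrow> 'p set \<Rightarrow> ('p \<Rightarrow> 'a set) \<Rightarrow> ('p \<Rightarrow> 'a \<Rightarrow> real) \<Rightarrow> nat \<Rightarrow> real \<Rightarrow>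
     ('p \<Rightarrow> 'a \<Rightarrow> complex) \<Rightarrow> bool" where
  "symbols v P U w 0 e F \<longleftrightarrow> weight_bounded P U w e F"
| "symbols v P U w (Suc k) e F \<longleftrightarrow>
     weight_bounded P U w e F \<and> (\<forall>p\<in>P. \<forall>x\<in>U p. has_dir_deriv v (F p) (dir_deriv v (F p) x) x) \<and>
     symbols v P U w k (e - 1) (\<lambda>p. dir_deriv v (F p))"

lemma symbols_unfold:
  "symbols v P U w 0 e F \<longleftrightarrow>
     (\<exists>C\<ge>0. \<forall>p\<in>P. \<forall>x\<in>U p. norm (F p x) \<le> C * w p x powr e) \<and> (\<forall>p\<in>P. continuous_on (U p) (F p))"
  "symbols v P U w (Suc k) e F \<longleftrightarrow>
     symbols v P U w 0 e F \<and> (\<forall>p\<in>P. \<forall>x\<in>U p. has_dir_deriv v (F p) (dir_deriv v (F p) x) x) \<and>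
     symbols v P U w k (e - 1) (\<lambda>p. dir_deriv v (F p))"
  by (auto simp: weight_bounded_def)

declare symbols.simps [simp del]

lemma symbols_0: "symbols v P U w k e F \<Longrightarrow> symbols v P U w 0 e F"
  by (cases k) (auto simp: symbols_unfold)

lemma symbols_SucD: "symbols v P U w (Suc k) e F \<Longrightarrow> symbols v P U w k e F"
  by (induction k arbitrary: e F) (auto simp: symbols_unfold)

lemma symbols_iterate:
  assumes "symbols v P U w k e F" "i \<le> k"
  shows "symbols v P U w (k - i) (e - real i) (\<lambda>p. (dir_deriv v ^^ i) (F p))"
  using assms
proof (induction i)
  case (Suc i)
  then have "symbols v P U w (Suc (k - Suc i)) (e - real i) (\<lambda>p. (dir_deriv v ^^ i) (F p))"
    by (simp add: Suc_diff_Suc)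
  then show ?case by (simp add: symbols_unfold algebra_simps)
qed simp

lemma symbols_bound:
  "symbols v P U w k e F \<Longrightarrow> \<exists>C\<ge>0. \<forall>p\<in>P. \<forall>x\<in>U p. norm (F p x) \<le> C * w p x powr e"
  by (drule symbols_0) (simp add: symbols_unfold)

lemma symbols_continuous: "symbols v P U w k e F \<Longrightarrow> p \<in> P \<Longrightarrow> continuous_on (U p) (F p)"
  by (drule symbols_0) (simp add: symbols_unfold)

lemma symbols_has_dir_deriv:
  "symbols v P U w (Suc k) e F \<Longrightarrow> p \<in> P \<Longrightarrow> x \<in> U p \<Longrightarrow> has_dir_deriv v (F p) (dir_deriv v (F p) x) x"
  by (simp add: symbols_unfold)

text \<open>For \<open>e \<le> 0\<close> a smaller weight makes a weaker condition. This allows two families with different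
  singularities to be compared with the common weight given by the distance to the nearer one, and then to be
  multiplied.\<close>

lemma symbols_reweight:
  assumes "symbols v P U w k e F" "\<And>q. q \<in> Q \<Longrightarrow> \<pi> q \<in> P \<and> U' q \<subseteq> U (\<pi> q)"
    and "\<And>q x. q \<in> Q \<Longrightarrow> x \<in> U' q \<Longrightarrow> 0 < w' q x \<and> w' q x \<le> w (\<pi> q) x" "e \<le> 0"
  shows "symbols v Q U' w' k e (\<lambda>q. F (\<pi> q))"
  using assms(1,4)
proof (induction k arbitrary: e F)
  case 0
  then obtain C where C: "C \<ge> 0" "\<And>p x. p \<in> P \<Longrightarrow> x \<in> U p \<Longrightarrow> norm (F p x) \<le> C * w p x powr e"
    by (auto simp: symbols_unfold)
  have "norm (F (\<pi> q) x) \<le> C * w' q x powr e" if "q \<in> Q" "x \<in> U' q" for q x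
  proof -
    have "norm (F (\<pi> q) x) \<le> C * w (\<pi> q) x powr e" using C(2) assms(2) that by blast
    also have "\<dots> \<le> C * w' q x powr e"
      using assms(3) that C(1) 0 by (intro mult_left_mono powr_mono2') auto
    finally show ?thesis .
  qed
  moreover have "continuous_on (U' q) (F (\<pi> q))" if "q \<in> Q" for q
    using 0 assms(2) that by (auto simp: symbols_unfold intro: continuous_on_subset)
  ultimately show ?case using C(1) by (auto simp: symbols_unfold)
next
  case (Suc k)
  have "symbols v Q U' w' 0 e (\<lambda>q. F (\<pi> q))"
    using Suc.IH[OF symbols_SucD[OF Suc.prems(1)] Suc.prems(2)] by (rule symbols_0)
  moreover have "symbols v Q U' w' k (e - 1) (\<lambda>q. dir_deriv v (F (\<pi> q)))"
    using Suc.IH[of "e - 1" "\<lambda>p. dir_deriv v (F p)"] Suc.prems by (simp add: symbols_unfold)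
  moreover have "has_dir_deriv v (F (\<pi> q)) (dir_deriv v (F (\<pi> q)) x) x" if "q \<in> Q" "x \<in> U' q" for q x
    using Suc.prems(1) assms(2) that unfolding symbols_unfold by blast
  ultimately show ?case by (simp add: symbols_unfold)
qed

context
  fixes v :: "'a::euclidean_space" and P :: "'p set" and U :: "'p \<Rightarrow> 'a set" and w :: "'p \<Rightarrow> 'a \<Rightarrow> real"
  assumes U_open: "\<And>p. p \<in> P \<Longrightarrow> open (U p)"
begin

lemma symbols_cong:
  assumes "\<And>p x. p \<in> P \<Longrightarrow> x \<in> U p \<Longrightarrow> F p x = G p x"
  shows "symbols v P U w k e F \<longleftrightarrow> symbols v P U w k e G"
  using assms
proof (induction k arbitrary: e F G)
  case 0
  then show ?case by (simp add: symbols_unfold cong: continuous_on_cong)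
next
  case (Suc k)
  have "dir_deriv v (F p) x = dir_deriv v (G p) x" if "p \<in> P" "x \<in> U p" for p x
    using dir_deriv_cong[OF U_open[OF that(1)] that(2)] Suc.prems that by blast
  moreover have "has_dir_deriv v (F p) d x \<longleftrightarrow> has_dir_deriv v (G p) d x" if "p \<in> P" "x \<in> U p" for p x d
    using has_dir_deriv_cong[OF U_open[OF that(1)] that(2)] Suc.prems that by blast
  ultimately show ?case
    using Suc.IH[of "\<lambda>p. dir_deriv v (F p)" "\<lambda>p. dir_deriv v (G p)" "e - 1"] Suc.prems
    by (simp add: symbols_unfold cong: continuous_on_cong)
qed

text \<open>The form in which derivatives are computed in practice: they need to be known on the open sets \<open>U p\<close> only.\<close>

lemma symbols_SucI:
  assumes "symbols v P U w 0 e F" "\<And>p x. p \<in> P \<Longrightarrow> x \<in> U p \<Longrightarrow> has_dir_deriv v (F p) (F' p x) x"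
    and "symbols v P U w k (e - 1) F'"
  shows "symbols v P U w (Suc k) e F"
proof -
  have "dir_deriv v (F p) x = F' p x" if "p \<in> P" "x \<in> U p" for p x
    using assms(2)[OF that] by (rule dir_deriv_eqI)
  then have "symbols v P U w k (e - 1) (\<lambda>p. dir_deriv v (F p))"
    using assms(3) symbols_cong[of "\<lambda>p. dir_deriv v (F p)" F'] by blast
  then show ?thesis
    using assms(1) has_dir_deriv_dir_deriv[OF assms(2)] by (simp add: symbols_unfold(2))
qed

lemma symbols_zero: "symbols v P U w k e (\<lambda>p x. 0)"
  by (induction k arbitrary: e) (auto simp: symbols_unfold(1) intro!: symbols_SucI[where F'="\<lambda>p x. 0"] exI[of _ 0])

lemma symbols_add:
  assumes "symbols v P U w k e F" "symbols v P U w k e G"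
  shows "symbols v P U w k e (\<lambda>p x. F p x + G p x)"
  using assms
proof (induction k arbitrary: e F G)
  case 0
  obtain C D where "C \<ge> 0" "\<And>p x. p \<in> P \<Longrightarrow> x \<in> U p \<Longrightarrow> norm (F p x) \<le> C * w p x powr e"
      "D \<ge> 0" "\<And>p x. p \<in> P \<Longrightarrow> x \<in> U p \<Longrightarrow> norm (G p x) \<le> D * w p x powr e"
    using 0 by (auto simp: symbols_unfold)
  then have "norm (F p x + G p x) \<le> (C + D) * w p x powr e" if "p \<in> P" "x \<in> U p" for p x
    using norm_triangle_ineq[of "F p x" "G p x"] that by (fastforce simp: algebra_simps)
  then show ?case using 0 \<open>C \<ge> 0\<close> \<open>D \<ge> 0\<close>
    by (auto simp: symbols_unfold intro!: continuous_intros exI[of _ "C + D"])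
next
  case (Suc k)
  show ?case
  proof (rule symbols_SucI)
    show "has_dir_deriv v (\<lambda>x. F p x + G p x) (dir_deriv v (F p) x + dir_deriv v (G p) x) x"
      if "p \<in> P" "x \<in> U p" for p x
      using Suc.prems that by (intro has_vector_derivative_add) (auto simp: symbols_unfold)
    show "symbols v P U w k (e - 1) (\<lambda>p x. dir_deriv v (F p) x + dir_deriv v (G p) x)"
      using Suc.prems by (intro Suc.IH) (auto simp: symbols_unfold)
  qed (use Suc in \<open>auto dest: symbols_0 symbols_SucD\<close>)
qed

text \<open>Orders add. The product rule splits the derivative into two products of order \<open>e + e' - 1\<close>, so
  induction on \<open>k\<close> replaces Leibniz' formula.\<close>

lemma symbols_mult:
  assumes "symbols v P U w k e F" "symbols v P U w k e' G"
  shows "symbols v P U w k (e + e') (\<lambda>p x. F p x * G p x)"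
  using assms
proof (induction k arbitrary: e e' F G)
  case 0
  obtain C D where CD: "C \<ge> 0" "\<And>p x. p \<in> P \<Longrightarrow> x \<in> U p \<Longrightarrow> norm (F p x) \<le> C * w p x powr e"
      "D \<ge> 0" "\<And>p x. p \<in> P \<Longrightarrow> x \<in> U p \<Longrightarrow> norm (G p x) \<le> D * w p x powr e'"
    using 0 by (auto simp: symbols_unfold)
  have "norm (F p x * G p x) \<le> (C * D) * w p x powr (e + e')" if "p \<in> P" "x \<in> U p" for p x
  proof -
    have "norm (F p x * G p x) \<le> (C * w p x powr e) * (D * w p x powr e')"
      unfolding norm_mult using CD that by (intro mult_mono) auto
    then show ?thesis by (simp add: powr_add ac_simps)
  qed
  then show ?case using 0 CD
    by (auto simp: symbols_unfold intro!: continuous_intros exI[of _ "C * D"])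
next
  case (Suc k)
  note IH = Suc.IH and F = Suc.prems(1) and G = Suc.prems(2)
  have F': "symbols v P U w k (e - 1) (\<lambda>p. dir_deriv v (F p))"
    and G': "symbols v P U w k (e' - 1) (\<lambda>p. dir_deriv v (G p))"
    using F G by (auto simp: symbols_unfold)
  show ?case
  proof (rule symbols_SucI)
    show "symbols v P U w 0 (e + e') (\<lambda>p x. F p x * G p x)"
      using IH[OF symbols_SucD[OF F] symbols_SucD[OF G]] by (rule symbols_0)
    show "has_dir_deriv v (\<lambda>x. F p x * G p x) (F p x * dir_deriv v (G p) x + dir_deriv v (F p) x * G p x) x"
      if "p \<in> P" "x \<in> U p" for p x
      using has_vector_derivative_mult[of "\<lambda>t. F p (x + t *\<^sub>R v)" _ 0 UNIV "\<lambda>t. G p (x + t *\<^sub>R v)"] F G that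
      by (auto simp: symbols_unfold)
    show "symbols v P U w k (e + e' - 1)
        (\<lambda>p x. F p x * dir_deriv v (G p) x + dir_deriv v (F p) x * G p x)"
      using IH[OF symbols_SucD[OF F] G'] IH[OF F' symbols_SucD[OF G]]
      by (intro symbols_add) (simp_all add: algebra_simps)
  qed
qed

lemma symbols_cnj:
  assumes "symbols v P U w k e F"
  shows "symbols v P U w k e (\<lambda>p x. cnj (F p x))"
  using assms
proof (induction k arbitrary: e F)
  case 0
  then show ?case by (auto simp: symbols_unfold intro!: continuous_on_cnj)
next
  case (Suc k)
  show ?case
  proof (rule symbols_SucI)
    show "symbols v P U w 0 e (\<lambda>p x. cnj (F p x))"
      using Suc.IH[OF symbols_SucD[OF Suc.prems]] by (rule symbols_0)
    show "has_dir_deriv v (\<lambda>x. cnj (F p x)) (cnj (dir_deriv v (F p) x)) x" if "p \<in> P" "x \<in> U p" for p x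
      using Suc.prems that by (auto simp: symbols_unfold intro: bounded_linear.has_vector_derivative[OF bounded_linear_cnj])
    show "symbols v P U w k (e - 1) (\<lambda>p x. cnj (dir_deriv v (F p) x))"
      using Suc.prems by (intro Suc.IH) (auto simp: symbols_unfold)
  qed
qed

text \<open>At points where \<open>F p\<close> vanishes identically nearby, all estimates hold for any weight whatsoever. In this way
  the amplitudes, which are cut off near the singularity, become symbols on the whole space.\<close>

lemma symbols_extend_by_zero:
  assumes "symbols v P U w k e F" "\<And>p. p \<in> P \<Longrightarrow> open (V p)"
    and "\<And>p x. p \<in> P \<Longrightarrow> x \<in> V p \<Longrightarrow> F p x = 0"
    and W: "\<And>p. p \<in> P \<Longrightarrow> W p = U p \<union> V p"
  shows "symbols v P W w k e F"
  using assms(1,3)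
proof (induction k arbitrary: e F)
  case 0
  have "continuous_on (W p) (F p)" if "p \<in> P" for p
    unfolding W[OF that]
  proof (rule continuous_on_open_Un)
    show "continuous_on (V p) (F p)" using 0 that by (simp cong: continuous_on_cong)
  qed (use 0 that assms U_open in \<open>auto simp: symbols_unfold\<close>)
  then show ?case using 0 by (auto simp: symbols_unfold W)
next
  case (Suc k)
  have V: "has_dir_deriv v (F p) 0 x" if "p \<in> P" "x \<in> V p" for p x
    using has_dir_deriv_cong[OF assms(2)[OF that(1)] that(2), of "F p" "\<lambda>_. 0"] Suc.prems(2) that by simp
  then have V': "dir_deriv v (F p) x = 0" if "p \<in> P" "x \<in> V p" for p x
    using that dir_deriv_eqI by blast
  have "symbols v P W w 0 e F"
    using Suc.IH[OF symbols_SucD[OF Suc.prems(1)] Suc.prems(2)] by (rule symbols_0)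
  moreover have "symbols v P W w k (e - 1) (\<lambda>p. dir_deriv v (F p))"
    using Suc.prems(1) V' by (intro Suc.IH) (auto simp: symbols_unfold)
  moreover have "has_dir_deriv v (F p) (dir_deriv v (F p) x) x" if "p \<in> P" "x \<in> W p" for p x
    using V V' Suc.prems(1) that W[OF that(1)] by (auto simp: symbols_unfold)
  ultimately show ?case by (simp add: symbols_unfold)
qed

context
  assumes w_pos: "\<And>p x. p \<in> P \<Longrightarrow> x \<in> U p \<Longrightarrow> 0 < w p x"
begin

lemma symbols_const:
  assumes "\<And>p. p \<in> P \<Longrightarrow> norm (c p) \<le> C"
  shows "symbols v P U w k 0 (\<lambda>p x. c p)"
proof -
  have "symbols v P U w 0 0 (\<lambda>p x. c p)"
    using assms w_pos by (force simp: symbols_unfold intro!: exI[of _ "max C 0"])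
  then show ?thesis
    by (cases k) (auto intro!: symbols_SucI[where F'="\<lambda>p x. 0"] symbols_zero)
qed

text \<open>The function \<open>max 0 r ^ M\<close> has \<open>M - 1\<close> continuous derivatives. As only finitely many derivatives are
  taken, such powers can replace smooth functions in the construction of the cut-off.\<close>

lemma symbols_positive_part_power:
  assumes "symbols v P U w k 0 F" "\<And>p x. p \<in> P \<Longrightarrow> x \<in> U p \<Longrightarrow> Im (F p x) = 0" "k < M"
  shows "symbols v P U w k 0 (\<lambda>p x. of_real (max 0 (Re (F p x)) ^ M))"
  using assms
proof (induction k arbitrary: M)
  case 0
  obtain C where C: "C \<ge> 0" "\<And>p x. p \<in> P \<Longrightarrow> x \<in> U p \<Longrightarrow> norm (F p x) \<le> C * w p x powr 0"
    using 0 by (auto simp: symbols_unfold)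
  have bnd: "norm (complex_of_real (max 0 (Re (F p x)) ^ M)) \<le> C ^ M * w p x powr 0" if "p \<in> P" "x \<in> U p" for p x
  proof -
    have "w p x powr 0 = 1" using w_pos[OF that] by simp
    moreover from this have "max 0 (Re (F p x)) \<le> C"
      using C(1) C(2)[OF that] abs_Re_le_cmod[of "F p x"] by simp
    ultimately show ?thesis by (simp add: power_mono norm_power)
  qed
  have cont: "continuous_on (U p) (\<lambda>x. complex_of_real (max 0 (Re (F p x)) ^ M))" if "p \<in> P" for p
    using 0 that by (auto simp: symbols_unfold intro!: continuous_intros)
  show ?case unfolding symbols_unfold
    by (intro conjI exI[of _ "C ^ M"] ballI zero_le_power) (fact C(1), erule (1) bnd, erule cont)
next
  case (Suc k)
  define L where "L = M - 2"
  have L: "M = Suc (Suc L)" "k < Suc L" using Suc.prems(3) by (simp_all add: L_def)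
  have pp: "((\<lambda>r. max 0 r ^ Suc (Suc L)) has_real_derivative real (Suc (Suc L)) * max 0 r ^ Suc L) (at r)" for r :: real
  proof -
    consider "r < 0" | "r > 0" | "r = 0" by linarith
    then show ?thesis
    proof cases
      case 1
      have "((\<lambda>r. 0) has_real_derivative 0) (at r)" by simp
      then have "((\<lambda>r. max 0 r ^ Suc (Suc L)) has_real_derivative 0) (at r)"
        by (rule has_field_derivative_transform_within_open[of _ _ _ "{..<0}"]) (use 1 in auto)
      then show ?thesis using 1 by simp
    next
      case 2
      have "((\<lambda>r. r ^ Suc (Suc L)) has_real_derivative real (Suc (Suc L)) * r ^ Suc L) (at r)"
        by (rule derivative_eq_intros refl | simp)+
      then have "((\<lambda>r. max 0 r ^ Suc (Suc L)) has_real_derivative real (Suc (Suc L)) * r ^ Suc L) (at r)"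
        by (rule has_field_derivative_transform_within_open[of _ _ _ "{0<..}"]) (use 2 in auto)
      then show ?thesis using 2 by simp
    next
      \<comment> \<open>the difference quotient at 0 of the power \<open>Suc (Suc L)\<close> is the power \<open>Suc L\<close>\<close>
      case 3
      have "((\<lambda>h. max 0 h ^ Suc L) \<longlongrightarrow> max 0 0 ^ Suc L) (at (0::real))"
        by (intro tendsto_intros)
      then have "((\<lambda>h. max 0 h ^ Suc L) \<longlongrightarrow> 0) (at (0::real))" by simp
      then have "((\<lambda>h. (max 0 (0 + h) ^ Suc (Suc L) - max 0 0 ^ Suc (Suc L)) / h) \<longlongrightarrow> 0) (at (0::real))"
        by (rule Lim_transform_eventually) (auto simp: eventually_at_filter max_def intro!: always_eventually)
      then show ?thesis using 3 by (simp add: DERIV_def)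
    qed
  qed
  show ?case
  proof (rule symbols_SucI)
    show "symbols v P U w 0 0 (\<lambda>p x. of_real (max 0 (Re (F p x)) ^ M))"
      using Suc.IH[OF symbols_SucD[OF Suc.prems(1)], of M] Suc.prems by (auto intro: symbols_0)
    show "has_dir_deriv v (\<lambda>x. of_real (max 0 (Re (F p x)) ^ M))
        (of_nat M * of_real (max 0 (Re (F p x)) ^ Suc L) * dir_deriv v (F p) x) x" if "p \<in> P" "x \<in> U p" for p x
    proof -
      have F: "has_dir_deriv v (F p) (dir_deriv v (F p) x) x"
        using Suc.prems(1) that by (simp add: symbols_unfold)
      have re: "((\<lambda>t. Re (F p (x + t *\<^sub>R v))) has_real_derivative Re (dir_deriv v (F p) x)) (at 0)"
        unfolding has_real_derivative_iff_has_vector_derivative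
        by (rule bounded_linear.has_vector_derivative[OF bounded_linear_Re F])
      have "has_dir_deriv v (\<lambda>x. complex_of_real (Im (F p x))) (complex_of_real (Im (dir_deriv v (F p) x))) x"
        using bounded_linear.has_vector_derivative[OF bounded_linear_Im F]
        by (intro bounded_linear.has_vector_derivative[OF bounded_linear_of_real])
      moreover have "has_dir_deriv v (\<lambda>x. complex_of_real (Im (F p x))) 0 x"
        using has_dir_deriv_cong[OF U_open[OF that(1)] that(2), of "\<lambda>x. complex_of_real (Im (F p x))" "\<lambda>_. 0" v 0]
          Suc.prems(2) that(1) by simp
      ultimately have "complex_of_real (Im (dir_deriv v (F p) x)) = 0"
        by (rule vector_derivative_unique_at)
      then have real: "dir_deriv v (F p) x = of_real (Re (dir_deriv v (F p) x))"
        by (simp add: complex_eq_iff)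
      have "((\<lambda>t. max 0 (Re (F p (x + t *\<^sub>R v))) ^ M) has_real_derivative
          (real M * max 0 (Re (F p x)) ^ Suc L) * Re (dir_deriv v (F p) x)) (at 0)"
        using DERIV_chain2[OF pp re] L(1) by simp
      then have "((\<lambda>t. complex_of_real (max 0 (Re (F p (x + t *\<^sub>R v))) ^ M)) has_vector_derivative
          complex_of_real ((real M * max 0 (Re (F p x)) ^ Suc L) * Re (dir_deriv v (F p) x))) (at 0)"
        unfolding has_real_derivative_iff_has_vector_derivative
        by (rule bounded_linear.has_vector_derivative[OF bounded_linear_of_real])
      then show ?thesis using real by simp
    qed
    have "symbols v P U w k 0 (\<lambda>p x. of_nat M * of_real (max 0 (Re (F p x)) ^ Suc L))"
      using symbols_mult[OF symbols_const[of "\<lambda>_. of_nat M" "real M"]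
          Suc.IH[OF symbols_SucD[OF Suc.prems(1)] Suc.prems(2) L(2)]] by simp
    then show "symbols v P U w k (0 - 1)
        (\<lambda>p x. of_nat M * of_real (max 0 (Re (F p x)) ^ Suc L) * dir_deriv v (F p) x)"
      using symbols_mult[of k 0 _ "- 1" "\<lambda>p. dir_deriv v (F p)"] Suc.prems(1) by (simp add: symbols_unfold)
  qed
qed

end

end


section \<open>Symbol bounds for the kernel, the amplitude and the cut-off\<close>

lemma smooth_on_partial_deriv: "smooth_on f S \<Longrightarrow> smooth_on (partial_deriv b f) S"
  unfolding smooth_on_def partial_deriv_def using Ck_on.simps(2) by blast

lemma smooth_on_imp_continuous_on: "smooth_on f S \<Longrightarrow> continuous_on S f"
  unfolding smooth_on_def using Ck_on.simps(1) by blast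

lemma smooth_on_imp_differentiable: "smooth_on f S \<Longrightarrow> x \<in> S \<Longrightarrow> f differentiable (at x)"
  unfolding smooth_on_def using Ck_on.simps(2) by blast

text \<open>For a multi-index supported on one axis the enumeration of the basis is immaterial.\<close>

lemma multi_deriv_single:
  fixes b :: "'a::euclidean_space"
  assumes "b \<in> Basis"
  shows "multi_deriv (\<lambda>c. if c = b then i else 0) f = (partial_deriv b ^^ i) f"
    and "multi_order (\<lambda>c. if c = b then i else 0) = i"
proof -
  have "\<exists>bs. distinct bs \<and> set bs = (Basis :: 'a set)"
    using finite_distinct_list[OF finite_Basis] by blast
  then have bs: "distinct (basis_enum :: 'a list)" "set basis_enum = (Basis :: 'a set)"
    unfolding basis_enum_def by (rule someI2_ex, simp)+
  have "foldr (\<lambda>c. partial_deriv c ^^ (if c = b then i else 0)) cs f =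
      (if b \<in> set cs then (partial_deriv b ^^ i) f else f)" if "distinct cs" for cs
    using that by (induction cs) auto
  from this[OF bs(1)] show "multi_deriv (\<lambda>c. if c = b then i else 0) f = (partial_deriv b ^^ i) f"
    using assms bs(2) by (simp add: multi_deriv_def)
  show "multi_order (\<lambda>c. if c = b then i else 0) = i"
    using assms by (simp add: multi_order_def)
qed

lemma has_vector_derivative_along_line:
  fixes H :: "'b::real_normed_vector \<Rightarrow> 'c::real_normed_vector" and h :: "'a::real_normed_vector \<Rightarrow> 'b"
  assumes "H differentiable (at (h x))" "\<And>t. h (x + t *\<^sub>R v) = h x + t *\<^sub>R b"
  shows "((\<lambda>t. H (h (x + t *\<^sub>R v))) has_vector_derivative frechet_derivative H (at (h x)) b) (at 0)"
proof -
  have H: "(H has_derivative frechet_derivative H (at (h x))) (at (h x + 0 *\<^sub>R b))"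
    using assms(1) by (simp add: frechet_derivative_works)
  have "((\<lambda>t. h x + t *\<^sub>R b) has_derivative (\<lambda>t. t *\<^sub>R b)) (at 0)"
    by (auto intro!: derivative_eq_intros)
  from diff_chain_at[OF this H] show ?thesis
    unfolding has_vector_derivative_def assms(2)
    by (simp add: o_def linear_cmul[OF has_derivative_linear[OF H]])
qed

text \<open>Everything is measured against the distance to the moving singularity \<open>Y p\<close>.\<close>

abbreviation symbols_off ::
    "'a::euclidean_space \<Rightarrow> 'p set \<Rightarrow> ('p \<Rightarrow> 'a) \<Rightarrow> nat \<Rightarrow> real \<Rightarrow> ('p \<Rightarrow> 'a \<Rightarrow> complex) \<Rightarrow> bool" where
  "symbols_off v P Y \<equiv> symbols v P (\<lambda>p. - {Y p}) (\<lambda>p x. norm (x - Y p))"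

lemma symbols_off_SucI:
  assumes "symbols_off v P Y 0 e F" "\<And>p x. p \<in> P \<Longrightarrow> x \<noteq> Y p \<Longrightarrow> has_dir_deriv v (F p) (F' p x) x"
    and "symbols_off v P Y k (e - 1) F'"
  shows "symbols_off v P Y (Suc k) e F"
  using assms by (intro symbols_SucI[where F'=F']) auto

lemma symbols_off_mult:
  "symbols_off v P Y k e F \<Longrightarrow> symbols_off v P Y k e' G \<Longrightarrow>
    symbols_off v P Y k (e + e') (\<lambda>p x. F p x * G p x)"
  by (rule symbols_mult) auto

lemma symbols_off_add:
  "symbols_off v P Y k e F \<Longrightarrow> symbols_off v P Y k e G \<Longrightarrow> symbols_off v P Y k e (\<lambda>p x. F p x + G p x)"
  by (rule symbols_add) auto

lemma symbols_off_const:
  "(\<And>p. p \<in> P \<Longrightarrow> norm (c p) \<le> C) \<Longrightarrow> symbols_off v P Y k 0 (\<lambda>p x. c p)"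
  by (rule symbols_const) auto

text \<open>Since the derivatives of \<open>H\<close> are bounded by negative powers of the full norm, and the full norm of
  \<open>(x - Y p, c p)\<close> is at least \<open>norm (x - Y p)\<close>, the second component \<open>c p\<close> has no influence on the
  bounds. Later it carries \<open>s - \<psi> y\<close>.\<close>

lemma symbols_off_singular_kernel:
  fixes H :: "('a::euclidean_space) \<times> real \<Rightarrow> complex" and c :: "'p \<Rightarrow> real"
  assumes "smooth_on H (- {0})"
    and "\<And>i. \<exists>C. \<forall>z. z \<noteq> 0 \<longrightarrow> norm ((partial_deriv (v, 0) ^^ i) H z) \<le> C * norm z powr (e - real i)"
    and "e \<le> 0"
  shows "symbols_off v P Y k e (\<lambda>p x. H (x - Y p, c p))"
  using assms
proof (induction k arbitrary: e H)
  case 0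
  obtain C where C: "\<And>z. z \<noteq> 0 \<Longrightarrow> norm (H z) \<le> C * norm z powr e"
    using "0.prems"(2)[of 0] by auto
  have bnd: "norm (H (x - Y p, c p)) \<le> max C 0 * norm (x - Y p) powr e" if "x \<in> - {Y p}" for p x
  proof -
    have z: "(x - Y p, c p) \<noteq> 0" using that by (auto simp: zero_prod_def)
    have "norm (H (x - Y p, c p)) \<le> C * norm (x - Y p, c p) powr e" using C[OF z] .
    also have "\<dots> \<le> max C 0 * norm (x - Y p, c p) powr e" by (intro mult_right_mono) auto
    also have "\<dots> \<le> max C 0 * norm (x - Y p) powr e"
      using that 0 norm_fst_le[of "x - Y p" "c p"] by (intro mult_left_mono powr_mono2') auto
    finally show ?thesis .
  qed
  have cont: "continuous_on (- {Y p}) (\<lambda>x. H (x - Y p, c p))" for p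
    by (rule continuous_on_compose2[OF smooth_on_imp_continuous_on[OF "0.prems"(1)]])
      (auto intro!: continuous_intros simp: zero_prod_def)
  show ?case unfolding symbols_unfold
    by (intro conjI exI[of _ "max C 0"] ballI) (simp, erule bnd, rule cont)
next
  case (Suc k)
  show ?case
  proof (rule symbols_off_SucI)
    show "symbols_off v P Y 0 e (\<lambda>p x. H (x - Y p, c p))"
      using Suc.IH[OF Suc.prems] by (rule symbols_0)
    show "has_dir_deriv v (\<lambda>x. H (x - Y p, c p)) (partial_deriv (v, 0) H (x - Y p, c p)) x" if "x \<noteq> Y p" for p x
      unfolding partial_deriv_def
      using that smooth_on_imp_differentiable[OF Suc.prems(1)]
      by (intro has_vector_derivative_along_line[where h="\<lambda>x. (x - Y p, c p)"]) (auto simp: zero_prod_def)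
    have "\<exists>C. \<forall>z. z \<noteq> 0 \<longrightarrow>
        norm ((partial_deriv (v, 0) ^^ i) (partial_deriv (v, 0) H) z) \<le> C * norm z powr (e - 1 - real i)" for i
      using Suc.prems(2)[of "Suc i"] by (simp add: funpow_swap1 algebra_simps)
    then show "symbols_off v P Y k (e - 1) (\<lambda>p x. partial_deriv (v, 0) H (x - Y p, c p))"
      using Suc.prems by (intro Suc.IH smooth_on_partial_deriv) auto
  qed
qed

text \<open>On the support the weight is at most \<open>2 * R\<close>, so a bounded function is of every order \<open>e \<le> 0\<close>.\<close>

lemma symbols_off_compactly_supported:
  fixes \<Phi> :: "('a::euclidean_space \<times> real) \<times> 'a \<Rightarrow> real" and s :: "'p \<Rightarrow> real"
  assumes "smooth_on \<Phi> UNIV" "\<And>q. q \<notin> S \<Longrightarrow> \<Phi> q = 0" "e \<le> 0"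
    and S: "compact S" and R: "\<And>q. q \<in> S \<Longrightarrow> norm (fst (fst q)) \<le> R \<and> norm (snd q) \<le> R" "0 < R"
  shows "symbols_off v P Y k e (\<lambda>p x. of_real (\<Phi> ((x, s p), Y p)))"
  using assms(1-3)
proof (induction k arbitrary: e \<Phi>)
  case 0
  have "bounded (\<Phi> ` S)"
    using S smooth_on_imp_continuous_on[OF "0.prems"(1)]
    by (intro compact_imp_bounded compact_continuous_image) (auto intro: continuous_on_subset)
  then obtain B where B: "\<And>q. q \<in> S \<Longrightarrow> \<bar>\<Phi> q\<bar> \<le> B" "0 < B"
    by (auto simp: bounded_pos)
  have bnd: "norm (complex_of_real (\<Phi> ((x, s p), Y p))) \<le> (B / (2 * R) powr e) * norm (x - Y p) powr e"
    if "x \<in> - {Y p}" for p x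
  proof (cases "((x, s p), Y p) \<in> S")
    case True
    have "norm (x - Y p) \<le> 2 * R"
      using R(1)[OF True] norm_triangle_ineq4[of x "Y p"] by simp
    then have "(2 * R) powr e \<le> norm (x - Y p) powr e"
      using 0 that by (intro powr_mono2') auto
    then have "B \<le> (B / (2 * R) powr e) * norm (x - Y p) powr e"
      using B(2) R(2) by (simp add: field_simps)
    then show ?thesis using B(1)[OF True] by simp
  next
    case False
    then show ?thesis using 0 B(2) by simp
  qed
  have cont: "continuous_on (- {Y p}) (\<lambda>x. complex_of_real (\<Phi> ((x, s p), Y p)))" for p
    by (intro continuous_on_of_real continuous_on_compose2[OF smooth_on_imp_continuous_on[OF "0.prems"(1)]])
      (auto intro!: continuous_intros)
  show ?case unfolding symbols_unfold
    by (intro conjI exI[of _ "B / (2 * R) powr e"] ballI) (use B in simp, erule bnd, rule cont)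
next
  case (Suc k)
  show ?case
  proof (rule symbols_off_SucI)
    show "symbols_off v P Y 0 e (\<lambda>p x. of_real (\<Phi> ((x, s p), Y p)))"
      using Suc.IH[OF Suc.prems] by (rule symbols_0)
    show "has_dir_deriv v (\<lambda>x. of_real (\<Phi> ((x, s p), Y p)))
        (of_real (partial_deriv ((v, 0), 0) \<Phi> ((x, s p), Y p))) x" for p x
      unfolding partial_deriv_def
      using smooth_on_imp_differentiable[OF Suc.prems(1)]
      by (intro bounded_linear.has_vector_derivative[OF bounded_linear_of_real]
          has_vector_derivative_along_line[where h="\<lambda>x. ((x, s p), Y p)"]) auto
    have "partial_deriv ((v, 0), 0) \<Phi> q = 0" if "q \<notin> S" for q
    proof -
      have "(\<Phi> has_derivative (\<lambda>_. 0)) (at q)"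
        by (rule has_derivative_transform_within_open[of "\<lambda>_. 0" _ _ _ "- S"])
          (use that S compact_imp_closed Suc.prems(2) in auto)
      then have "(\<lambda>_. 0) = frechet_derivative \<Phi> (at q)" by (rule frechet_derivative_at)
      then show ?thesis unfolding partial_deriv_def by metis
    qed
    then show "symbols_off v P Y k (e - 1) (\<lambda>p x. of_real (partial_deriv ((v, 0), 0) \<Phi> ((x, s p), Y p)))"
      using Suc.prems by (intro Suc.IH smooth_on_partial_deriv) auto
  qed
qed

text \<open>The ratio \<open>(norm z)\<^sup>2 / ((norm z)\<^sup>2 + \<delta>\<^sup>2)\<close> is a smooth increasing function of \<open>norm z\<close> with values in
  \<open>[0, 1)\<close>. The map \<open>t \<mapsto> 1 - max 0 (1 - max 0 t ^ M) ^ M\<close> is a step of class \<open>C^(M - 1)\<close> from 0 for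
  \<open>t \<le> 0\<close> to 1 for \<open>t \<ge> 1\<close>, and the affine function \<open>t = 4 r - 2\<close> of the ratio \<open>r\<close> makes the
  step happen for \<open>1/2 \<le> r \<le> 3/4\<close>, that is for \<open>\<delta> \<le> norm z \<le> sqrt 3 * \<delta>\<close>.\<close>

definition cutoff :: "nat \<Rightarrow> real \<Rightarrow> 'a::real_inner \<Rightarrow> real" where
  "cutoff M \<delta> z = 1 - max 0 (1 - max 0 (4 * ((norm z)\<^sup>2 / ((norm z)\<^sup>2 + \<delta>\<^sup>2)) - 2) ^ M) ^ M"

lemma cutoff_bounds: "0 \<le> cutoff M \<delta> z" "cutoff M \<delta> z \<le> 1"
proof -
  define t where "t = max 0 (4 * ((norm z)\<^sup>2 / ((norm z)\<^sup>2 + \<delta>\<^sup>2)) - 2) ^ M"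
  have t: "0 \<le> t" by (simp add: t_def)
  then show "0 \<le> cutoff M \<delta> z" "cutoff M \<delta> z \<le> 1"
    unfolding cutoff_def t_def[symmetric] by (auto intro!: power_le_one)
qed

lemma cutoff_near:
  assumes "norm z \<le> \<delta>" "0 < \<delta>" "0 < M"
  shows "cutoff M \<delta> z = 0"
proof -
  have "(norm z)\<^sup>2 \<le> \<delta>\<^sup>2" using assms by (intro power_mono) auto
  then have "4 * ((norm z)\<^sup>2 / ((norm z)\<^sup>2 + \<delta>\<^sup>2)) - 2 \<le> 0"
    using add_nonneg_pos[of "(norm z)\<^sup>2" "\<delta>\<^sup>2"] assms by (simp add: divide_simps)
  then show ?thesis using assms by (simp add: cutoff_def max_absorb1 zero_power)
qed

lemma cutoff_far:
  assumes "2 * \<delta> \<le> norm z" "0 < \<delta>" "0 < M"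
  shows "cutoff M \<delta> z = 1"
proof -
  have "(2 * \<delta>)\<^sup>2 \<le> (norm z)\<^sup>2" using assms by (intro power_mono) auto
  then have "1 \<le> 4 * ((norm z)\<^sup>2 / ((norm z)\<^sup>2 + \<delta>\<^sup>2)) - 2"
    using add_nonneg_pos[of "(norm z)\<^sup>2" "\<delta>\<^sup>2"] assms by (simp add: divide_simps power_mult_distrib)
  then have "1 \<le> max 0 (4 * ((norm z)\<^sup>2 / ((norm z)\<^sup>2 + \<delta>\<^sup>2)) - 2) ^ M"
    by (intro one_le_power) auto
  then show ?thesis using assms by (simp add: cutoff_def max_absorb1)
qed

text \<open>The cut-off function depends on \<open>z / \<delta>\<close> only, hence is of order 0 uniformly in \<open>\<delta>\<close>. The proof
  follows its construction: \<open>z \<bullet> v\<close> has order 1, \<open>(norm z)\<^sup>2\<close> order 2 and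
  \<open>1 / ((norm z)\<^sup>2 + \<delta>\<^sup>2)\<close> order -2 with a bound free of \<open>\<delta>\<close>, so the ratio has order 0.\<close>

lemma symbols_off_cutoff:
  fixes v :: "'a::euclidean_space"
  assumes \<delta>: "\<And>p. p \<in> P \<Longrightarrow> 0 < \<delta> p" and M: "k < M"
  shows "symbols_off v P Y k 0 (\<lambda>p x. of_real (cutoff M (\<delta> p) (x - Y p)))"
proof -
  have lin: "symbols_off v P Y k 1 (\<lambda>p x. of_real ((x - Y p) \<bullet> v))" for k
  proof -
    have "norm (complex_of_real ((x - Y p) \<bullet> v)) \<le> norm v * norm (x - Y p) powr 1" for x p
      using Cauchy_Schwarz_ineq2[of "x - Y p" v] by (simp add: mult.commute)
    then have 0: "symbols_off v P Y 0 1 (\<lambda>p x. of_real ((x - Y p) \<bullet> v))"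
      unfolding symbols_unfold
      by (intro conjI exI[of _ "norm v"] ballI) (auto intro!: continuous_intros)
    have "has_dir_deriv v (\<lambda>x. of_real ((x - Y p) \<bullet> v)) (of_real (v \<bullet> v)) x" for p x
      by (intro bounded_linear.has_vector_derivative[OF bounded_linear_of_real])
        (auto simp: has_real_derivative_iff_has_vector_derivative[symmetric] inner_simps intro!: derivative_eq_intros)
    then show ?thesis
      using 0 by (cases k) (auto intro!: symbols_off_SucI[where F'="\<lambda>p x. of_real (v \<bullet> v)"] symbols_off_const)
  qed
  have dsq: "((\<lambda>t. (norm (x + t *\<^sub>R v - Y p))\<^sup>2) has_real_derivative 2 * ((x - Y p) \<bullet> v)) (at 0)" for x p
  proof -
    have "(norm (x + t *\<^sub>R v - Y p))\<^sup>2 = (norm (x - Y p))\<^sup>2 + 2 * t * ((x - Y p) \<bullet> v) + t\<^sup>2 * (v \<bullet> v)" for t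
      unfolding power2_norm_eq_inner by (simp add: inner_simps inner_commute power2_eq_square algebra_simps)
    then show ?thesis by (auto intro!: derivative_eq_intros)
  qed
  have sq: "symbols_off v P Y k 2 (\<lambda>p x. of_real ((norm (x - Y p))\<^sup>2))" for k
  proof -
    have 0: "symbols_off v P Y 0 2 (\<lambda>p x. of_real ((norm (x - Y p))\<^sup>2))"
      unfolding symbols_unfold
      by (intro conjI exI[of _ 1] ballI) (auto simp: norm_power intro!: continuous_intros)
    have "has_dir_deriv v (\<lambda>x. of_real ((norm (x - Y p))\<^sup>2)) (2 * of_real ((x - Y p) \<bullet> v)) x" for p x
      using bounded_linear.has_vector_derivative[OF bounded_linear_of_real[where 'a=complex]
          dsq[of x p, unfolded has_real_derivative_iff_has_vector_derivative]] by simp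
    moreover have "symbols_off v P Y k 1 (\<lambda>p x. 2 * of_real ((x - Y p) \<bullet> v))" for k
      using symbols_off_mult[OF symbols_off_const[of P "\<lambda>_. 2" 2] lin] by simp
    ultimately show ?thesis
      using 0 by (cases k) (auto intro!: symbols_off_SucI[where F'="\<lambda>p x. 2 * of_real ((x - Y p) \<bullet> v)"])
  qed
  let ?r = "\<lambda>p x. inverse ((norm (x - Y p))\<^sup>2 + (\<delta> p)\<^sup>2)"
  have pos: "0 < (norm (x - Y p))\<^sup>2 + (\<delta> p)\<^sup>2" if "p \<in> P" for p x
    using \<delta>[OF that] by (intro add_nonneg_pos) auto
  have inv: "symbols_off v P Y k (- 2) (\<lambda>p x. of_real (?r p x))" for k
  proof (induction k)
    case 0
    have bnd: "norm (complex_of_real (?r p x)) \<le> 1 * norm (x - Y p) powr (- 2)" if "p \<in> P" "x \<in> - {Y p}" for p x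
    proof -
      have "?r p x \<le> inverse ((norm (x - Y p))\<^sup>2)" using that by (intro le_imp_inverse_le) auto
      moreover have "norm (complex_of_real (?r p x)) = ?r p x"
        unfolding norm_of_real using pos[OF that(1), of x] by (intro abs_of_nonneg) simp
      moreover have "norm (x - Y p) powr (- 2) = inverse ((norm (x - Y p))\<^sup>2)"
        by (simp add: powr_minus)
      ultimately show ?thesis by simp
    qed
    have cont: "continuous_on (- {Y p}) (\<lambda>x. complex_of_real (?r p x))" if "p \<in> P" for p
      using pos[OF that] by (intro continuous_intros) (auto simp: less_le)
    show ?case unfolding symbols_unfold
      by (intro conjI exI[of _ 1] ballI) (simp, erule (1) bnd, erule cont)
  next
    case (Suc k)
    show ?case
    proof (rule symbols_off_SucI[OF symbols_0[OF Suc]])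
      show "has_dir_deriv v (\<lambda>x. of_real (?r p x)) (- 2 * of_real ((x - Y p) \<bullet> v) * (of_real (?r p x) * of_real (?r p x))) x"
        if "p \<in> P" for p x
      proof -
        have "((\<lambda>t. ?r p (x + t *\<^sub>R v)) has_real_derivative - (2 * ((x - Y p) \<bullet> v)) * (?r p x * ?r p x)) (at 0)"
          by (rule DERIV_cong[OF DERIV_inverse'[OF DERIV_add[OF dsq[of x p] DERIV_const]]])
            (use \<delta>[OF that] in simp_all)
        from bounded_linear.has_vector_derivative[OF bounded_linear_of_real[where 'a=complex]
            this[unfolded has_real_derivative_iff_has_vector_derivative]]
        show ?thesis by simp
      qed
      show "symbols_off v P Y k (- 2 - 1)
          (\<lambda>p x. - 2 * of_real ((x - Y p) \<bullet> v) * (of_real (?r p x) * of_real (?r p x)))"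
        using symbols_off_mult[OF symbols_off_mult[OF symbols_off_const[of P "\<lambda>_. - 2" 2] lin] symbols_off_mult[OF Suc Suc]]
        by simp
    qed
  qed
  have \<tau>: "symbols_off v P Y k 0 (\<lambda>p x. of_real ((norm (x - Y p))\<^sup>2) * of_real (?r p x))"
    using symbols_off_mult[OF sq inv] by simp
  have mult0: "symbols_off v P Y k 0 (\<lambda>p x. a * F p x)" if "symbols_off v P Y k 0 F" for a F
    using symbols_off_mult[OF symbols_off_const[of P "\<lambda>_. a" "norm a"] that] by simp
  let ?t = "\<lambda>p x. 4 * ((norm (x - Y p))\<^sup>2 / ((norm (x - Y p))\<^sup>2 + (\<delta> p)\<^sup>2)) - 2"
  have "complex_of_real (?t p x) = 4 * (of_real ((norm (x - Y p))\<^sup>2) * of_real (?r p x)) + - 2" for p x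
    by (simp add: divide_inverse)
  then have t: "symbols_off v P Y k 0 (\<lambda>p x. of_real (?t p x))"
    using symbols_off_add[OF mult0[OF \<tau>, of 4] symbols_off_const[of P "\<lambda>_. - 2" 2]] by simp
  have step: "symbols_off v P Y k 0 (\<lambda>p x. of_real (1 - max 0 (h p x) ^ M))"
    if "symbols_off v P Y k 0 (\<lambda>p x. of_real (h p x))" for h
  proof -
    have "symbols_off v P Y k 0 (\<lambda>p x. complex_of_real (max 0 (Re (of_real (h p x))) ^ M))"
      by (rule symbols_positive_part_power[OF _ _ that]) (use M in auto)
    then have "symbols_off v P Y k 0 (\<lambda>p x. complex_of_real (max 0 (h p x) ^ M))"
      by (simp only: Re_complex_of_real)
    from symbols_off_add[OF symbols_off_const[of P "\<lambda>_. 1" 1] mult0[OF this, of "- 1"]]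
    show ?thesis by simp
  qed
  show ?thesis using step[OF step[OF t]] by (simp only: cutoff_def)
qed

section \<open>Integration by parts\<close>

text \<open>By translation invariance \<open>\<integral> F (x + v) - F x dx = 0\<close>. The fundamental theorem of calculus on the
  segment from \<open>x\<close> to \<open>x + v\<close> and Fubini turn the left-hand side into \<open>\<integral> F' x dx\<close>.\<close>

lemma integral_directional_derivative_eq_0:
  fixes F F' :: "'a::euclidean_space \<Rightarrow> complex"
  assumes deriv: "\<And>x. ((\<lambda>t::real. F (x + t *\<^sub>R v)) has_vector_derivative F' x) (at 0)"
    and cont: "continuous_on UNIV F" "continuous_on UNIV F'"
    and supp: "\<And>x. F x \<noteq> 0 \<Longrightarrow> norm x \<le> R" "\<And>x. F' x \<noteq> 0 \<Longrightarrow> norm x \<le> R"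
  shows "(LINT x|lborel. F' x) = 0"
proof -
  have int: "integrable lborel G" if "continuous_on UNIV G" "\<And>x. G x \<noteq> 0 \<Longrightarrow> norm x \<le> R"
    for G :: "'a \<Rightarrow> complex"
  proof -
    have "integrable lborel (\<lambda>x. indicator (cball 0 R) x *\<^sub>R G x)"
      using that(1) by (intro borel_integrable_compact) (auto intro: continuous_on_subset)
    also have "(\<lambda>x. indicator (cball 0 R) x *\<^sub>R G x) = G"
      using that(2) by (force simp: indicator_def fun_eq_iff)
    finally show ?thesis .
  qed
  note intF = int[OF cont(1) supp(1)] and intF' = int[OF cont(2) supp(2)]
  have [measurable]: "F \<in> borel_measurable borel" "F' \<in> borel_measurable borel"
    using cont by (auto intro: borel_measurable_continuous_onI)
  have shift: "(LINT x|lborel. G (x + c)) = (LINT x|lborel. G x)"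
    if "G \<in> borel_measurable borel" for G :: "'a \<Rightarrow> complex" and c
    using integral_distr[of "(+) c" lborel borel G] that
    by (simp add: lborel_distr_plus add.commute)
  have shift_int: "integrable lborel (\<lambda>x. G (x + c))"
    if "integrable lborel G" for G :: "'a \<Rightarrow> complex" and c
    using integrable_distr[of "(+) c" lborel borel G] that
    by (simp add: lborel_distr_plus add.commute)
  have deriv': "((\<lambda>t. F (x + t *\<^sub>R v)) has_vector_derivative F' (x + t *\<^sub>R v)) (at t within {0..1})" for x t
  proof -
    have "((\<lambda>h. F (x + t *\<^sub>R v + h *\<^sub>R v)) \<circ> (\<lambda>u. u - t) has_vector_derivative (1 *\<^sub>R F' (x + t *\<^sub>R v))) (at t)"
      using deriv[of "x + t *\<^sub>R v"]
      by (intro vector_diff_chain_at) (auto intro!: derivative_eq_intros)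
    moreover have "(\<lambda>h. F (x + t *\<^sub>R v + h *\<^sub>R v)) \<circ> (\<lambda>u. u - t) = (\<lambda>u. F (x + u *\<^sub>R v))"
      by (rule ext) (simp add: scaleR_diff_left)
    ultimately show ?thesis by (auto intro: has_vector_derivative_at_within)
  qed
  have FTC: "(LINT t|lborel. indicator {0..1} t *\<^sub>R F' (x + t *\<^sub>R v)) = F (x + v) - F x" for x
  proof -
    have "continuous_on {0..1} (\<lambda>t. F' (x + t *\<^sub>R v))"
      by (intro continuous_on_compose2[OF cont(2)] continuous_intros) auto
    then show ?thesis
      using integral_FTC_atLeastAtMost[of 0 1 "\<lambda>t. F (x + t *\<^sub>R v)" "\<lambda>t. F' (x + t *\<^sub>R v)"] deriv'
      by simp
  qed
  let ?H = "\<lambda>x t. indicator {0..1::real} t *\<^sub>R F' (x + t *\<^sub>R v)"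
  have Hint: "integrable (lborel \<Otimes>\<^sub>M lborel) (\<lambda>(t, x). ?H x t)"
  proof (rule lborel_pair.Fubini_integrable)
    have "(LINT x|lborel. norm (F' (x + c))) = (LINT x|lborel. norm (F' x))" for c
      using integral_distr[of "(+) c" lborel borel "\<lambda>x. norm (F' x)"]
      by (simp add: lborel_distr_plus add.commute)
    then show "integrable lborel (\<lambda>t. LINT x|lborel. norm (case (t, x) of (t, x) \<Rightarrow> ?H x t))"
      by simp
    show "AE t in lborel. integrable lborel (\<lambda>x. case (t, x) of (t, x) \<Rightarrow> ?H x t)"
      using shift_int[OF intF'] by simp
  qed measurable
  have "0 = (LINT x|lborel. F (x + v) - F x)"
    using shift[of F v] shift_int[OF intF, of v] intF by simp
  also have "\<dots> = (LINT x|lborel. LINT t|lborel. ?H x t)" by (simp add: FTC)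
  also have "\<dots> = (LINT t|lborel. LINT x|lborel. ?H x t)"
    using lborel_pair.Fubini_integral[OF Hint] by simp
  also have "\<dots> = (LINT t|lborel. indicator {0..1::real} t *\<^sub>R (LINT x|lborel. F' x))"
    using shift[of F'] by simp
  also have "\<dots> = (LINT x|lborel. F' x)" by simp
  finally show ?thesis ..
qed

text \<open>Each integration by parts in the direction \<open>v\<close> moves one derivative to the amplitude and gains the factor
  \<open>1 / \<bar>lam * (w \<bullet> v)\<bar>\<close>.\<close>

lemma oscillatory_integral_bound:
  fixes g :: "'a::euclidean_space \<Rightarrow> complex"
  assumes cont: "\<And>i. i \<le> N \<Longrightarrow> continuous_on UNIV ((dir_deriv v ^^ i) g)"
    and deriv: "\<And>i x. i < N \<Longrightarrow> has_dir_deriv v ((dir_deriv v ^^ i) g) ((dir_deriv v ^^ Suc i) g x) x"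
    and supp: "\<And>i x. i \<le> N \<Longrightarrow> (dir_deriv v ^^ i) g x \<noteq> 0 \<Longrightarrow> norm x \<le> R"
    and w: "w \<bullet> v \<noteq> 0" and lam: "lam \<noteq> 0"
  shows "norm (LINT x|lborel. exp (\<i> * of_real (lam * (x \<bullet> w))) * g x)
     \<le> (LINT x|lborel. norm ((dir_deriv v ^^ N) g x)) / \<bar>lam * (w \<bullet> v)\<bar> ^ N"
proof -
  let ?E = "\<lambda>x. exp (\<i> * complex_of_real (lam * (x \<bullet> w)))"
  let ?\<mu> = "lam * (w \<bullet> v)"
  have int: "integrable lborel (\<lambda>x. ?E x * G x)" if "continuous_on UNIV G" "\<And>x. G x \<noteq> 0 \<Longrightarrow> norm x \<le> R"
    for G :: "'a \<Rightarrow> complex"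
  proof -
    have "integrable lborel (\<lambda>x. indicator (cball 0 R) x *\<^sub>R (?E x * G x))"
      using that(1) by (intro borel_integrable_compact continuous_intros) (auto intro: continuous_on_subset)
    also have "(\<lambda>x. indicator (cball 0 R) x *\<^sub>R (?E x * G x)) = (\<lambda>x. ?E x * G x)"
      using that(2) by (force simp: indicator_def fun_eq_iff)
    finally show ?thesis .
  qed
  have step: "norm (LINT x|lborel. ?E x * (dir_deriv v ^^ i) g x) * \<bar>?\<mu>\<bar>
      = norm (LINT x|lborel. ?E x * (dir_deriv v ^^ Suc i) g x)" if i: "i < N" for i
  proof -
    let ?h = "(dir_deriv v ^^ i) g" and ?h' = "(dir_deriv v ^^ Suc i) g"
    have c: "continuous_on UNIV ?h" "continuous_on UNIV ?h'" using cont[of i] cont[of "Suc i"] i by auto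
    have s: "\<And>x. ?h x \<noteq> 0 \<Longrightarrow> norm x \<le> R" "\<And>x. ?h' x \<noteq> 0 \<Longrightarrow> norm x \<le> R"
      using supp[of i] supp[of "Suc i"] i by auto
    have "(LINT x|lborel. ?E x * ?h' x + \<i> * ?\<mu> * (?E x * ?h x)) = 0"
    proof (rule integral_directional_derivative_eq_0[where v=v and R=R and F="\<lambda>x. ?E x * ?h x"])
      show "has_dir_deriv v (\<lambda>x. ?E x * ?h x) (?E x * ?h' x + \<i> * ?\<mu> * (?E x * ?h x)) x" for x
      proof -
        have "((\<lambda>t. lam * ((x + t *\<^sub>R v) \<bullet> w)) has_real_derivative ?\<mu>) (at 0)"
          by (auto intro!: derivative_eq_intros simp: inner_simps inner_commute)
        then have "has_dir_deriv v (\<lambda>x. complex_of_real (lam * (x \<bullet> w))) (of_real ?\<mu>) x"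
          unfolding has_real_derivative_iff_has_vector_derivative
          by (rule bounded_linear.has_vector_derivative[OF bounded_linear_of_real])
        then have "has_dir_deriv v (\<lambda>x. \<i> * complex_of_real (lam * (x \<bullet> w))) (\<i> * of_real ?\<mu>) x"
          by (rule bounded_linear.has_vector_derivative[OF bounded_linear_mult_right])
        then have "has_dir_deriv v ?E (\<i> * of_real ?\<mu> * ?E x) x"
          using field_vector_diff_chain_at[of "\<lambda>t. \<i> * complex_of_real (lam * ((x + t *\<^sub>R v) \<bullet> w))" _ 0 exp "?E x"]
            DERIV_exp by (simp add: o_def)
        from has_vector_derivative_mult[OF this deriv[OF i, of x]] show ?thesis
          by (simp add: algebra_simps)
      qed
      show "continuous_on UNIV (\<lambda>x. ?E x * ?h x)" "continuous_on UNIV (\<lambda>x. ?E x * ?h' x + \<i> * ?\<mu> * (?E x * ?h x))"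
        using c by (intro continuous_intros; simp)+
      show "norm x \<le> R" if "?E x * ?h x \<noteq> 0" for x using that s(1) by auto
      show "norm x \<le> R" if "?E x * ?h' x + \<i> * ?\<mu> * (?E x * ?h x) \<noteq> 0" for x
        using that s[of x] by (cases "?h x = 0") auto
    qed
    then have "(LINT x|lborel. ?E x * ?h' x) = - (\<i> * ?\<mu>) * (LINT x|lborel. ?E x * ?h x)"
      using int[OF c(1) s(1)] int[OF c(2) s(2)] by (simp add: eq_neg_iff_add_eq_0)
    then have "norm (LINT x|lborel. ?E x * ?h' x) = norm (- (\<i> * ?\<mu>)) * norm (LINT x|lborel. ?E x * ?h x)"
      by (simp only: norm_mult)
    then show ?thesis by (simp add: norm_mult abs_mult)
  qed
  have "norm (LINT x|lborel. ?E x * g x) * \<bar>?\<mu>\<bar> ^ i = norm (LINT x|lborel. ?E x * (dir_deriv v ^^ i) g x)"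
    if "i \<le> N" for i
    using that
  proof (induction i)
    case (Suc i)
    then show ?case using step[of i] by (simp add: mult.assoc[symmetric] mult.commute[of "\<bar>_\<bar>"])
  qed simp
  from this[of N] have "norm (LINT x|lborel. ?E x * g x) * \<bar>?\<mu>\<bar> ^ N
      = norm (LINT x|lborel. ?E x * (dir_deriv v ^^ N) g x)" by simp
  also have "\<dots> \<le> (LINT x|lborel. norm (?E x * (dir_deriv v ^^ N) g x))"
    by (rule integral_norm_bound)
  also have "\<dots> = (LINT x|lborel. norm ((dir_deriv v ^^ N) g x))"
    by (simp add: norm_mult)
  finally show ?thesis using w lam by (simp add: pos_le_divide_eq)
qed


section \<open>The truncated oscillatory operator\<close>

text \<open>The letter \<open>e\<close> denotes the order of the singularity of \<open>K\<close>, and \<open>N\<close> is the number of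
  integrations by parts. It is the least integer exceeding the dimension, so that \<open>\<bar>y - y'\<bar> powr - N\<close> is integrable at infinity.\<close>

locale oscillatory_kernel =
  fixes m e :: real and N :: nat and K :: "('a::euclidean_space) \<times> real \<Rightarrow> complex"
    and \<phi> :: "('a \<times> real) \<times> 'a \<Rightarrow> real"
  assumes m: "1 \<le> m" "m < real DIM('a)"
    and e_eq: "e = m - real DIM('a)" and N_eq: "N = Suc DIM('a)"
    and \<phi>_smooth: "smooth_on \<phi> UNIV"
    and \<phi>_supp: "compact (closure {p. \<phi> p \<noteq> 0})"
    and K_smooth: "smooth_on K (- {0})"
    and K_bound: "\<forall>\<alpha>. \<exists>C. \<forall>z. z \<noteq> 0 \<longrightarrow>
          norm (multi_deriv \<alpha> K z) \<le> C * norm z powr (m - real DIM('a) - real (multi_order \<alpha>))"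
begin

lemma e_bounds: "- real DIM('a) < e" "e < 0"
  using m by (auto simp: e_eq)

definition kernel :: "('a \<Rightarrow> real) \<Rightarrow> real \<Rightarrow> real \<Rightarrow> 'a \<Rightarrow> 'a \<Rightarrow> complex" where
  "kernel \<psi> lam s x y = exp (\<i> * of_real (lam * (x \<bullet> y))) * of_real (\<phi> ((x, s), y)) * K (x - y, s - \<psi> y)"

text \<open>The numbers \<open>s\<close> and \<open>c\<close> stand for \<open>x\<^sub>n\<^sub>+\<^sub>1\<close> and \<open>s - \<psi> y\<close>. Making them parameters hides \<open>\<psi>\<close> from
  all estimates in which derivatives are taken.\<close>

definition far_amplitude :: "'a \<Rightarrow> real \<Rightarrow> real \<Rightarrow> real \<Rightarrow> 'a \<Rightarrow> complex" where
  "far_amplitude y s c \<delta> x = of_real (\<phi> ((x, s), y)) * of_real (cutoff (Suc N) \<delta> (x - y)) * K (x - y, c)"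

lemma K_deriv_bound:
  assumes "b \<in> Basis"
  shows "\<exists>C. \<forall>z. z \<noteq> 0 \<longrightarrow> norm ((partial_deriv (b, 0) ^^ i) K z) \<le> C * norm z powr (e - real i)"
proof -
  have b: "(b, 0) \<in> (Basis :: ('a \<times> real) set)" using assms by (simp add: Basis_prod_def)
  from K_bound[rule_format, of "\<lambda>c. if c = (b, 0) then i else 0"] show ?thesis
    unfolding multi_deriv_single[OF b] e_eq .
qed

lemma K_size: obtains C where "0 < C" "\<And>z. fst z \<noteq> 0 \<Longrightarrow> norm (K z) \<le> C * norm (fst z) powr e"
proof -
  obtain b :: 'a where "b \<in> Basis" using nonempty_Basis by blast
  from K_deriv_bound[OF this, of 0] obtain C where C: "\<And>z. z \<noteq> 0 \<Longrightarrow> norm (K z) \<le> C * norm z powr e" by auto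
  have "norm (K z) \<le> max C 1 * norm (fst z) powr e" if "fst z \<noteq> 0" for z
  proof -
    have "z \<noteq> 0" using that by auto
    have "norm (K z) \<le> max C 1 * norm z powr e"
      using C[OF \<open>z \<noteq> 0\<close>] by (rule order_trans) (auto intro!: mult_right_mono)
    also have "\<dots> \<le> max C 1 * norm (fst z) powr e"
      using that e_bounds norm_fst_le[of "fst z" "snd z"] by (intro mult_left_mono powr_mono2') auto
    finally show ?thesis .
  qed
  then show ?thesis by (intro that[of "max C 1"]) auto
qed

lemma amplitude_support:
  obtains S R where "compact S" "\<And>q. q \<notin> S \<Longrightarrow> \<phi> q = 0" "0 < R"
    "\<And>q. q \<in> S \<Longrightarrow> norm (fst (fst q)) \<le> R \<and> norm (snd q) \<le> R"
proof -
  let ?S = "closure {p. \<phi> p \<noteq> 0}"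
  obtain R where R: "0 < R" "\<And>q. q \<in> ?S \<Longrightarrow> norm q \<le> R"
    using compact_imp_bounded[OF \<phi>_supp] by (auto simp: bounded_pos)
  have n: "norm (fst (fst q)) \<le> norm q" "norm (snd q) \<le> norm q" for q :: "('a \<times> real) \<times> 'a"
    using norm_fst_le[of "fst (fst q)" "snd (fst q)"] norm_fst_le[of "fst q" "snd q"] norm_snd_le[of "snd q" "fst q"]
    by auto
  show ?thesis
  proof (rule that[OF \<phi>_supp _ R(1)])
    show "\<phi> q = 0" if "q \<notin> ?S" for q using that closure_subset[of "{p. \<phi> p \<noteq> 0}"] by blast
    show "norm (fst (fst q)) \<le> R \<and> norm (snd q) \<le> R" if "q \<in> ?S" for q
      using R(2)[OF that] n[of q] by linarith
  qed
qed

lemma K_measurable [measurable]: "K \<in> borel_measurable borel"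
proof -
  have "continuous_on (- {0}) K" using K_smooth by (rule smooth_on_imp_continuous_on)
  then have "(\<lambda>z. indicator (- {0}) z *\<^sub>R K z) \<in> borel_measurable borel"
    by (intro borel_measurable_continuous_on_indicator) auto
  moreover have "(\<lambda>z. indicator {0::'a \<times> real} z *\<^sub>R K 0) \<in> borel_measurable borel"
    by (intro borel_measurable_scaleR borel_measurable_indicator borel_measurable_const borel_closed) auto
  ultimately have "(\<lambda>z. indicator (- {0}) z *\<^sub>R K z + indicator {0} z *\<^sub>R K 0) \<in> borel_measurable borel"
    by (rule borel_measurable_add)
  also have "(\<lambda>z. indicator (- {0}) z *\<^sub>R K z + indicator {0} z *\<^sub>R K 0) = K"
    by (auto simp: indicator_def fun_eq_iff)
  finally show ?thesis .
qed

lemma \<phi>_measurable [measurable]: "\<phi> \<in> borel_measurable borel"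
  using smooth_on_imp_continuous_on[OF \<phi>_smooth] by (rule borel_measurable_continuous_onI)

lemma kernel_measurable:
  assumes [measurable]: "\<psi> \<in> borel_measurable borel"
  shows "(\<lambda>(x, y). kernel \<psi> lam s x y) \<in> borel_measurable (borel \<Otimes>\<^sub>M borel)"
proof -
  have [measurable]: "(\<lambda>z. K (fst z - snd z, s - \<psi> (snd z))) \<in> borel_measurable (borel \<Otimes>\<^sub>M borel)"
    by (rule measurable_compose[OF _ K_measurable]) (simp add: borel_prod[symmetric])
  have [measurable]: "(\<lambda>z. \<phi> ((fst z, s), snd z)) \<in> borel_measurable (borel \<Otimes>\<^sub>M borel)"
    by (rule measurable_compose[OF _ \<phi>_measurable]) (simp add: borel_prod[symmetric])
  show ?thesis unfolding kernel_def split_beta' by measurable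
qed

lemma far_measurable:
  assumes [measurable]: "\<psi> \<in> borel_measurable borel"
  shows "(\<lambda>(x, y). far_amplitude y s (s - \<psi> y) \<delta> x) \<in> borel_measurable (borel \<Otimes>\<^sub>M borel)"
proof -
  have [measurable]: "(\<lambda>z. K (fst z - snd z, s - \<psi> (snd z))) \<in> borel_measurable (borel \<Otimes>\<^sub>M borel)"
    by (rule measurable_compose[OF _ K_measurable]) (simp add: borel_prod[symmetric])
  have [measurable]: "(\<lambda>z. \<phi> ((fst z, s), snd z)) \<in> borel_measurable (borel \<Otimes>\<^sub>M borel)"
    by (rule measurable_compose[OF _ \<phi>_measurable]) (simp add: borel_prod[symmetric])
  show ?thesis unfolding far_amplitude_def cutoff_def split_beta' by measurable
qed

lemma amplitude_kernel_size:
  obtains B R where "0 < B" "0 < R"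
    "\<And>x y s c. x \<noteq> y \<Longrightarrow>
      norm (of_real (\<phi> ((x, s), y)) * K (x - y, c)) \<le> B * (indicator (cball 0 R) (x - y) * norm (x - y) powr e)"
    "\<And>x y s. \<phi> ((x, s), y) \<noteq> 0 \<Longrightarrow> norm x \<le> R \<and> norm y \<le> R"
proof -
  obtain S R where S: "compact S" "\<And>q. q \<notin> S \<Longrightarrow> \<phi> q = 0" "0 < R"
    "\<And>q. q \<in> S \<Longrightarrow> norm (fst (fst q)) \<le> R \<and> norm (snd q) \<le> R"
    using amplitude_support by blast
  obtain C where C: "0 < C" "\<And>z. fst z \<noteq> 0 \<Longrightarrow> norm (K z) \<le> C * norm (fst z) powr e"
    using K_size by blast
  have "bounded (\<phi> ` S)"
    using S(1) smooth_on_imp_continuous_on[OF \<phi>_smooth]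
    by (intro compact_imp_bounded compact_continuous_image) (auto intro: continuous_on_subset)
  then obtain B where B: "\<And>q. q \<in> S \<Longrightarrow> \<bar>\<phi> q\<bar> \<le> B" "0 < B" by (auto simp: bounded_pos)
  have supp: "norm x \<le> R \<and> norm y \<le> R" if "\<phi> ((x, s), y) \<noteq> 0" for x y s
    using S(2)[of "((x, s), y)"] S(4)[of "((x, s), y)"] that by auto
  show ?thesis
  proof (rule that[of "B * C" "2 * R"])
    show "norm x \<le> 2 * R \<and> norm y \<le> 2 * R" if "\<phi> ((x, s), y) \<noteq> 0" for x y s
      using supp[OF that] S(3) by auto
    fix x y :: 'a and s c :: real
    assume xy: "x \<noteq> y"
    show "norm (of_real (\<phi> ((x, s), y)) * K (x - y, c))
        \<le> B * C * (indicator (cball 0 (2 * R)) (x - y) * norm (x - y) powr e)"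
    proof (cases "\<phi> ((x, s), y) = 0")
      case False
      have "norm (x - y) \<le> 2 * R" using supp[OF False] norm_triangle_ineq4[of x y] by simp
      moreover have "\<bar>\<phi> ((x, s), y)\<bar> \<le> B" using B(1) S(2) False by blast
      moreover have "norm (K (x - y, c)) \<le> C * norm (x - y) powr e"
        using C(2)[of "(x - y, c)"] xy by simp
      ultimately show ?thesis
        using B(2) mult_mono[of "\<bar>\<phi> ((x, s), y)\<bar>" B "norm (K (x - y, c))" "C * norm (x - y) powr e"]
        by (simp add: norm_mult mult.assoc)
    qed (use B C in simp)
  qed (use B C S in auto)
qed

lemma far_symbols:
  assumes "b \<in> Basis"
  shows "symbols_off b {p. 0 < snd (snd (snd p))} fst N e (\<lambda>(y, s, c, \<delta>). far_amplitude y s c \<delta>)"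
proof -
  let ?P = "{p :: 'a \<times> real \<times> real \<times> real. 0 < snd (snd (snd p))}"
  obtain S R where S: "compact S" "\<And>q. q \<notin> S \<Longrightarrow> \<phi> q = 0" "0 < R"
    "\<And>q. q \<in> S \<Longrightarrow> norm (fst (fst q)) \<le> R \<and> norm (snd q) \<le> R"
    using amplitude_support by blast
  have 1: "symbols_off b ?P fst N 0 (\<lambda>p x. of_real (\<phi> ((x, fst (snd p)), fst p)))"
    by (rule symbols_off_compactly_supported[OF \<phi>_smooth S(2) _ S(1) S(4) S(3)]) auto
  have 2: "symbols_off b ?P fst N 0 (\<lambda>p x. of_real (cutoff (Suc N) (snd (snd (snd p))) (x - fst p)))"
    by (rule symbols_off_cutoff) auto
  have 3: "symbols_off b ?P fst N e (\<lambda>p x. K (x - fst p, fst (snd (snd p))))"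
    using e_bounds by (intro symbols_off_singular_kernel K_smooth K_deriv_bound assms) auto
  have "symbols_off b ?P fst N e (\<lambda>p x. of_real (\<phi> ((x, fst (snd p)), fst p)) *
      of_real (cutoff (Suc N) (snd (snd (snd p))) (x - fst p)) * K (x - fst p, fst (snd (snd p))))"
    using symbols_off_mult[OF symbols_off_mult[OF 1 2] 3] by simp
  then show ?thesis by (simp add: far_amplitude_def[abs_def] split_beta')
qed

lemma far_eq_0: "0 < \<delta> \<Longrightarrow> norm (x - y) \<le> \<delta> \<Longrightarrow> far_amplitude y s c \<delta> x = 0"
  by (simp add: far_amplitude_def cutoff_near)

text \<open>The product of the two amplitudes is a symbol of order \<open>2 * e\<close> with respect to the distance to the
  nearer of \<open>y\<close> and \<open>y'\<close>, and it vanishes where that distance is less than \<open>\<delta>\<close>. After \<open>N\<close>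
  integrations by parts the integrand is therefore \<open>O(distance powr (2 * e - N))\<close> outside two balls of radius
  \<open>\<delta>\<close>, with integral \<open>O(\<delta> powr (2 * e - N + n))\<close>, and \<open>- N + n = - 1\<close>. The direction of
  differentiation is the coordinate axis along which \<open>y - y'\<close> is largest.\<close>

lemma gram_oscillation_bound:
  obtains C where "0 < C" "\<And>y y' s c c' \<delta> lam. y \<noteq> y' \<Longrightarrow> 0 < \<delta> \<Longrightarrow> 0 < lam \<Longrightarrow>
    norm (LINT x|lborel. exp (\<i> * of_real (lam * (x \<bullet> (y - y')))) * (far_amplitude y s c \<delta> x * cnj (far_amplitude y' s c' \<delta> x)))
      \<le> C * \<delta> powr (2 * e - 1) * (lam * norm (y - y')) powr - real N"
proof -
  let ?n = "real DIM('a)"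
  define Q :: "(('a \<times> real \<times> real \<times> real) \<times> ('a \<times> real \<times> real \<times> real)) set"
    where "Q = {q. 0 < snd (snd (snd (fst q))) \<and> snd (snd (snd (fst q))) = snd (snd (snd (snd q)))}"
  define w where "w q x = min (norm (x - fst (fst q))) (norm (x - fst (snd q)))"
    for q :: "('a \<times> real \<times> real \<times> real) \<times> ('a \<times> real \<times> real \<times> real)" and x :: 'a
  define U where "U q = - {fst (fst q), fst (snd q)}"
    for q :: "('a \<times> real \<times> real \<times> real) \<times> ('a \<times> real \<times> real \<times> real)"
  let ?F = "\<lambda>(y, s, c, \<delta>). far_amplitude y s c \<delta>"
  obtain B R :: real where "0 < B" "0 < R" and supp: "\<And>x y s. \<phi> ((x, s), y) \<noteq> 0 \<Longrightarrow> norm x \<le> R \<and> norm y \<le> R"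
    by (rule amplitude_kernel_size) blast
  obtain CE where CE: "0 < CE" "\<And>r. 0 < r \<Longrightarrow>
    (\<integral>\<^sup>+z. ennreal (indicator (- ball (0::'a) r) z * norm z powr (2 * e - N)) \<partial>lborel) \<le> ennreal (CE * r powr (2 * e - N + ?n))"
    using nn_integral_norm_powr_exterior[where 'a='a, of "2 * e - N"] e_bounds by (auto simp: N_eq)
  define osc where "osc b D \<longleftrightarrow> (\<forall>y y' s c c' \<delta> lam. 0 < \<delta> \<longrightarrow> 0 < lam \<longrightarrow> (y - y') \<bullet> b \<noteq> 0 \<longrightarrow>
    norm (LINT x|lborel. exp (\<i> * of_real (lam * (x \<bullet> (y - y')))) * (far_amplitude y s c \<delta> x * cnj (far_amplitude y' s c' \<delta> x)))
      \<le> D * \<delta> powr (2 * e - 1) / \<bar>lam * ((y - y') \<bullet> b)\<bar> ^ N)" for b D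
  have "\<exists>D. 0 \<le> D \<and> osc b D" if b: "b \<in> Basis" for b
  proof -
    have U_open: "open (U q)" if "q \<in> Q" for q
      by (simp add: U_def open_Compl finite_imp_closed)
    have 1: "symbols b Q U w N e (\<lambda>q. ?F (fst q))"
      by (rule symbols_reweight[OF far_symbols[OF b]]) (use e_bounds in \<open>auto simp: Q_def U_def w_def\<close>)
    have 2: "symbols b Q U w N e (\<lambda>q. ?F (snd q))"
      by (rule symbols_reweight[OF far_symbols[OF b]]) (use e_bounds in \<open>auto simp: Q_def U_def w_def\<close>)
    define G where "G q x = ?F (fst q) x * cnj (?F (snd q) x)"
      for q :: "('a \<times> real \<times> real \<times> real) \<times> ('a \<times> real \<times> real \<times> real)" and x
    have G: "G ((y, s, c, \<delta>), (y', s', c', \<delta>')) x = far_amplitude y s c \<delta> x * cnj (far_amplitude y' s' c' \<delta>' x)"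
      for y s c \<delta> y' s' c' \<delta>' x
      by (simp add: G_def)
    have 3: "symbols b Q U w N (e + e) G"
      unfolding G_def[abs_def] by (rule symbols_mult[OF U_open 1 symbols_cnj[OF U_open 2]])
    define V where "V q = ball (fst (fst q)) (snd (snd (snd (fst q)))) \<union>
      ball (fst (snd q)) (snd (snd (snd (fst q)))) \<union> {x. R < norm x}"
      for q :: "('a \<times> real \<times> real \<times> real) \<times> ('a \<times> real \<times> real \<times> real)"
    have V_open: "open (V q)" if "q \<in> Q" for q
      unfolding V_def by (intro open_Un open_ball open_Collect_less continuous_intros)
    have V_zero: "G q x = 0" if "q \<in> Q" "x \<in> V q" for q x
    proof -
      obtain p p' where pp: "q = (p, p')" by (cases q)
      obtain y s c \<delta> where p: "p = (y, s, c, \<delta>)" by (rule prod_cases4)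
      obtain y' s' c' \<delta>' where p': "p' = (y', s', c', \<delta>')" by (rule prod_cases4)
      have q: "q = ((y, s, c, \<delta>), (y', s', c', \<delta>))" "0 < \<delta>"
        using that(1) by (simp_all add: pp p p' Q_def)
      show ?thesis
        using that(2) supp[of x s y] far_eq_0[OF q(2), of x y s c] far_eq_0[OF q(2), of x y' s' c'] q
        by (auto simp: V_def dist_norm norm_minus_commute G far_amplitude_def[of y s c] far_amplitude_def[of y' s' c'])
    qed
    have 4: "symbols b Q (\<lambda>_. UNIV) w N (e + e) G"
      by (rule symbols_extend_by_zero[OF U_open 3 V_open V_zero]) (auto simp: V_def U_def Q_def)
    have it: "symbols b Q (\<lambda>_. UNIV) w (N - i) (2 * e - real i) (\<lambda>q. (dir_deriv b ^^ i) (G q))"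
      if "i \<le> N" for i
      using symbols_iterate[OF 4 that] by (simp only: mult_2)
    have "\<exists>D\<ge>0. \<forall>q\<in>Q. \<forall>x\<in>UNIV. norm ((dir_deriv b ^^ N) (G q) x) \<le> D * w q x powr (2 * e - real N)"
      by (rule symbols_bound[OF it[OF order_refl]])
    then obtain D where D: "0 \<le> D" "\<forall>q\<in>Q. \<forall>x\<in>UNIV. norm ((dir_deriv b ^^ N) (G q) x) \<le> D * w q x powr (2 * e - real N)"
      by (elim exE conjE) (rule that)
    have cont: "continuous_on UNIV ((dir_deriv b ^^ i) (G q))" if "i \<le> N" "q \<in> Q" for i q
      by (rule symbols_continuous[OF it[OF that(1)] that(2)])
    have deriv: "has_dir_deriv b ((dir_deriv b ^^ i) (G q)) ((dir_deriv b ^^ Suc i) (G q) x) x"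
      if "i < N" "q \<in> Q" for i q x
    proof -
      have "symbols b Q (\<lambda>_. UNIV) w (Suc (N - Suc i)) (2 * e - real i) (\<lambda>q. (dir_deriv b ^^ i) (G q))"
        using it[of i] that(1) by (simp only: Suc_diff_Suc less_imp_le)
      from symbols_has_dir_deriv[OF this that(2) UNIV_I] show ?thesis by (simp only: funpow.simps o_apply)
    qed
    have zero: "(dir_deriv b ^^ i) (G q) x = 0" if "q \<in> Q" "x \<in> V q" for i q x
      using that(1) by (rule dir_deriv_iterate_zero[OF V_open V_zero]) (use that in auto)
    show ?thesis
      unfolding osc_def
    proof (intro exI[of _ "2 * D * CE"] conjI allI impI)
      show "0 \<le> 2 * D * CE" using D CE by simp
      fix y y' :: 'a and s c c' \<delta> lam :: real
      assume \<delta>: "0 < \<delta>" and lam: "0 < lam" and nz: "(y - y') \<bullet> b \<noteq> 0"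
      let ?q = "((y, s, c, \<delta>), (y', s, c', \<delta>))"
      have q: "?q \<in> Q" using \<delta> by (simp add: Q_def)
      let ?h = "(dir_deriv b ^^ N) (G ?q)"
      have "norm (LINT x|lborel. exp (\<i> * of_real (lam * (x \<bullet> (y - y')))) * G ?q x)
          \<le> (LINT x|lborel. norm (?h x)) / \<bar>lam * ((y - y') \<bullet> b)\<bar> ^ N"
      proof (rule oscillatory_integral_bound[where R=R])
        show "norm x \<le> R" if "(dir_deriv b ^^ i) (G ?q) x \<noteq> 0" for i x
          using zero[OF q, of x i] that by (force simp: V_def)
      qed (use cont deriv q nz lam in auto)
      also have "(LINT x|lborel. norm (?h x)) / \<bar>lam * ((y - y') \<bullet> b)\<bar> ^ N
          \<le> 2 * D * CE * \<delta> powr (2 * e - 1) / \<bar>lam * ((y - y') \<bullet> b)\<bar> ^ N"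
      proof -
        have "(LINT x|lborel. norm (?h x)) \<le> 2 * D * CE * \<delta> powr (2 * e - 1)"
        proof -
          define k where "k z = indicator (- ball 0 \<delta>) z * norm z powr (2 * e - N)" for z :: 'a
          have [measurable]: "(indicator (- ball 0 \<delta>) :: 'a \<Rightarrow> real) \<in> borel_measurable borel"
            by (auto intro!: borel_measurable_indicator)
          have [measurable]: "k \<in> borel_measurable borel" unfolding k_def by measurable
          have k_nonneg: "0 \<le> k z" for z by (simp add: k_def)
          have le: "norm (?h x) \<le> D * k (x - y) + D * k (x - y')" for x
          proof (cases "x \<in> V ?q")
            case True
            then show ?thesis using zero[OF q True] D k_nonneg by simp
          next
            case False
            then have "\<delta> \<le> norm (x - y)" "\<delta> \<le> norm (x - y')"
              by (auto simp: V_def dist_norm norm_minus_commute)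
            then have "k (x - y) = norm (x - y) powr (2 * e - real N)" "k (x - y') = norm (x - y') powr (2 * e - real N)"
              by (simp_all add: k_def)
            moreover have "norm (?h x) \<le> D * min (norm (x - y)) (norm (x - y')) powr (2 * e - real N)"
              using D(2)[rule_format, OF q UNIV_I, of x] by (simp only: w_def fst_conv snd_conv)
            moreover have "min (norm (x - y)) (norm (x - y')) powr (2 * e - real N)
                \<le> norm (x - y) powr (2 * e - real N) + norm (x - y') powr (2 * e - real N)"
              by (simp add: min_def)
            ultimately show ?thesis
              using D(1) mult_left_mono[of "min (norm (x - y)) (norm (x - y')) powr (2 * e - real N)"
                  "k (x - y) + k (x - y')" D] by (simp add: distrib_left)
          qed
          have "(\<integral>\<^sup>+z. ennreal (k z) \<partial>lborel) \<le> ennreal (CE * \<delta> powr (2 * e - N + ?n))"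
            unfolding k_def by (rule CE(2)[OF \<delta>])
          moreover have "2 * e - N + ?n = 2 * e - 1" by (simp add: N_eq)
          ultimately have int: "(\<integral>\<^sup>+z. ennreal (k z) \<partial>lborel) \<le> ennreal (CE * \<delta> powr (2 * e - 1))"
            by (simp only:)
          have "(LINT x|lborel. norm (?h x)) \<le> 2 * D * (CE * \<delta> powr (2 * e - 1))"
            by (rule integral_norm_le_two_translates[OF _ k_nonneg D(1) _ le int]) (use CE(1) in simp_all)
          then show ?thesis by (simp only: mult.assoc)
        qed
        then show ?thesis by (rule divide_right_mono) simp
      qed
      finally show "norm (LINT x|lborel. exp (\<i> * of_real (lam * (x \<bullet> (y - y')))) * (far_amplitude y s c \<delta> x * cnj (far_amplitude y' s c' \<delta> x)))
          \<le> 2 * D * CE * \<delta> powr (2 * e - 1) / \<bar>lam * ((y - y') \<bullet> b)\<bar> ^ N"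
        by (simp only: G)
    qed
  qed
  then have "\<forall>b\<in>Basis. \<exists>D. 0 \<le> D \<and> osc b D" by blast
  from bchoice[OF this] obtain D where "\<forall>b\<in>Basis. 0 \<le> D b \<and> osc b (D b)" by blast
  then have D: "0 \<le> D b" "osc b (D b)" if "b \<in> Basis" for b using that by auto
  let ?C = "(\<Sum>b\<in>Basis. D b) + 1"
  show ?thesis
  proof (rule that[of "?C * ?n ^ N"])
    show "0 < ?C * ?n ^ N" using D(1) by (simp add: sum_nonneg add_nonneg_pos)
    fix y y' :: 'a and s c c' \<delta> lam :: real
    assume ne: "y \<noteq> y'" and \<delta>: "0 < \<delta>" and lam: "0 < lam"
    let ?w = "y - y'"
    \<comment> \<open>the largest coordinate is at least the average, and the norm is at most the sum of all \<open>n\<close>\<close>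
    have "\<exists>b\<in>Basis. norm ?w \<le> ?n * \<bar>?w \<bullet> b\<bar>"
    proof (rule ccontr)
      assume "\<not> ?thesis"
      then have "\<bar>?w \<bullet> b\<bar> < norm ?w / ?n" if "b \<in> Basis" for b
        using that by (auto simp: field_simps not_le)
      then have "(\<Sum>b\<in>Basis. \<bar>?w \<bullet> b\<bar>) < (\<Sum>b\<in>(Basis::'a set). norm ?w / ?n)"
        by (intro sum_strict_mono) auto
      then show False using norm_le_l1[of ?w] by simp
    qed
    then obtain b where b: "b \<in> Basis" "norm ?w \<le> ?n * \<bar>?w \<bullet> b\<bar>" by blast
    have wb: "?w \<bullet> b \<noteq> 0" using b(2) ne by auto
    have "norm (LINT x|lborel. exp (\<i> * of_real (lam * (x \<bullet> ?w))) * (far_amplitude y s c \<delta> x * cnj (far_amplitude y' s c' \<delta> x)))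
        \<le> D b * \<delta> powr (2 * e - 1) / \<bar>lam * (?w \<bullet> b)\<bar> ^ N"
      using D(2)[OF b(1)] \<delta> lam wb unfolding osc_def by blast
    also have "\<dots> \<le> ?C * \<delta> powr (2 * e - 1) / (lam * norm ?w / ?n) ^ N"
    proof (intro frac_le mult_right_mono power_mono)
      have "D b \<le> (\<Sum>b\<in>Basis. D b)" using D(1) b(1) by (intro member_le_sum) auto
      then show "D b \<le> ?C" by simp
      show "lam * norm ?w / ?n \<le> \<bar>lam * (?w \<bullet> b)\<bar>"
        using b(2) lam by (simp add: abs_mult divide_le_eq mult.commute mult.left_commute)
      show "0 \<le> ?C * \<delta> powr (2 * e - 1)" using D(1) by (simp add: sum_nonneg)
      show "0 < (lam * norm ?w / ?n) ^ N" using lam ne by simp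
    qed (use lam in auto)
    also have "\<dots> = ?C * ?n ^ N * \<delta> powr (2 * e - 1) * (lam * norm ?w) powr - real N"
    proof -
      have "(lam * norm ?w) powr - real N = inverse ((lam * norm ?w) ^ N)"
        using lam ne by (simp only: powr_minus powr_realpow mult_pos_pos zero_less_norm_iff right_minus_eq not_False_eq_True)
      moreover have "a * d / (W / t) ^ k = a * t ^ k * d * inverse (W ^ k)" for a d W t :: real and k
        by (simp only: power_divide divide_divide_eq_right) (simp add: divide_inverse)
      ultimately show ?thesis by (simp only:)
    qed
    finally show "norm (LINT x|lborel. exp (\<i> * of_real (lam * (x \<bullet> ?w))) * (far_amplitude y s c \<delta> x * cnj (far_amplitude y' s c' \<delta> x)))
        \<le> ?C * ?n ^ N * \<delta> powr (2 * e - 1) * (lam * norm ?w) powr - real N" .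
  qed
qed

lemma norm_far_le: "norm (far_amplitude y s c \<delta> x) \<le> norm (of_real (\<phi> ((x, s), y)) * K (x - y, c))"
proof -
  have "norm (far_amplitude y s c \<delta> x) = cutoff (Suc N) \<delta> (x - y) * norm (of_real (\<phi> ((x, s), y)) * K (x - y, c))"
    using cutoff_bounds[of "Suc N" \<delta> "x - y"] by (simp add: far_amplitude_def norm_mult)
  also have "\<dots> \<le> 1 * norm (of_real (\<phi> ((x, s), y)) * K (x - y, c))"
    by (rule mult_right_mono[OF cutoff_bounds(2)]) simp
  finally show ?thesis by simp
qed

text \<open>One amplitude is bounded by its supremum \<open>O(\<delta> powr e)\<close>, the other one by an integrable function. This is
  far from sharp in some ranges of \<open>m\<close>, but it suffices for the exponent in question.\<close>

lemma gram_crude_bound: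
  obtains C where "0 < C" "\<And>y y' s c c' \<delta> u. 0 < \<delta> \<Longrightarrow>
    norm (LINT x|lborel. exp (\<i> * of_real (u x)) * (far_amplitude y s c \<delta> x * cnj (far_amplitude y' s c' \<delta> x)))
      \<le> C * \<delta> powr e"
proof -
  let ?n = "real DIM('a)"
  obtain B R :: real where B: "0 < B" "0 < R" and size: "\<And>x y s c. x \<noteq> y \<Longrightarrow>
      norm (of_real (\<phi> ((x, s), y)) * K (x - y, c)) \<le> B * (indicator (cball 0 R) (x - y) * norm (x - y) powr e)"
    by (rule amplitude_kernel_size) blast
  obtain C where C: "0 < C" "\<And>r. 0 < r \<Longrightarrow>
    (\<integral>\<^sup>+z. ennreal (indicator (cball (0::'a) r) z * norm z powr e) \<partial>lborel) \<le> ennreal (C * r powr (e + ?n))"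
    by (rule nn_integral_norm_powr_cball[where 'a='a, of e]) (use e_bounds in auto)
  define k where "k z = indicator (cball 0 R) z * norm z powr e" for z :: 'a
  have [measurable]: "(indicator (cball 0 R) :: 'a \<Rightarrow> real) \<in> borel_measurable borel"
    by (auto intro!: borel_measurable_indicator)
  have km: "k \<in> borel_measurable borel" unfolding k_def by measurable
  have k0: "0 \<le> k z" for z by (simp add: k_def)
  let ?I = "C * R powr (e + ?n)"
  have I0: "0 \<le> ?I" using C(1) by simp
  have int: "(\<integral>\<^sup>+z. ennreal (k z) \<partial>lborel) \<le> ennreal ?I"
    unfolding k_def by (rule C(2)[OF B(2)])
  show ?thesis
  proof (rule that[of "2 * (B * B) * ?I"])
    show "0 < 2 * (B * B) * ?I" using B C by simp
    fix y y' :: 'a and s c c' \<delta> :: real and u :: "'a \<Rightarrow> real"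
    assume \<delta>: "0 < \<delta>"
    let ?h = "\<lambda>x. far_amplitude y s c \<delta> x * cnj (far_amplitude y' s c' \<delta> x)"
    have le: "norm (far_amplitude y s c \<delta> x) \<le> B * k (x - y)" for x y c
    proof (cases "x = y")
      case True
      then show ?thesis using far_eq_0[OF \<delta>, of x y s c] \<delta> B k0 by simp
    next
      case False
      show ?thesis using order_trans[OF norm_far_le size[OF False, of s c]] by (simp only: k_def)
    qed
    have le': "norm (far_amplitude y s c \<delta> x) \<le> B * \<delta> powr e" for x
    proof (cases "norm (x - y) \<le> \<delta>")
      case True
      then show ?thesis using far_eq_0[OF \<delta> True] B by simp
    next
      case False
      have "k (x - y) \<le> norm (x - y) powr e" by (simp add: k_def indicator_def)
      also have "\<dots> \<le> \<delta> powr e" using False \<delta> e_bounds by (intro powr_mono2') auto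
      finally have "B * k (x - y) \<le> B * \<delta> powr e" using B by simp
      then show ?thesis by (rule order_trans[OF le])
    qed
    have dom: "norm (?h x) \<le> (B * B * \<delta> powr e) * k (x - y') + (B * B * \<delta> powr e) * k (x - y')" for x
    proof -
      have "norm (?h x) \<le> (B * \<delta> powr e) * (B * k (x - y'))"
        unfolding norm_mult complex_mod_cnj
        by (intro mult_mono le le') (use B in auto)
      also have "\<dots> \<le> (B * B * \<delta> powr e) * k (x - y') + (B * B * \<delta> powr e) * k (x - y')"
        using B k0 by simp
      finally show ?thesis .
    qed
    have "(LINT x|lborel. norm (?h x)) \<le> 2 * (B * B * \<delta> powr e) * ?I"
      by (rule integral_norm_le_two_translates[OF km k0 _ I0 dom int]) (use B in simp)
    moreover have "norm (LINT x|lborel. exp (\<i> * of_real (u x)) * ?h x) \<le> (LINT x|lborel. norm (?h x))"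
    proof -
      have "norm (LINT x|lborel. exp (\<i> * of_real (u x)) * ?h x) \<le> (LINT x|lborel. norm (exp (\<i> * of_real (u x)) * ?h x))"
        by (rule integral_norm_bound)
      then show ?thesis by (simp add: norm_mult)
    qed
    ultimately show "norm (LINT x|lborel. exp (\<i> * of_real (u x)) * ?h x) \<le> 2 * (B * B) * ?I * \<delta> powr e"
      by (simp add: ac_simps)
  qed
qed

text \<open>Schur's test for the Gram kernel, with the crude bound for \<open>norm (y - y') < \<rho>\<close> and the oscillatory bound
  beyond. The radius \<open>\<rho>\<close> is such that the first region contributes exactly
  \<open>\<delta> powr e * \<rho> ^ n = \<delta> powr (2 * m)\<close>. The second region contributes a power of \<open>\<delta>\<close> whose exponent
  exceeds \<open>2 * m\<close> by \<open>2 + (2 - m) / n\<close>, which is positive since \<open>m < n\<close>.\<close>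

lemma far_operator_bound:
  obtains C where "0 < C" "\<And>\<psi> lam s \<delta> f. \<psi> \<in> borel_measurable borel \<Longrightarrow> 1 \<le> lam \<Longrightarrow>
      \<delta> = lam powr (- real DIM('a) / (2 * real N)) \<Longrightarrow> f \<in> L2 \<Longrightarrow>
      L2_norm (\<lambda>x. LINT y|lborel. exp (\<i> * of_real (lam * (x \<bullet> y))) * far_amplitude y s (s - \<psi> y) \<delta> x * f y)
        \<le> C * \<delta> powr m * L2_norm f"
proof -
  let ?n = "real DIM('a)"
  obtain B R :: real where B: "0 < B" "0 < R" and size: "\<And>x y s c. x \<noteq> y \<Longrightarrow>
      norm (of_real (\<phi> ((x, s), y)) * K (x - y, c)) \<le> B * (indicator (cball 0 R) (x - y) * norm (x - y) powr e)"
    and supp: "\<And>x y s. \<phi> ((x, s), y) \<noteq> 0 \<Longrightarrow> norm x \<le> R \<and> norm y \<le> R"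
    by (rule amplitude_kernel_size) blast
  obtain C1 where C1: "0 < C1" "\<And>y y' s c c' \<delta> u. 0 < \<delta> \<Longrightarrow>
    norm (LINT x|lborel. exp (\<i> * of_real (u x)) * (far_amplitude y s c \<delta> x * cnj (far_amplitude y' s c' \<delta> x))) \<le> C1 * \<delta> powr e"
    by (rule gram_crude_bound) blast
  obtain C2 where C2: "0 < C2" "\<And>y y' s c c' \<delta> lam. y \<noteq> y' \<Longrightarrow> 0 < \<delta> \<Longrightarrow> 0 < lam \<Longrightarrow>
    norm (LINT x|lborel. exp (\<i> * of_real (lam * (x \<bullet> (y - y')))) * (far_amplitude y s c \<delta> x * cnj (far_amplitude y' s c' \<delta> x)))
      \<le> C2 * \<delta> powr (2 * e - 1) * (lam * norm (y - y')) powr - real N"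
    by (rule gram_oscillation_bound) blast
  obtain C3 where C3: "0 < C3" "\<And>r. 0 < r \<Longrightarrow>
    (\<integral>\<^sup>+z. ennreal (indicator (- ball (0::'a) r) z * norm z powr - real N) \<partial>lborel) \<le> ennreal (C3 * r powr (- real N + ?n))"
    by (rule nn_integral_norm_powr_exterior[where 'a='a, of "- real N"]) (auto simp: N_eq)
  let ?V = "unit_ball_vol ?n"
  let ?C = "C1 * ?V + C2 * C3"
  have C0: "0 < ?C" using C1(1) C2(1) C3(1) by (simp add: add_pos_pos unit_ball_vol_pos)
  show ?thesis
  proof (rule that[of "sqrt ?C"])
    show "0 < sqrt ?C" using C0 by simp
    fix \<psi> :: "'a \<Rightarrow> real" and lam s \<delta> :: real and f :: "'a \<Rightarrow> complex"
    assume \<psi>: "\<psi> \<in> borel_measurable borel" and lam: "1 \<le> lam"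
      and \<delta>: "\<delta> = lam powr (- ?n / (2 * real N))" and f: "f \<in> L2"
    have n0: "0 < ?n" by simp
    have \<delta>0: "0 < \<delta>" using lam by (simp add: \<delta>)
    have \<delta>1: "\<delta> \<le> 1" using lam powr_mono[of "- ?n / (2 * real N)" 0 lam] by (simp add: \<delta>)
    have lam_\<delta>: "lam = \<delta> powr (- (2 * real N / ?n))"
      using lam by (simp add: \<delta> powr_powr N_eq)
    define \<rho> where "\<rho> = \<delta> powr (1 + m / ?n)"
    have \<rho>: "0 < \<rho>" using \<delta>0 by (simp add: \<rho>_def)
    define g where "g z = C1 * \<delta> powr e * indicator (ball 0 \<rho>) z +
        C2 * \<delta> powr (2 * e - 1) * lam powr - real N * (indicator (- ball 0 \<rho>) z * norm z powr - real N)" for z :: 'a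
    have [measurable]: "(indicator (ball 0 \<rho>) :: 'a \<Rightarrow> real) \<in> borel_measurable borel"
       "(indicator (- ball 0 \<rho>) :: 'a \<Rightarrow> real) \<in> borel_measurable borel"
      by (auto intro!: borel_measurable_indicator)
    have gm [measurable]: "g \<in> borel_measurable borel" unfolding g_def by measurable
    have g0: "0 \<le> g z" for z unfolding g_def using C1(1) C2(1) by simp
    have g_sym: "g (y - y') = g (y' - y)" for y y' by (simp add: g_def indicator_def norm_minus_commute)
    let ?a = "?C * \<delta> powr (2 * m)"
    have g_int: "(\<integral>\<^sup>+z. ennreal (g z) \<partial>lborel) \<le> ennreal ?a"
    proof -
      let ?c1 = "C1 * \<delta> powr e" and ?c2 = "C2 * \<delta> powr (2 * e - 1) * lam powr - real N"
      let ?h = "\<lambda>z::'a. indicator (- ball 0 \<rho>) z * norm z powr - real N"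
      have nn: "0 \<le> ?c1" "0 \<le> ?c2" using C1(1) C2(1) by auto
      have "(\<integral>\<^sup>+z. ennreal (g z) \<partial>lborel)
          = (\<integral>\<^sup>+z. ennreal ?c1 * indicator (ball (0::'a) \<rho>) z + ennreal ?c2 * ennreal (?h z) \<partial>lborel)"
      proof (rule nn_integral_cong)
        fix z
        have "ennreal (g z) = ennreal (?c1 * indicator (ball 0 \<rho>) z) + ennreal (?c2 * ?h z)"
          unfolding g_def by (rule ennreal_plus) (intro mult_nonneg_nonneg nn; simp)+
        also have "ennreal (?c1 * indicator (ball 0 \<rho>) z) = ennreal ?c1 * indicator (ball (0::'a) \<rho>) z"
          by (simp add: indicator_def)
        also have "ennreal (?c2 * ?h z) = ennreal ?c2 * ennreal (?h z)"
          by (rule ennreal_mult[OF nn(2)]) simp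
        finally show "ennreal (g z) = ennreal ?c1 * indicator (ball (0::'a) \<rho>) z + ennreal ?c2 * ennreal (?h z)" .
      qed
      also have "\<dots> = ennreal ?c1 * emeasure lborel (ball (0::'a) \<rho>) + ennreal ?c2 * (\<integral>\<^sup>+z. ennreal (?h z) \<partial>lborel)"
      proof -
        have 1: "(\<lambda>z::'a. ennreal ?c1 * indicator (ball 0 \<rho>) z) \<in> borel_measurable lborel"
          by (intro borel_measurable_times_ennreal borel_measurable_const borel_measurable_indicator) simp
        have 2: "(\<lambda>z. ennreal ?c2 * ennreal (?h z)) \<in> borel_measurable lborel" by measurable
        have 3: "(\<integral>\<^sup>+z. ennreal ?c1 * indicator (ball (0::'a) \<rho>) z \<partial>lborel) = ennreal ?c1 * emeasure lborel (ball (0::'a) \<rho>)"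
          by (rule nn_integral_cmult_indicator) simp
        have 4: "(\<integral>\<^sup>+z. ennreal ?c2 * ennreal (?h z) \<partial>lborel) = ennreal ?c2 * (\<integral>\<^sup>+z. ennreal (?h z) \<partial>lborel)"
          by (rule nn_integral_cmult) measurable
        show ?thesis by (simp only: nn_integral_add[OF 1 2] 3 4)
      qed
      also have "\<dots> \<le> ennreal ?c1 * ennreal (?V * \<rho> ^ DIM('a)) + ennreal ?c2 * ennreal (C3 * \<rho> powr (- real N + ?n))"
        using \<rho> by (intro add_mono mult_left_mono C3(2)) (auto simp: emeasure_ball)
      also have "\<dots> = ennreal (?c1 * (?V * \<rho> ^ DIM('a)) + ?c2 * (C3 * \<rho> powr (- real N + ?n)))"
      proof -
        have p: "0 \<le> ?V * \<rho> ^ DIM('a)" "0 \<le> C3 * \<rho> powr (- real N + ?n)"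
          using \<rho> C3(1) by auto
        show ?thesis
          by (simp only: ennreal_mult[OF nn(1) p(1), symmetric] ennreal_mult[OF nn(2) p(2), symmetric])
            (rule ennreal_plus[symmetric]; intro mult_nonneg_nonneg nn p)
      qed
      also have "\<dots> \<le> ennreal ?a"
      proof (rule ennreal_leI)
        have "\<delta> powr e * \<rho> ^ DIM('a) = \<delta> powr (2 * m)"
        proof -
          have "\<rho> ^ DIM('a) = \<rho> powr ?n" using \<rho> by (simp add: powr_realpow)
          also have "\<dots> = \<delta> powr (?n + m)" using n0 by (simp add: \<rho>_def powr_powr distrib_right)
          finally have "\<delta> powr e * \<rho> ^ DIM('a) = \<delta> powr (e + (?n + m))" by (simp only: powr_add)
          then show ?thesis by (simp add: e_eq)
        qed
        then have 1: "?c1 * (?V * \<rho> ^ DIM('a)) = C1 * ?V * \<delta> powr (2 * m)"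
          by (metis (no_types, opaque_lifting) mult.assoc mult.left_commute)
        have "\<delta> powr (2 * e - 1) * lam powr - real N * \<rho> powr (- real N + ?n) \<le> \<delta> powr (2 * m)"
        proof -
          have l: "lam powr - real N = \<delta> powr (2 * real N * real N / ?n)"
            by (subst lam_\<delta>) (simp add: powr_powr)
          have r: "\<rho> powr (- real N + ?n) = \<delta> powr (- (1 + m / ?n))"
          proof -
            have "- real N + ?n = - 1" by (simp add: N_eq)
            then show ?thesis by (simp only: \<rho>_def powr_powr mult_minus1_right)
          qed
          have ex: "2 * m \<le> 2 * e - 1 + 2 * real N * real N / ?n + - (1 + m / ?n)"
          proof -
            have "2 * real N * real N / ?n = 2 * ?n + 4 + 2 / ?n"
              using n0 by (simp add: N_eq field_simps)
            moreover have "m / ?n \<le> 1" "0 \<le> 2 / ?n" using m n0 by (auto simp: divide_le_eq)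
            moreover have "2 * m \<le> 2 * (m - d) - 1 + q + - (1 + a)"
              if "q = 2 * d + 4 + b" "a \<le> 1" "0 \<le> b" for q a b d :: real
              using that by (simp add: algebra_simps)
            ultimately show ?thesis unfolding e_eq by blast
          qed
          have "\<delta> powr (2 * e - 1) * lam powr - real N * \<rho> powr (- real N + ?n)
              = \<delta> powr (2 * e - 1 + 2 * real N * real N / ?n + - (1 + m / ?n))"
            unfolding l r by (simp only: powr_add)
          also have "\<dots> \<le> \<delta> powr (2 * m)" by (rule powr_mono'[OF ex]) (use \<delta>0 \<delta>1 in auto)
          finally show ?thesis .
        qed
        from mult_left_mono[OF this, of "C2 * C3"]
        have 2: "?c2 * (C3 * \<rho> powr (- real N + ?n)) \<le> C2 * C3 * \<delta> powr (2 * m)"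
          using C2(1) C3(1) by (simp add: ac_simps)
        show "?c1 * (?V * \<rho> ^ DIM('a)) + ?c2 * (C3 * \<rho> powr (- real N + ?n)) \<le> ?a"
          using 1 2 by (simp only: distrib_right add_left_mono)
      qed
      finally show ?thesis .
    qed
    define A where "A x y = exp (\<i> * of_real (lam * (x \<bullet> y))) * far_amplitude y s (s - \<psi> y) \<delta> x" for x y
    have Am: "(\<lambda>(x, y). A x y) \<in> borel_measurable (borel \<Otimes>\<^sub>M borel)"
    proof -
      note far_measurable[OF \<psi>, of s \<delta>, measurable]
      show ?thesis unfolding A_def split_beta' by measurable
    qed
    have AB: "norm (A x y) \<le> B * \<delta> powr e" for x y
    proof (cases "norm (x - y) \<le> \<delta>")
      case True
      then show ?thesis using far_eq_0[OF \<delta>0 True] B by (simp add: A_def)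
    next
      case False
      have "norm (A x y) = norm (far_amplitude y s (s - \<psi> y) \<delta> x)" by (simp add: A_def norm_mult)
      also have "\<dots> \<le> B * (indicator (cball 0 R) (x - y) * norm (x - y) powr e)"
        by (rule order_trans[OF norm_far_le size]) (use False \<delta>0 in auto)
      also have "\<dots> \<le> B * \<delta> powr e"
      proof (rule mult_left_mono)
        have "indicator (cball 0 R) (x - y) * norm (x - y) powr e \<le> norm (x - y) powr e"
          by (simp add: indicator_def)
        also have "\<dots> \<le> \<delta> powr e" using False \<delta>0 e_bounds by (intro powr_mono2') auto
        finally show "indicator (cball 0 R) (x - y) * norm (x - y) powr e \<le> \<delta> powr e" .
      qed (use B in simp)
      finally show ?thesis .
    qed
    have Asupp: "norm x \<le> R \<and> norm y \<le> R" if "A x y \<noteq> 0" for x y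
      using that supp[of x s y] by (auto simp: A_def far_amplitude_def)
    have gram: "norm (LINT x|lborel. A x y * cnj (A x y')) \<le> g (y - y')" if "y \<noteq> y'" for y y'
    proof -
      have "A x y * cnj (A x y') = exp (\<i> * of_real (lam * (x \<bullet> (y - y')))) *
          (far_amplitude y s (s - \<psi> y) \<delta> x * cnj (far_amplitude y' s (s - \<psi> y') \<delta> x))" for x
      proof -
        have "exp (\<i> * of_real (lam * (x \<bullet> y))) * cnj (exp (\<i> * of_real (lam * (x \<bullet> y'))))
            = exp (\<i> * of_real (lam * (x \<bullet> (y - y'))))"
          by (simp add: exp_cnj mult_exp_exp inner_diff_right algebra_simps)
        then show ?thesis by (simp add: A_def ac_simps)
      qed
      then have eq: "(LINT x|lborel. A x y * cnj (A x y')) = (LINT x|lborel. exp (\<i> * of_real (lam * (x \<bullet> (y - y')))) *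
          (far_amplitude y s (s - \<psi> y) \<delta> x * cnj (far_amplitude y' s (s - \<psi> y') \<delta> x)))" by (simp only:)
      show ?thesis
      proof (cases "norm (y - y') < \<rho>")
        case True
        then have "g (y - y') = C1 * \<delta> powr e" by (simp add: g_def indicator_def)
        then show ?thesis unfolding eq using C1(2)[OF \<delta>0] by (simp only:)
      next
        case False
        then have "g (y - y') = C2 * \<delta> powr (2 * e - 1) * (lam * norm (y - y')) powr - real N"
          using lam by (simp add: g_def indicator_def powr_mult)
        then show ?thesis unfolding eq using C2(2)[OF that \<delta>0, of lam] lam by simp
      qed
    qed
    have col: "(\<integral>\<^sup>+y. ennreal (g (y - y')) \<partial>lborel) \<le> ennreal ?a" for y'
      using nn_integral_translate[of "\<lambda>z. ennreal (g z)" y'] g_int by simp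
    have row: "(\<integral>\<^sup>+y'. ennreal (g (y - y')) \<partial>lborel) \<le> ennreal ?a" for y
      unfolding g_sym[of y] by (rule col)
    have gm2: "(\<lambda>(y, y'). g (y - y')) \<in> borel_measurable (borel \<Otimes>\<^sub>M borel)" by measurable
    have "(L2_norm (\<lambda>x. LINT y|lborel. A x y * f y))\<^sup>2 \<le> ?a * (L2_norm f)\<^sup>2"
      by (rule tstar_t_bound[OF Am gm2 AB Asupp gram g0 row col _ f]) (use C0 in auto)
    also have "\<dots> = (sqrt ?C * \<delta> powr m * L2_norm f)\<^sup>2"
    proof -
      have "(\<delta> powr m)\<^sup>2 = \<delta> powr (2 * m)" using \<delta>0 by (simp add: powr_power)
      moreover have "(sqrt ?C)\<^sup>2 = ?C" using C0 by (intro real_sqrt_pow2) simp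
      ultimately show ?thesis by (simp only: power_mult_distrib)
    qed
    finally have "L2_norm (\<lambda>x. LINT y|lborel. A x y * f y) \<le> sqrt ?C * \<delta> powr m * L2_norm f"
      by (rule power2_le_imp_le) (use C0 in \<open>simp add: L2_norm_def\<close>)
    then show "L2_norm (\<lambda>x. LINT y|lborel. exp (\<i> * of_real (lam * (x \<bullet> y))) * far_amplitude y s (s - \<psi> y) \<delta> x * f y)
        \<le> sqrt ?C * \<delta> powr m * L2_norm f"
      by (simp only: A_def)
  qed
qed

text \<open>For small \<open>lam\<close> Schur's test for the whole kernel is enough. Otherwise the kernel is cut at distance
  \<open>\<delta>\<close>; Schur's test bounds the part near the diagonal by the same power of \<open>\<delta>\<close> as
  \<open>far_operator_bound\<close> gives for the rest, and this determines the choice of \<open>\<delta>\<close>.\<close>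

theorem kernel_operator_bound:
  obtains C where "0 < C" "\<And>\<psi> lam s f. \<psi> \<in> borel_measurable borel \<Longrightarrow> 0 < lam \<Longrightarrow> f \<in> L2 \<Longrightarrow>
      (AE x in lborel. integrable lborel (\<lambda>y. kernel \<psi> lam s x y * f y)) \<and>
      (\<lambda>x. LINT y|lborel. kernel \<psi> lam s x y * f y) \<in> L2 \<and>
      L2_norm (\<lambda>x. LINT y|lborel. kernel \<psi> lam s x y * f y)
        \<le> C * lam powr (- (m / 2) * (real DIM('a) / (real DIM('a) + 1))) * L2_norm f"
proof -
  let ?n = "real DIM('a)"
  obtain B R :: real where B: "0 < B" "0 < R" and size: "\<And>x y s c. x \<noteq> y \<Longrightarrow>
      norm (of_real (\<phi> ((x, s), y)) * K (x - y, c)) \<le> B * (indicator (cball 0 R) (x - y) * norm (x - y) powr e)"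
    by (rule amplitude_kernel_size) blast
  obtain C1 where C1: "0 < C1" "\<And>(A :: 'a \<Rightarrow> 'a \<Rightarrow> complex) B r f.
      (\<lambda>(x, y). A x y) \<in> borel_measurable (borel \<Otimes>\<^sub>M borel) \<Longrightarrow> 0 < r \<Longrightarrow> 0 \<le> B \<Longrightarrow>
      (\<And>x y. x \<noteq> y \<Longrightarrow> norm (A x y) \<le> B * (indicator (cball 0 r) (x - y) * norm (x - y) powr e)) \<Longrightarrow>
      f \<in> L2 \<Longrightarrow>
      (AE x in lborel. integrable lborel (\<lambda>y. A x y * f y)) \<and>
      (\<lambda>x. LINT y|lborel. A x y * f y) \<in> L2 \<and>
      L2_norm (\<lambda>x. LINT y|lborel. A x y * f y) \<le> C1 * B * r powr (e + ?n) * L2_norm f"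
    by (rule weakly_singular_kernel_bound[where 'a='a, of e]) (use e_bounds in \<open>auto simp del: split_paired_All\<close>)
  obtain C2 where C2: "0 < C2" "\<And>\<psi> lam s \<delta> f. \<psi> \<in> borel_measurable borel \<Longrightarrow> 1 \<le> lam \<Longrightarrow>
      \<delta> = lam powr (- ?n / (2 * real N)) \<Longrightarrow> f \<in> L2 \<Longrightarrow>
      L2_norm (\<lambda>x. LINT y|lborel. exp (\<i> * of_real (lam * (x \<bullet> y))) * far_amplitude y s (s - \<psi> y) \<delta> x * f y)
        \<le> C2 * \<delta> powr m * L2_norm f"
    by (rule far_operator_bound) blast
  let ?C = "C1 * B * R powr m + 2 * (C1 * B * 2 powr m + C2)"
  have pos: "0 < C1 * B * R powr m" "0 < C1 * B * 2 powr m" using B C1(1) by auto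
  have em: "e + ?n = m" by (simp add: e_eq)
  show ?thesis
  proof (rule that[of ?C])
    show "0 < ?C" using pos C2(1) by simp
    fix \<psi> :: "'a \<Rightarrow> real" and lam s :: real and f :: "'a \<Rightarrow> complex"
    assume \<psi>: "\<psi> \<in> borel_measurable borel" and lam: "0 < lam" and f: "f \<in> L2"
    let ?T = "\<lambda>A x. LINT y|lborel. A x y * f y"
    let ?k = "kernel \<psi> lam s"
    let ?r = "lam powr (- (m / 2) * (?n / (?n + 1)))"
    have nf: "0 \<le> L2_norm f" by (simp add: L2_norm_def)
    have norm_kernel: "norm (?k x y) = norm (of_real (\<phi> ((x, s), y)) * K (x - y, s - \<psi> y))" for x y
      by (simp add: kernel_def norm_mult)
    have whole: "(AE x in lborel. integrable lborel (\<lambda>y. ?k x y * f y)) \<and> ?T ?k \<in> L2 \<and>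
        L2_norm (?T ?k) \<le> C1 * B * R powr (e + ?n) * L2_norm f"
      by (rule C1(2)[OF kernel_measurable[OF \<psi>] B(2) _ _ f]) (use B size norm_kernel in auto)
    have "L2_norm (?T ?k) \<le> ?C * ?r * L2_norm f"
    proof (cases "1 \<le> lam")
      case False
      have "1 \<le> ?r"
        using False lam m powr_mono'[of "- (m / 2) * (?n / (?n + 1))" 0 lam] by simp
      have "C1 * B * R powr m * L2_norm f \<le> ?C * L2_norm f"
        using pos C2(1) nf by (intro mult_right_mono) auto
      also have "\<dots> \<le> ?C * L2_norm f * ?r"
        using mult_left_mono[OF \<open>1 \<le> ?r\<close>, of "?C * L2_norm f"] pos C2(1) nf by simp
      finally have "C1 * B * R powr m * L2_norm f \<le> ?C * ?r * L2_norm f" by (simp only: ac_simps)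
      then show ?thesis
        using order_trans[OF whole[THEN conjunct2, THEN conjunct2]] unfolding em by blast
    next
      case True
      define \<delta> where "\<delta> = lam powr (- ?n / (2 * real N))"
      have \<delta>0: "0 < \<delta>" using lam by (simp add: \<delta>_def)
      have r: "\<delta> powr m = ?r"
        by (simp add: \<delta>_def powr_powr N_eq add.commute mult.commute)
      define A where "A x y = exp (\<i> * of_real (lam * (x \<bullet> y))) * far_amplitude y s (s - \<psi> y) \<delta> x" for x y
      define D where "D x y = ?k x y - A x y" for x y
      have Am: "(\<lambda>(x, y). A x y) \<in> borel_measurable (borel \<Otimes>\<^sub>M borel)"
      proof -
        note far_measurable[OF \<psi>, of s \<delta>, measurable]
        show ?thesis unfolding A_def split_beta' by measurable
      qed
      have Dm: "(\<lambda>(x, y). D x y) \<in> borel_measurable (borel \<Otimes>\<^sub>M borel)"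
        using borel_measurable_diff[OF kernel_measurable[OF \<psi>, of lam s] Am] by (simp add: D_def split_beta')
      have far: "(AE x in lborel. integrable lborel (\<lambda>y. A x y * f y)) \<and> ?T A \<in> L2 \<and>
          L2_norm (?T A) \<le> C1 * B * R powr (e + ?n) * L2_norm f"
      proof (rule C1(2)[OF Am B(2) _ _ f])
        show "norm (A x y) \<le> B * (indicator (cball 0 R) (x - y) * norm (x - y) powr e)" if "x \<noteq> y" for x y
          using order_trans[OF norm_far_le size[OF that]] by (simp add: A_def norm_mult)
      qed (use B in simp)
      have far_bound: "L2_norm (?T A) \<le> C2 * \<delta> powr m * L2_norm f"
        unfolding A_def by (rule C2(2)[OF \<psi> True \<delta>_def f])
      have near: "(AE x in lborel. integrable lborel (\<lambda>y. D x y * f y)) \<and> ?T D \<in> L2 \<and>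
          L2_norm (?T D) \<le> C1 * B * (2 * \<delta>) powr (e + ?n) * L2_norm f"
      proof (rule C1(2)[OF Dm _ _ _ f])
        fix x y :: 'a assume xy: "x \<noteq> y"
        let ?\<chi> = "cutoff (Suc N) \<delta> (x - y)"
        have "D x y = of_real (1 - ?\<chi>) * ?k x y"
          by (simp add: D_def A_def kernel_def far_amplitude_def algebra_simps)
        then have D: "norm (D x y) = (1 - ?\<chi>) * norm (of_real (\<phi> ((x, s), y)) * K (x - y, s - \<psi> y))"
          using cutoff_bounds[of "Suc N" \<delta> "x - y"] by (simp only: norm_mult norm_of_real norm_kernel abs_of_nonneg diff_ge_0_iff_ge)
        show "norm (D x y) \<le> B * (indicator (cball 0 (2 * \<delta>)) (x - y) * norm (x - y) powr e)"
        proof (cases "norm (x - y) \<le> 2 * \<delta>")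
          case True
          have "norm (D x y) \<le> 1 * norm (of_real (\<phi> ((x, s), y)) * K (x - y, s - \<psi> y))"
            unfolding D using cutoff_bounds[of "Suc N" \<delta> "x - y"] by (intro mult_right_mono) auto
          also have "\<dots> \<le> B * (indicator (cball 0 R) (x - y) * norm (x - y) powr e)"
            using size[OF xy] by simp
          also have "\<dots> \<le> B * norm (x - y) powr e"
            using B by (simp add: indicator_def)
          finally show ?thesis using True by simp
        next
          case False
          then show ?thesis unfolding D using cutoff_far[of \<delta> "x - y" "Suc N"] \<delta>0 B by simp
        qed
      qed (use B \<delta>0 in auto)
      have "AE x in lborel. norm (?T ?k x) \<le> norm (?T D x) + norm (?T A x)"
        using near[THEN conjunct1] far[THEN conjunct1]
      proof eventually_elim
        case (elim x)
        have "?T ?k x = (LINT y|lborel. D x y * f y + A x y * f y)"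
          by (simp add: D_def algebra_simps)
        also have "\<dots> = ?T D x + ?T A x" by (rule Bochner_Integration.integral_add[OF elim])
        finally show ?case by (simp only: norm_triangle_ineq)
      qed
      then have "L2_norm (?T ?k) \<le> 2 * (L2_norm (?T D) + L2_norm (?T A))"
        using whole near far by (intro L2_norm_le_of_dominated) auto
      also have "\<dots> \<le> 2 * (C1 * B * (2 * \<delta>) powr m * L2_norm f + C2 * \<delta> powr m * L2_norm f)"
        using add_mono[OF near[THEN conjunct2, THEN conjunct2] far_bound] unfolding em by (rule mult_left_mono) simp
      also have "\<dots> = 2 * (C1 * B * 2 powr m + C2) * (?r * L2_norm f)"
        using \<delta>0 by (simp add: powr_mult r algebra_simps)
      also have "\<dots> \<le> ?C * (?r * L2_norm f)"
        using pos nf by (intro mult_right_mono) auto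
      finally show ?thesis by (simp only: mult.assoc)
    qed
    then show "(AE x in lborel. integrable lborel (\<lambda>y. ?k x y * f y)) \<and> ?T ?k \<in> L2 \<and>
        L2_norm (?T ?k) \<le> ?C * ?r * L2_norm f"
      using whole by blast
  qed
qed

end


section \<open>Passing to the surface measure\<close>

lemma grad_continuous:
  fixes \<psi> :: "'a::euclidean_space \<Rightarrow> real"
  assumes "smooth_on \<psi> UNIV"
  shows "continuous_on UNIV (grad \<psi>)"
  unfolding grad_def[abs_def]
  by (intro continuous_intros smooth_on_imp_continuous_on[OF smooth_on_partial_deriv[OF assms]])

lemma grad_bounded:
  fixes \<psi> :: "'a::euclidean_space \<Rightarrow> real"
  assumes "\<And>\<alpha>. bounded (range (multi_deriv \<alpha> \<psi>))"
  obtains B where "\<And>y. norm (grad \<psi> y) \<le> B"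
proof -
  have "\<exists>B. \<forall>y. \<bar>partial_deriv b \<psi> y\<bar> \<le> B" if "b \<in> Basis" for b
    using assms[of "\<lambda>c. if c = b then 1 else 0"] unfolding multi_deriv_single(1)[OF that]
    by (auto simp: bounded_iff)
  then have "\<forall>b\<in>Basis. \<exists>B. \<forall>y. \<bar>partial_deriv b \<psi> y\<bar> \<le> B" by blast
  from bchoice[OF this] obtain B where B: "\<And>b y. b \<in> Basis \<Longrightarrow> \<bar>partial_deriv b \<psi> y\<bar> \<le> B b" by blast
  have "norm (grad \<psi> y) \<le> (\<Sum>b\<in>Basis. B b)" for y
  proof -
    have "norm (grad \<psi> y) \<le> (\<Sum>b\<in>Basis. norm (partial_deriv b \<psi> y *\<^sub>R b))"
      unfolding grad_def by (rule norm_sum)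
    also have "\<dots> \<le> (\<Sum>b\<in>Basis. B b)" by (rule sum_mono) (simp add: B)
    finally show ?thesis .
  qed
  then show ?thesis by (rule that)
qed

lemma AE_le_Linf_norm:
  fixes g :: "'a::euclidean_space \<Rightarrow> 'b::euclidean_space"
  assumes [measurable]: "g \<in> borel_measurable borel" and B: "\<And>y. norm (g y) \<le> B"
  shows "AE y in lborel. norm (g y) \<le> enn2real (Linf_norm g)" "ennreal (enn2real (Linf_norm g)) = Linf_norm g"
proof -
  have "Linf_norm g \<le> ennreal B"
    unfolding Linf_norm_def by (rule esssup_I) (auto intro!: ennreal_leI B)
  then have "Linf_norm g < top" using ennreal_less_top le_less_trans by blast
  then show eq: "ennreal (enn2real (Linf_norm g)) = Linf_norm g" by (rule ennreal_enn2real)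
  have "AE y in lborel. ennreal (norm (g y)) \<le> Linf_norm g"
    unfolding Linf_norm_def by (rule esssup_AE)
  then show "AE y in lborel. norm (g y) \<le> enn2real (Linf_norm g)"
  proof eventually_elim
    case (elim y)
    then have "ennreal (norm (g y)) \<le> ennreal (enn2real (Linf_norm g))" by (simp only: eq)
    then show ?case by (simp only: ennreal_le_iff enn2real_nonneg)
  qed
qed

lemma L2_multiplier:
  fixes f :: "'a::euclidean_space \<Rightarrow> complex"
  assumes J[measurable]: "J \<in> borel_measurable borel" and f: "f \<in> L2" and M: "0 \<le> M"
    and le: "AE y in lborel. \<bar>J y\<bar> \<le> M"
  shows "(\<lambda>y. of_real (J y) * f y) \<in> L2" "L2_norm (\<lambda>y. of_real (J y) * f y) \<le> M * L2_norm f"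
proof -
  note [measurable] = L2_measurable[OF f]
  have "(\<integral>\<^sup>+y. ennreal ((norm (of_real (J y) * f y))\<^sup>2) \<partial>lborel) \<le> (\<integral>\<^sup>+y. ennreal (M\<^sup>2) * ennreal ((norm (f y))\<^sup>2) \<partial>lborel)"
  proof (rule nn_integral_mono_AE)
    show "AE y in lborel. ennreal ((norm (of_real (J y) * f y))\<^sup>2) \<le> ennreal (M\<^sup>2) * ennreal ((norm (f y))\<^sup>2)"
      using le
    proof eventually_elim
      case (elim y)
      have "(norm (of_real (J y) * f y))\<^sup>2 \<le> M\<^sup>2 * (norm (f y))\<^sup>2"
        unfolding norm_mult norm_of_real power_mult_distrib using elim by (intro mult_right_mono power_mono) auto
      then have "ennreal ((norm (of_real (J y) * f y))\<^sup>2) \<le> ennreal (M\<^sup>2 * (norm (f y))\<^sup>2)" by (rule ennreal_leI)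
      also have "\<dots> = ennreal (M\<^sup>2) * ennreal ((norm (f y))\<^sup>2)" by (rule ennreal_mult) auto
      finally show ?case .
    qed
  qed
  also have "\<dots> = ennreal (M\<^sup>2) * ennreal ((L2_norm f)\<^sup>2)"
    by (subst nn_integral_cmult) (simp_all only: nn_integral_norm_power2[OF f], measurable)
  also have "\<dots> = ennreal ((M * L2_norm f)\<^sup>2)"
    by (simp add: ennreal_mult power_mult_distrib)
  finally have *: "(\<integral>\<^sup>+y. ennreal ((norm (of_real (J y) * f y))\<^sup>2) \<partial>lborel) \<le> ennreal ((M * L2_norm f)\<^sup>2)" .
  have "0 \<le> M * L2_norm f" using M by (simp add: L2_norm_def)
  from L2_normI[OF _ this *]
  show "(\<lambda>y. of_real (J y) * f y) \<in> L2" "L2_norm (\<lambda>y. of_real (J y) * f y) \<le> M * L2_norm f"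
    by simp_all
qed

lemma hypersurface_borel:
  assumes "continuous_on UNIV \<psi>"
  shows "hypersurface \<psi> \<in> sets borel"
proof -
  have "hypersurface \<psi> = {q. snd q = \<psi> (fst q)}"
    by (auto simp: hypersurface_def)
  moreover have "closed {q. snd q = \<psi> (fst q)}"
    by (intro closed_Collect_eq continuous_intros continuous_on_compose2[OF assms]) auto
  ultimately show ?thesis by simp
qed

text \<open>The surface measure is the image of \<open>sqrt (1 + \<bar>\<nabla>\<psi>\<bar>\<^sup>2) dy\<close> under the graph map, so both integrability and
  the integral over the graph can be read off in the parameter \<open>y\<close>.\<close>

lemma surface_integral_pullback:
  fixes g :: "(real ^ 'n) \<times> real \<Rightarrow> complex" and \<psi> :: "real ^ 'n \<Rightarrow> real"
  assumes \<psi>: "continuous_on UNIV \<psi>" "continuous_on UNIV (grad \<psi>)" and g: "g \<in> borel_measurable borel"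
  shows "set_integrable (surface_measure \<psi>) (hypersurface \<psi>) g \<longleftrightarrow>
      integrable lborel (\<lambda>y. of_real (sqrt (1 + (norm (grad \<psi> y))\<^sup>2)) * g (y, \<psi> y))" (is ?int)
    and "(LINT q : hypersurface \<psi> | surface_measure \<psi>. g q)
      = (LINT y|lborel. of_real (sqrt (1 + (norm (grad \<psi> y))\<^sup>2)) * g (y, \<psi> y))" (is ?val)
proof -
  let ?J = "\<lambda>y. sqrt (1 + (norm (grad \<psi> y))\<^sup>2)"
  have [measurable]: "\<psi> \<in> borel_measurable borel" "grad \<psi> \<in> borel_measurable borel"
    using \<psi> by (auto intro: borel_measurable_continuous_onI)
  have h: "(\<lambda>q. indicator (hypersurface \<psi>) q *\<^sub>R g q) \<in> borel_measurable borel"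
    using hypersurface_borel[OF \<psi>(1)] g by (intro borel_measurable_scaleR borel_measurable_indicator) auto
  have map: "(\<lambda>y. (y, \<psi> y)) \<in> measurable (density lborel (\<lambda>y. ennreal (?J y))) borel"
    by (simp add: borel_prod[symmetric])
  have on: "indicator (hypersurface \<psi>) (y, \<psi> y) *\<^sub>R g (y, \<psi> y) = g (y, \<psi> y)" for y
    by (simp add: hypersurface_def)
  have gm: "(\<lambda>y. g (y, \<psi> y)) \<in> borel_measurable borel"
    by (rule measurable_compose[OF _ g]) (simp add: borel_prod[symmetric])
  have J0: "AE y in lborel. 0 \<le> ?J y" by simp
  have Jm: "?J \<in> borel_measurable lborel" by measurable
  show ?int
    unfolding set_integrable_def surface_measure_def integrable_distr_eq[OF map h] on
    using integrable_density[OF _ Jm J0, of "\<lambda>y. g (y, \<psi> y)"] gm by (simp add: scaleR_conv_of_real)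
  show ?val
    unfolding set_lebesgue_integral_def surface_measure_def integral_distr[OF map h] on
    using integral_density[OF _ Jm J0, of "\<lambda>y. g (y, \<psi> y)"] gm by (simp add: scaleR_conv_of_real)
qed

theorem theorem2p1:
  fixes m :: real
    and K :: "(real ^ 'n) \<times> real \<Rightarrow> complex"
    and \<phi>\<^sub>0 :: "((real ^ 'n) \<times> real) \<times> (real ^ 'n) \<Rightarrow> real"
  assumes m: "1 \<le> m" "m < real CARD('n)"
    and \<phi>\<^sub>0_smooth: "smooth_on \<phi>\<^sub>0 UNIV"
    and \<phi>\<^sub>0_supp: "compact (closure {p. \<phi>\<^sub>0 p \<noteq> 0})"
    and K_smooth: "smooth_on K (- {0})"
    and K_bound: "\<forall>\<alpha>. \<exists>C\<^sub>\<alpha>. \<forall>z. z \<noteq> 0 \<longrightarrow>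
          norm (multi_deriv \<alpha> K z) \<le> C\<^sub>\<alpha> * norm z powr (m - real CARD('n) - real (multi_order \<alpha>))"
  shows "\<exists>C::real. \<forall>\<psi> :: real ^ 'n \<Rightarrow> real.
           smooth_on \<psi> UNIV \<longrightarrow> (\<forall>\<alpha>. bounded (range (multi_deriv \<alpha> \<psi>))) \<longrightarrow>
           (\<forall>lam>0. \<forall>s::real.
              (\<forall>f\<in>L2. (AE x in lborel. set_integrable (surface_measure \<psi>) (hypersurface \<psi>)
                                        (T_integrand K \<phi>\<^sub>0 lam f (x, s)))
                     \<and> (\<lambda>x. T_op K \<phi>\<^sub>0 \<psi> lam f (x, s)) \<in> L2) \<and>
              L2_op_norm (\<lambda>f x. T_op K \<phi>\<^sub>0 \<psi> lam f (x, s))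
                \<le> ennreal (C * lam powr (- (m / 2) * (real CARD('n) / (real CARD('n) + 1))))
                   * (1 + Linf_norm (grad \<psi>)) * (1 + Linf_norm \<psi>))"
proof -
  interpret oscillatory_kernel m "m - real DIM(real ^ 'n)" "Suc DIM(real ^ 'n)" K \<phi>\<^sub>0
    by unfold_locales (use assms in simp_all)
  obtain C where C: "0 < C" "\<And>\<psi> lam s f. \<psi> \<in> borel_measurable borel \<Longrightarrow> 0 < lam \<Longrightarrow> f \<in> L2 \<Longrightarrow>
      (AE x in lborel. integrable lborel (\<lambda>y. kernel \<psi> lam s x y * f y)) \<and>
      (\<lambda>x. LINT y|lborel. kernel \<psi> lam s x y * f y) \<in> L2 \<and>
      L2_norm (\<lambda>x. LINT y|lborel. kernel \<psi> lam s x y * f y)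
        \<le> C * lam powr (- (m / 2) * (real DIM(real ^ 'n) / (real DIM(real ^ 'n) + 1))) * L2_norm f"
    by (rule kernel_operator_bound) blast
  show ?thesis
  proof (intro exI[of _ C] allI impI)
    fix \<psi> :: "real ^ 'n \<Rightarrow> real" and lam s :: real
    assume \<psi>: "smooth_on \<psi> UNIV" "\<forall>\<alpha>. bounded (range (multi_deriv \<alpha> \<psi>))" and lam: "0 < lam"
    have cont: "continuous_on UNIV \<psi>" "continuous_on UNIV (grad \<psi>)"
      using \<psi>(1) by (auto intro: smooth_on_imp_continuous_on grad_continuous)
    have meas: "\<psi> \<in> borel_measurable borel" "grad \<psi> \<in> borel_measurable borel"
      using cont by (auto intro: borel_measurable_continuous_onI)
    let ?J = "\<lambda>y. sqrt (1 + (norm (grad \<psi> y))\<^sup>2)"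
    let ?T = "\<lambda>f x. T_op K \<phi>\<^sub>0 \<psi> lam f (x, s)"
    let ?r = "lam powr (- (m / 2) * (real CARD('n) / (real CARD('n) + 1)))"
    define G where "G = enn2real (Linf_norm (grad \<psi>))"
    have G0: "0 \<le> G" by (simp add: G_def)
    obtain B where "\<And>y. norm (grad \<psi> y) \<le> B" using grad_bounded \<psi>(2) by blast
    note G = AE_le_Linf_norm[OF meas(2) this, folded G_def]
    have J_le: "AE y in lborel. \<bar>?J y\<bar> \<le> 1 + G"
      using G(1)
    proof eventually_elim
      case (elim y)
      have "1 + (norm (grad \<psi> y))\<^sup>2 \<le> (1 + norm (grad \<psi> y))\<^sup>2"
        by (simp add: power2_eq_square algebra_simps)
      then have "?J y \<le> 1 + norm (grad \<psi> y)" by (intro real_le_lsqrt) auto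
      then show ?case using elim by simp
    qed
    have J_meas: "?J \<in> borel_measurable borel" using meas(2) by measurable
    have main: "(AE x in lborel. set_integrable (surface_measure \<psi>) (hypersurface \<psi>) (T_integrand K \<phi>\<^sub>0 lam f (x, s)))
        \<and> ?T f \<in> L2 \<and> L2_norm (?T f) \<le> C * ?r * (1 + G) * L2_norm f" if f: "f \<in> L2" for f
    proof -
      let ?f = "\<lambda>y. of_real (?J y) * f y"
      have f': "?f \<in> L2" "L2_norm ?f \<le> (1 + G) * L2_norm f"
        using L2_multiplier[OF J_meas f _ J_le] G0 by auto
      note B = C(2)[OF meas(1) lam f'(1), of s]
      have Tm: "T_integrand K \<phi>\<^sub>0 lam f (x, s) \<in> borel_measurable borel" for x
      proof -
        have [measurable]: "(\<lambda>q. K (x - fst q, s - snd q)) \<in> borel_measurable (borel \<Otimes>\<^sub>M borel)"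
          by (rule measurable_compose[OF _ K_measurable]) (simp add: borel_prod[symmetric])
        have [measurable]: "(\<lambda>q. \<phi>\<^sub>0 ((x, s), fst q)) \<in> borel_measurable (borel \<Otimes>\<^sub>M borel)"
          by (rule measurable_compose[OF _ \<phi>_measurable]) (simp add: borel_prod[symmetric])
        note L2_measurable[OF f, measurable]
        have "T_integrand K \<phi>\<^sub>0 lam f (x, s) \<in> borel_measurable (borel \<Otimes>\<^sub>M borel)"
          unfolding T_integrand_def split_beta' by measurable
        then show ?thesis by (simp only: borel_prod)
      qed
      have eq: "of_real (?J y) * T_integrand K \<phi>\<^sub>0 lam f (x, s) (y, \<psi> y) = kernel \<psi> lam s x y * ?f y" for x y
        by (simp add: T_integrand_def kernel_def ac_simps)
      note P = surface_integral_pullback[OF cont Tm, unfolded eq]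
      have "?T f = (\<lambda>x. LINT y|lborel. kernel \<psi> lam s x y * ?f y)"
        unfolding T_op_def P(2) ..
      moreover have "C * ?r * L2_norm ?f \<le> C * ?r * ((1 + G) * L2_norm f)"
        using C(1) f'(2) by (intro mult_left_mono) auto
      ultimately show ?thesis using B unfolding P(1) by (auto simp: mult.assoc intro: order_trans)
    qed
    have "L2_op_norm ?T \<le> ennreal (C * ?r) * (1 + Linf_norm (grad \<psi>)) * (1 + Linf_norm \<psi>)"
      unfolding L2_op_norm_def
    proof (rule SUP_least)
      fix f :: "real ^ 'n \<Rightarrow> complex" assume "f \<in> {f \<in> L2. L2_norm f \<le> 1}"
      then have f: "f \<in> L2" "L2_norm f \<le> 1" by auto
      have "L2_norm (?T f) \<le> C * ?r * (1 + G) * L2_norm f" using main[OF f(1)] by blast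
      also have "\<dots> \<le> C * ?r * (1 + G)"
        using mult_left_mono[OF f(2), of "C * ?r * (1 + G)"] C(1) G0 by simp
      finally have "ennreal (L2_norm (?T f)) \<le> ennreal (C * ?r * (1 + G))" by (rule ennreal_leI)
      also have "\<dots> = ennreal (C * ?r) * ennreal (1 + G)"
        using C(1) G0 by (intro ennreal_mult) auto
      also have "ennreal (1 + G) = 1 + Linf_norm (grad \<psi>)"
        using G0 by (simp add: ennreal_plus G(2))
      also have "ennreal (C * ?r) * (1 + Linf_norm (grad \<psi>)) * 1
          \<le> ennreal (C * ?r) * (1 + Linf_norm (grad \<psi>)) * (1 + Linf_norm \<psi>)"
        by (rule mult_left_mono) auto
      finally show "ennreal (L2_norm (?T f)) \<le> ennreal (C * ?r) * (1 + Linf_norm (grad \<psi>)) * (1 + Linf_norm \<psi>)"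
        by simp
    qed
    then show "(\<forall>f\<in>L2. (AE x in lborel. set_integrable (surface_measure \<psi>) (hypersurface \<psi>) (T_integrand K \<phi>\<^sub>0 lam f (x, s)))
                     \<and> ?T f \<in> L2) \<and>
        L2_op_norm ?T \<le> ennreal (C * ?r) * (1 + Linf_norm (grad \<psi>)) * (1 + Linf_norm \<psi>)"
      using main by blast
  qed
qed

end
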